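(* Let $X$ be a finite $5$-large simplicial complex obtained by performing finitely many steps of the basic construction, starting with an initial complex $X_0$ which is a complex with $SD_2^{\ast}$ links. Then $X$ is a complex with $SD_2^{\ast}$ links and, consequently, the right-angled Coxeter group $W$ with nerve $X$ acts geometrically on a weakly systolic complex with $SD_2^{\ast}$ links.
   Context: Simplicial complexes. Flag: every finite set of pairwise adjacent vertices spans a simplex. Full subcomplex $A\subseteq X$: every set of vertices of $A$ contained in a simplex of $X$ is contained in a simplex of $A$. $j$-cycle ($j\ge4$): triangulation of the circle with $j$ edges. A flag complex is $5$-large if it has no $4$-cycle as a full subcomplex. The link $X_\sigma$ of a simplex $\sigma$ is the complex of simplices $\tau$ disjoint from $\sigma$ that together with $\sigma$ span a simplex. $B_i(v,X)$ and $S_i(v,X)$ are the combinatorial ball and sphere of radius $i$ about $v$ (full subcomplexes spanned by the vertices at $1$-skeleton distance $\le i$, resp. $=i$). A flag complex $X$ is weakly systolic if for every vertex $v$, every $i\ge1$ and every simplex $\sigma\subseteq S_{i+1}(v,X)$, the intersection $X_\sigma\cap B_i(v,X)$ is a nonempty simplex. A geometric action is a properly discontinuous and cocompact action by simplicial automorphisms. A $k$-wheel $(v_0;v_1,\dots,v_k)$ in $X$ is a full subcomplex such that $(v_1,\dots,v_k,v_1)$ is a $k$-cycle and $v_0$ is adjacent to all of $v_1,\dots,v_k$. A $k$-wheel with a pendant triangle $(v_0;v_1,\dots,v_k;t)$ is the union of a $k$-wheel and a triangle $\langle v_1,v_2,t\rangle\in X$ with $t\ne v_i$ for all $i$. A flag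 complex $X$ satisfies $SD_2^{\ast}$ if (a) it contains no $4$-wheel, and (b) for every $5$-wheel with a pendant triangle $\widehat W$ in $X$ there is a vertex $v$ with $\widehat W\subseteq B_1(v,X)$. A flag complex $X$ is a complex with $SD_2^{\ast}$ links if $X$ and each of its links satisfy $SD_2^{\ast}$. Right-angled Coxeter groups. A finite flag complex $X$ is the nerve of the right-angled Coxeter system $(W,S)$ with $S=X^{(0)}$, all $s^2=1$, and $(st)^2=1$ exactly when $\{s,t\}$ is an edge. A subset $T\subseteq S$ is spherical if the subgroup $W_T=\langle T\rangle$ is finite. The Davis complex $\Sigma=\Sigma(W,S)$ is the cubical complex with vertex set $W$ and cubes the cosets $wW_T$, $T$ spherical (its barycentric subdivision is the realization of the poset of these cosets). $K\subseteq\Sigma$ is the geometric realization of the poset of spherical subsets of $S$ ($T$ identified with $W_T$). For a cubical complex $Y$, the thickening $Th(Y)$ is the simplicial complex with the same vertices, in which a set of vertices spans a simplex iff it lies in a common cube of $Y$. One step of the basic construction. Input: a finite $5$-large complex $X$, with associated $(W,S)$ and $\Sigma$. Choose a torsion-free finite index subgroup $H<W$ such that $d(v,hv)\ge5$ for all vertices $v$ of $Th(\Sigma)$ and all $1\ne h\in H$, where $d$ is the path metric on $Th(\Sigma)^{(1)}$, and such that $Y=H\backslash\Sigma$ admits an orientation: with $p:\Sigma\to Y$ the quotient map, a function $\epsilon:\{p(wK):w\in W\}\to\{-1,1\}$ with $\epsilon(p(swK))=-\epsilon(p(wK))$ for all $w\in W$, $s\in S$. Output: the complex $X'=Th(Y)$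 (a finite $5$-large complex), to which the step may be applied again. The initial complex $X_0$ is a finite $5$-large simplicial complex. *)

theory Defs
  imports
    "HOL-Algebra.Group_Action"
    "HOL-Algebra.Generated_Groups"
    "HOL-Analysis.Function_Topology"
    "HOL-Library.Extended_Nat"
begin

section \<open>Simplicial complexes\<close>

text \<open>A simplicial complex is the set of its (finite, nonempty) simplices.  In particular the
  empty set is not a simplex, and the vertices are the points \<open>v\<close> with \<open>{v}\<close> a simplex.\<close>

definition simplicial_complex :: "'a set set \<Rightarrow> bool" where
  "simplicial_complex X \<longleftrightarrow>
     (\<forall>\<sigma>\<in>X. finite \<sigma> \<and> \<sigma> \<noteq> {}) \<and> (\<forall>\<sigma>\<in>X. \<forall>\<tau>. \<tau> \<noteq> {} \<and> \<tau> \<subseteq> \<sigma> \<longrightarrow> \<tau> \<in> X)"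

abbreviation (input) vertices :: "'a set set \<Rightarrow> 'a set" where
  "vertices X \<equiv> \<Union>X"

definition adjacent :: "'a set set \<Rightarrow> 'a \<Rightarrow> 'a \<Rightarrow> bool" where
  "adjacent X u v \<longleftrightarrow> u \<noteq> v \<and> {u, v} \<in> X"

definition flag_complex :: "'a set set \<Rightarrow> bool" where
  "flag_complex X \<longleftrightarrow> simplicial_complex X \<and>
     (\<forall>U. U \<subseteq> vertices X \<and> finite U \<and> U \<noteq> {} \<and> (\<forall>u\<in>U. \<forall>v\<in>U. u \<noteq> v \<longrightarrow> adjacent X u v)
        \<longrightarrow> U \<in> X)"

definition full_subcomplex :: "'a set set \<Rightarrow> 'a set set \<Rightarrow> bool" where
  "full_subcomplex A X \<longleftrightarrow> simplicial_complex A \<and> A \<subseteq> X \<and>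
     (\<forall>U. U \<subseteq> vertices A \<and> U \<noteq> {} \<and> (\<exists>\<sigma>\<in>X. U \<subseteq> \<sigma>) \<longrightarrow> (\<exists>\<tau>\<in>A. U \<subseteq> \<tau>))"

definition spanned_subcomplex :: "'a set set \<Rightarrow> 'a set \<Rightarrow> 'a set set" where
  "spanned_subcomplex X U = {\<sigma> \<in> X. \<sigma> \<subseteq> U}"

definition link :: "'a set set \<Rightarrow> 'a set \<Rightarrow> 'a set set" where
  "link X \<sigma> = {\<tau> \<in> X. \<tau> \<inter> \<sigma> = {} \<and> \<tau> \<union> \<sigma> \<in> X}"

definition simplicial_iso :: "'a set set \<Rightarrow> 'b set set \<Rightarrow> bool" where
  "simplicial_iso X Y \<longleftrightarrow> (\<exists>f. inj_on f (vertices X) \<and> (\<lambda>\<sigma>. f ` \<sigma>) ` X = Y)"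

text \<open>The path metric on the 1-skeleton; it is \<open>\<infinity>\<close> between different components.\<close>

definition skeleton_dist :: "'a set set \<Rightarrow> 'a \<Rightarrow> 'a \<Rightarrow> enat" where
  "skeleton_dist X u v = (INF n \<in> {n. ((adjacent X) ^^ n) u v}. enat n)"

definition comb_ball :: "nat \<Rightarrow> 'a \<Rightarrow> 'a set set \<Rightarrow> 'a set set" where
  "comb_ball i v X = spanned_subcomplex X {u \<in> vertices X. skeleton_dist X v u \<le> enat i}"

definition comb_sphere :: "nat \<Rightarrow> 'a \<Rightarrow> 'a set set \<Rightarrow> 'a set set" where
  "comb_sphere i v X = spanned_subcomplex X {u \<in> vertices X. skeleton_dist X v u = enat i}"

definition connected_complex :: "'a set set \<Rightarrow> bool" where
  "connected_complex X \<longleftrightarrow> X \<noteq> {} \<and> (\<forall>u\<in>vertices X. \<forall>v\<in>vertices X. skeleton_dist X u v < \<infinity>)"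


section \<open>Cycles, wheels and curvature conditions\<close>

definition cycle_complex :: "'a list \<Rightarrow> 'a set set" where
  "cycle_complex vs =
     {{vs ! i} | i. i < length vs} \<union> {{vs ! i, vs ! (Suc i mod length vs)} | i. i < length vs}"

definition is_cycle :: "nat \<Rightarrow> 'a set set \<Rightarrow> bool" where
  "is_cycle j C \<longleftrightarrow> 4 \<le> j \<and> (\<exists>vs. length vs = j \<and> distinct vs \<and> C = cycle_complex vs)"

definition five_large :: "'a set set \<Rightarrow> bool" where
  "five_large X \<longleftrightarrow> flag_complex X \<and> \<not> (\<exists>C. is_cycle 4 C \<and> full_subcomplex C X)"

definition wheel_complex :: "'a \<Rightarrow> 'a list \<Rightarrow> 'a set set" where
  "wheel_complex v0 vs = {{v0}} \<union> cycle_complex vs \<union> insert v0 ` cycle_complex vs"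

text \<open>The wheel itself is required to be full, so the rim has no chords in \<open>X\<close>.  The list \<open>vs\<close>
  holds \<open>v\<^sub>1, \<dots>, v\<^sub>k\<close>; thus \<open>v\<^sub>1 = vs ! 0\<close> and \<open>v\<^sub>2 = vs ! 1\<close> below.\<close>

definition is_wheel :: "'a set set \<Rightarrow> nat \<Rightarrow> 'a \<Rightarrow> 'a list \<Rightarrow> bool" where
  "is_wheel X k v0 vs \<longleftrightarrow>
     4 \<le> k \<and> length vs = k \<and> distinct (v0 # vs) \<and> full_subcomplex (wheel_complex v0 vs) X"

definition is_pendant_wheel :: "'a set set \<Rightarrow> nat \<Rightarrow> 'a \<Rightarrow> 'a list \<Rightarrow> 'a \<Rightarrow> bool" where
  "is_pendant_wheel X k v0 vs t \<longleftrightarrow>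
     is_wheel X k v0 vs \<and> t \<notin> set (v0 # vs) \<and> {vs ! 0, vs ! 1, t} \<in> X"

definition pendant_wheel_complex :: "'a \<Rightarrow> 'a list \<Rightarrow> 'a \<Rightarrow> 'a set set" where
  "pendant_wheel_complex v0 vs t = wheel_complex v0 vs \<union> (Pow {vs ! 0, vs ! 1, t} - {{}})"

definition SD2_star :: "'a set set \<Rightarrow> bool" where
  "SD2_star X \<longleftrightarrow> flag_complex X \<and>
     \<not> (\<exists>v0 vs. is_wheel X 4 v0 vs) \<and>
     (\<forall>v0 vs t. is_pendant_wheel X 5 v0 vs t \<longrightarrow>
        (\<exists>v\<in>vertices X. pendant_wheel_complex v0 vs t \<subseteq> comb_ball 1 v X))"

definition SD2_star_links :: "'a set set \<Rightarrow> bool" where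
  "SD2_star_links X \<longleftrightarrow> flag_complex X \<and> SD2_star X \<and> (\<forall>\<sigma>\<in>X. SD2_star (link X \<sigma>))"

text \<open>Weakly systolic complexes are connected (and nonempty) by convention: the sphere condition
  alone cannot see other components and holds, for instance, for every discrete set of points.\<close>

definition weakly_systolic :: "'a set set \<Rightarrow> bool" where
  "weakly_systolic X \<longleftrightarrow> flag_complex X \<and> connected_complex X \<and>
     (\<forall>v\<in>vertices X. \<forall>i\<ge>1. \<forall>\<sigma>\<in>comb_sphere (i + 1) v X.
        \<exists>\<tau>. \<tau> \<noteq> {} \<and> link X \<sigma> \<inter> comb_ball i v X = Pow \<tau> - {{}})"


section \<open>Geometric actions\<close>

text \<open>Geometric realization: points are given by barycentric coordinates, and a set is open iff it
  meets every closed simplex in a relatively open set (weak topology).\<close>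

definition support :: "('a \<Rightarrow> real) \<Rightarrow> 'a set" where
  "support x = {v. x v \<noteq> 0}"

definition realization :: "'a set set \<Rightarrow> ('a \<Rightarrow> real) set" where
  "realization X = {x. support x \<in> X \<and> (\<forall>v. 0 \<le> x v) \<and> (\<Sum>v\<in>support x. x v) = 1}"

definition closed_simplex :: "'a set set \<Rightarrow> 'a set \<Rightarrow> ('a \<Rightarrow> real) set" where
  "closed_simplex X \<sigma> = {x \<in> realization X. support x \<subseteq> \<sigma>}"

definition realization_topology :: "'a set set \<Rightarrow> ('a \<Rightarrow> real) topology" where
  "realization_topology X = topology (\<lambda>U. U \<subseteq> realization X \<and>
     (\<forall>\<sigma>\<in>X. openin (top_of_set (closed_simplex X \<sigma>)) (U \<inter> closed_simplex X \<sigma>)))"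

text \<open>The affine extension of a vertex map to the realization.\<close>

definition realization_map :: "('a \<Rightarrow> 'b) \<Rightarrow> ('a \<Rightarrow> real) \<Rightarrow> ('b \<Rightarrow> real)" where
  "realization_map f x = (\<lambda>u. \<Sum>v | v \<in> support x \<and> f v = u. x v)"

definition geometric_action ::
    "('g, 'm) monoid_scheme \<Rightarrow> 'a set set \<Rightarrow> ('g \<Rightarrow> 'a \<Rightarrow> 'a) \<Rightarrow> bool" where
  "geometric_action G X \<phi> \<longleftrightarrow>
     simplicial_complex X \<and>
     group_action G (vertices X) \<phi> \<and>
     (\<forall>g\<in>carrier G. (\<lambda>\<sigma>. \<phi> g ` \<sigma>) ` X = X) \<and>
     (\<forall>K. compactin (realization_topology X) K \<longrightarrow>
        finite {g \<in> carrier G. realization_map (\<phi> g) ` K \<inter> K \<noteq> {}}) \<and>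
     (\<exists>K. compactin (realization_topology X) K \<and>
        (\<Union>g\<in>carrier G. realization_map (\<phi> g) ` K) = realization X)"


section \<open>Right-angled Coxeter groups and Davis complexes\<close>

text \<open>The group with generators the vertices of \<open>X\<close> and relators \<open>s\<^sup>2\<close> for all \<open>s\<close> and \<open>(st)\<^sup>2\<close> for all
  edges \<open>{s, t}\<close>.  Generators being involutions, formal inverses are not needed, and the group
  consists of classes of positive words.\<close>

inductive racg_eq :: "'a set set \<Rightarrow> 'a list \<Rightarrow> 'a list \<Rightarrow> bool" for X where
  refl: "racg_eq X xs xs"
| sym: "racg_eq X xs ys \<Longrightarrow> racg_eq X ys xs"
| trans: "racg_eq X xs ys \<Longrightarrow> racg_eq X ys zs \<Longrightarrow> racg_eq X xs zs"
| square: "s \<in> vertices X \<Longrightarrow> racg_eq X (xs @ [s, s] @ ys) (xs @ ys)"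
| edge: "adjacent X s t \<Longrightarrow> racg_eq X (xs @ [s, t, s, t] @ ys) (xs @ ys)"

definition racg_rel :: "'a set set \<Rightarrow> ('a list \<times> 'a list) set" where
  "racg_rel X = {(xs, ys). xs \<in> lists (vertices X) \<and> ys \<in> lists (vertices X) \<and> racg_eq X xs ys}"

definition racg :: "'a set set \<Rightarrow> 'a list set monoid" where
  "racg X =
     \<lparr>carrier = lists (vertices X) // racg_rel X,
      mult = (\<lambda>A B. \<Union>xs\<in>A. \<Union>ys\<in>B. racg_rel X `` {xs @ ys}),
      one = racg_rel X `` {[]}\<rparr>"

definition racg_gen :: "'a set set \<Rightarrow> 'a \<Rightarrow> 'a list set" where
  "racg_gen X s = racg_rel X `` {[s]}"

definition special_subgroup :: "'a set set \<Rightarrow> 'a set \<Rightarrow> 'a list set set" where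
  "special_subgroup X T = generate (racg X) (racg_gen X ` T)"

definition spherical :: "'a set set \<Rightarrow> 'a set \<Rightarrow> bool" where
  "spherical X T \<longleftrightarrow> T \<subseteq> vertices X \<and> finite (special_subgroup X T)"

text \<open>A cubical complex is recorded as the family of vertex sets of its cubes; vertices are cubes
  of dimension 0.\<close>

definition davis_complex :: "'a set set \<Rightarrow> 'a list set set set" where
  "davis_complex X = {w <#\<^bsub>racg X\<^esub> special_subgroup X T | w T. w \<in> carrier (racg X) \<and> spherical X T}"

definition thickening :: "'v set set \<Rightarrow> 'v set set" where
  "thickening Y = {\<sigma>. \<sigma> \<noteq> {} \<and> (\<exists>c\<in>Y. \<sigma> \<subseteq> c)}"

text \<open>The quotient of \<open>\<Sigma>\<close> by the left action of \<open>H\<close>: its vertices are the orbits \<open>Hw\<close>,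
  its cubes the images of the cubes of \<open>\<Sigma>\<close> (which embed for the subgroups used below).\<close>

definition davis_quotient :: "'a set set \<Rightarrow> 'a list set set \<Rightarrow> 'a list set set set set" where
  "davis_quotient X H = (\<lambda>c. (\<lambda>v. H #>\<^bsub>racg X\<^esub> v) ` c) ` davis_complex X"

text \<open>Orientations.  Subcomplexes of the barycentric subdivision of \<open>\<Sigma>\<close> are sets of finite chains
  of cosets \<open>wW\<^sub>T\<close>, and the projection \<open>p\<close> sends the barycentre of a cube \<open>c\<close> to that of its
  \<open>H\<close>-orbit.\<close>

definition order_complex :: "'p set set \<Rightarrow> 'p set set set" where
  "order_complex P = {C. C \<subseteq> P \<and> C \<noteq> {} \<and> finite C \<and> (\<forall>a\<in>C. \<forall>b\<in>C. a \<subseteq> b \<or> b \<subseteq> a)}"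

definition davis_chamber :: "'a set set \<Rightarrow> 'a list set set set set" where
  "davis_chamber X = order_complex {special_subgroup X T | T. spherical X T}"

definition translated_chamber :: "'a set set \<Rightarrow> 'a list set \<Rightarrow> 'a list set set set set" where
  "translated_chamber X w = (\<lambda>C. (\<lambda>c. w <#\<^bsub>racg X\<^esub> c) ` C) ` davis_chamber X"

definition cube_orbit ::
    "'a set set \<Rightarrow> 'a list set set \<Rightarrow> 'a list set set \<Rightarrow> 'a list set set set" where
  "cube_orbit X H c = {h <#\<^bsub>racg X\<^esub> c | h. h \<in> H}"

definition projected_chamber ::
    "'a set set \<Rightarrow> 'a list set set \<Rightarrow> 'a list set \<Rightarrow> 'a list set set set set set" where
  "projected_chamber X H w = (\<lambda>C. cube_orbit X H ` C) ` translated_chamber X w"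

definition orientable_quotient :: "'a set set \<Rightarrow> 'a list set set \<Rightarrow> bool" where
  "orientable_quotient X H \<longleftrightarrow> (\<exists>\<epsilon> :: 'a list set set set set set \<Rightarrow> int.
     (\<forall>w\<in>carrier (racg X). \<epsilon> (projected_chamber X H w) \<in> {-1, 1}) \<and>
     (\<forall>w\<in>carrier (racg X). \<forall>s\<in>vertices X.
        \<epsilon> (projected_chamber X H (racg_gen X s \<otimes>\<^bsub>racg X\<^esub> w)) = - \<epsilon> (projected_chamber X H w)))"


section \<open>The basic construction\<close>

definition admissible_subgroup :: "'a set set \<Rightarrow> 'a list set set \<Rightarrow> bool" where
  "admissible_subgroup X H \<longleftrightarrow>
     subgroup H (racg X) \<and>
     finite (rcosets\<^bsub>racg X\<^esub> H) \<and>
     (\<forall>h\<in>H. h \<noteq> \<one>\<^bsub>racg X\<^esub> \<longrightarrow> (\<forall>n::nat. n > 0 \<longrightarrow> h [^]\<^bsub>racg X\<^esub> n \<noteq> \<one>\<^bsub>racg X\<^esub>)) \<and>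
     (\<forall>v\<in>vertices (thickening (davis_complex X)). \<forall>h\<in>H. h \<noteq> \<one>\<^bsub>racg X\<^esub> \<longrightarrow>
        5 \<le> skeleton_dist (thickening (davis_complex X)) v (h \<otimes>\<^bsub>racg X\<^esub> v)) \<and>
     orientable_quotient X H"

definition basic_step :: "'a set set \<Rightarrow> 'b set set \<Rightarrow> bool" where
  "basic_step X X' \<longleftrightarrow> finite X \<and> five_large X \<and>
     (\<exists>H. admissible_subgroup X H \<and> simplicial_iso (thickening (davis_quotient X H)) X')"

text \<open>The vertex type of the complex grows with each step.  As all complexes involved are finite,
  the iteration is carried out on isomorphic copies with vertices in \<^typ>\<open>nat\<close>.\<close>

definition obtained_by_basic_steps :: "'a set set \<Rightarrow> 'b set set \<Rightarrow> bool" where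
  "obtained_by_basic_steps X0 X \<longleftrightarrow> (\<exists>(A :: nat set set) (B :: nat set set).
     simplicial_iso X0 A \<and> basic_step\<^sup>*\<^sup>* A B \<and> simplicial_iso B X)"

end

theory Submission
  imports Defs
begin

text \<open>The neighbours of a vertex \<open>A\<close> of \<open>Th(\<Sigma>)\<close> are the elements \<open>A w\<^sub>\<sigma>\<close>, where \<open>w\<^sub>\<sigma>\<close> is the product of the
  vertices of a simplex \<open>\<sigma>\<close> of \<open>X\<close>, and \<open>A w\<^sub>\<sigma>\<close>, \<open>A w\<^sub>\<tau>\<close> are adjacent iff \<open>\<sigma> \<union> \<tau>\<close> is a simplex.  So
  cycles in links of \<open>Th(\<Sigma>)\<close> are cycles of simplices of \<open>X\<close>; when \<open>X\<close> is 5-large, one can pick from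
  each simplex of a full 5-cycle a vertex whose set of non-neighbours is largest, and these vertices
  form a full 5-cycle in \<open>X\<close>.  This turns \<open>SD\<^sub>2\<^sup>*\<close> for \<open>X\<close> and its links into \<open>SD\<^sub>2\<^sup>*\<close> for \<open>Th(\<Sigma>)\<close> and its links.
  The quotient map \<open>Th(\<Sigma>) \<rightarrow> Th(Y)\<close> is a covering that is injective on small balls, so the
  condition descends to \<open>Th(Y)\<close>.

  Weak systolicity needs the word metric: an element of \<open>W\<close> is encoded by a heap of pieces, i.e. each
  letter of a word falls to the lowest layer allowed by the letters it does not commute with, and
  cancels if it lands on a copy of itself.  The distance from \<open>1\<close> in \<open>Th(\<Sigma>)\<close> is the number of layers.\<close>

section \<open>Flag complexes\<close>

text \<open>The two kinds of links draw on different sources. In Th(\<Sigma>) itself the pendant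
  vertex may fail to be a neighbour of the hub, so the hub attaches no simplex of \<open>X\<close>
  to it; the cone vertex is written down explicitly and squares in \<open>X\<close> supply its
  edges. In the link of a nonempty simplex \<open>R\<close> every vertex, the pendant one included,
  is a neighbour of any \<open>A\<close> in \<open>R\<close>. The whole picture then becomes one of
  simplices of \<open>X\<close> joined to a fixed simplex \<rho>, and the cone vertex comes from
  \<open>SD2_star\<close> for the link of \<rho>. For \<open>R = {A}\<close> the simplex \<rho> is
  empty: \<open>X\<close> itself reappears inside a vertex link. This is why the empty simplex is
  carried along.

  Adjacency is mostly expressed by \<open>{u, v} \<in> X\<close>, which includes
  \<open>u = v\<close>. A constructed cone vertex may coincide with a vertex of the wheel, and
  distinctness of wheel vertices follows from the missing diagonals.

  The heap serves twice: its number of pieces is the word length, which solves the word problem and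
  selects minimal coset elements, while its number of layers is the distance in
  Th(\<Sigma>).\<close>

lemma flag_simplexD:
  assumes "flag_complex X" "\<sigma> \<in> X"
  shows "finite \<sigma>" "\<sigma> \<noteq> {}" "\<And>\<tau>. \<tau> \<subseteq> \<sigma> \<Longrightarrow> \<tau> \<noteq> {} \<Longrightarrow> \<tau> \<in> X" "\<And>u v. u \<in> \<sigma> \<Longrightarrow> v \<in> \<sigma> \<Longrightarrow> {u, v} \<in> X"
proof -
  have *: "\<forall>\<sigma>\<in>X. finite \<sigma> \<and> \<sigma> \<noteq> {}" "\<forall>\<sigma>\<in>X. \<forall>\<tau>. \<tau> \<noteq> {} \<and> \<tau> \<subseteq> \<sigma> \<longrightarrow> \<tau> \<in> X"
    using assms(1) unfolding flag_complex_def simplicial_complex_def by blast+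
  show "finite \<sigma>" "\<sigma> \<noteq> {}" using *(1) assms(2) by blast+
  show sub: "\<tau> \<in> X" if "\<tau> \<subseteq> \<sigma>" "\<tau> \<noteq> {}" for \<tau> using *(2) assms(2) that by blast
  show "{u, v} \<in> X" if "u \<in> \<sigma>" "v \<in> \<sigma>" for u v using sub[of "{u, v}"] that by simp
qed

lemma flag_simplex_iff:
  assumes "flag_complex X"
  shows "U \<in> X \<longleftrightarrow> finite U \<and> U \<noteq> {} \<and> (\<forall>u\<in>U. \<forall>v\<in>U. {u, v} \<in> X)"
proof
  assume "U \<in> X"
  then show "finite U \<and> U \<noteq> {} \<and> (\<forall>u\<in>U. \<forall>v\<in>U. {u, v} \<in> X)"
    using flag_simplexD[OF assms \<open>U \<in> X\<close>] by simp
next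
  assume *: "finite U \<and> U \<noteq> {} \<and> (\<forall>u\<in>U. \<forall>v\<in>U. {u, v} \<in> X)"
  then have "U \<subseteq> \<Union>X" by blast
  with * show "U \<in> X" using assms unfolding flag_complex_def adjacent_def by blast
qed

lemma flag_simplex_empty_iff:
  assumes "flag_complex X"
  shows "U \<in> insert {} X \<longleftrightarrow> finite U \<and> (\<forall>u\<in>U. \<forall>v\<in>U. {u, v} \<in> X)"
  using flag_simplex_iff[OF assms, of U] by (cases "U = {}") simp_all

lemma flag_vertex:
  assumes "flag_complex X"
  shows "v \<in> \<Union>X \<longleftrightarrow> {v} \<in> X"
  using flag_simplexD(3)[OF assms, of _ "{v}"] by blast

lemma flag_edge_refl:
  assumes "flag_complex X" "{u, v} \<in> X"
  shows "{u} \<in> X" "{v} \<in> X"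
  using flag_simplexD(3)[OF assms] by auto

lemma flag_complexI:
  assumes "\<And>\<sigma>. \<sigma> \<in> X \<Longrightarrow> finite \<sigma> \<and> \<sigma> \<noteq> {}"
    and "\<And>\<sigma> \<tau>. \<sigma> \<in> X \<Longrightarrow> \<tau> \<subseteq> \<sigma> \<Longrightarrow> \<tau> \<noteq> {} \<Longrightarrow> \<tau> \<in> X"
    and "\<And>U. finite U \<Longrightarrow> U \<noteq> {} \<Longrightarrow> (\<And>u v. u \<in> U \<Longrightarrow> v \<in> U \<Longrightarrow> {u, v} \<in> X) \<Longrightarrow> U \<in> X"
  shows "flag_complex X"
  unfolding flag_complex_def simplicial_complex_def
proof (intro conjI ballI allI impI)
  fix U assume U: "U \<subseteq> \<Union>X \<and> finite U \<and> U \<noteq> {} \<and> (\<forall>u\<in>U. \<forall>v\<in>U. u \<noteq> v \<longrightarrow> adjacent X u v)"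
  have "{u, v} \<in> X" if "u \<in> U" "v \<in> U" for u v
  proof (cases "u = v")
    case True
    from that U obtain \<sigma> where "\<sigma> \<in> X" "u \<in> \<sigma>" by blast
    with True show ?thesis using assms(2)[of \<sigma> "{u}"] by simp
  next
    case False then show ?thesis using U that unfolding adjacent_def by blast
  qed
  with U show "U \<in> X" using assms(3) by blast
qed (use assms(1,2) in blast)+

text \<open>Flagness reduces membership in a link to pairs. Admitting \<open>\<rho> = {}\<close>
  lets \<open>X\<close> be treated as the link of the empty simplex.\<close>

lemma link_edge_iff:
  assumes X: "flag_complex X" and \<rho>: "\<rho> \<in> insert {} X"
  shows "{u, v} \<in> link X \<rho> \<longleftrightarrow>
    {u, v} \<in> X \<and> u \<notin> \<rho> \<and> v \<notin> \<rho> \<and> (\<forall>r\<in>\<rho>. {u, r} \<in> X \<and> {v, r} \<in> X)"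
proof -
  have r: "finite \<rho>" "\<And>x y. x \<in> \<rho> \<Longrightarrow> y \<in> \<rho> \<Longrightarrow> {x, y} \<in> X"
    using \<rho> flag_simplex_empty_iff[OF X, of \<rho>] by blast+
  have "{u, v} \<union> \<rho> \<in> X \<longleftrightarrow> {u, v} \<in> X \<and> (\<forall>r\<in>\<rho>. {u, r} \<in> X \<and> {v, r} \<in> X)" (is "?L \<longleftrightarrow> ?R")
  proof
    assume ?L
    then show ?R using flag_simplexD(4)[OF X \<open>?L\<close>] by blast
  next
    assume R: ?R
    have "{x, y} \<in> X" if xy: "x \<in> {u, v} \<union> \<rho>" "y \<in> {u, v} \<union> \<rho>" for x y
    proof -
      have "{u, u} \<in> X" "{v, v} \<in> X" "{v, u} \<in> X"
        using R flag_edge_refl[OF X, of u v] by (auto simp: insert_commute)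
      then show ?thesis using R r(2) xy by (auto simp: insert_commute)
    qed
    then show ?L using r(1) flag_simplex_iff[OF X, of "{u, v} \<union> \<rho>"] by blast
  qed
  then show ?thesis unfolding link_def by auto
qed

lemma flag_link:
  assumes X: "flag_complex X" and \<rho>: "\<rho> \<in> insert {} X"
  shows "flag_complex (link X \<rho>)"
proof (rule flag_complexI)
  fix \<sigma> assume "\<sigma> \<in> link X \<rho>"
  then show "finite \<sigma> \<and> \<sigma> \<noteq> {}" unfolding link_def using flag_simplexD[OF X] by blast
next
  fix \<sigma> \<tau> assume s: "\<sigma> \<in> link X \<rho>" "\<tau> \<subseteq> \<sigma>" "\<tau> \<noteq> {}"
  then have "\<tau> \<in> X" "\<tau> \<inter> \<rho> = {}" unfolding link_def using flag_simplexD[OF X] by blast+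
  moreover have "\<tau> \<union> \<rho> \<subseteq> \<sigma> \<union> \<rho>" "\<tau> \<union> \<rho> \<noteq> {}" "\<sigma> \<union> \<rho> \<in> X" using s unfolding link_def by auto
  then have "\<tau> \<union> \<rho> \<in> X" using flag_simplexD(3)[OF X] by metis
  ultimately show "\<tau> \<in> link X \<rho>" unfolding link_def by blast
next
  fix U assume U: "finite U" "U \<noteq> {}" and e: "\<And>u v. u \<in> U \<Longrightarrow> v \<in> U \<Longrightarrow> {u, v} \<in> link X \<rho>"
  have e': "\<And>u v. u \<in> U \<Longrightarrow> v \<in> U \<Longrightarrow> {u, v} \<in> X \<and> u \<notin> \<rho> \<and> v \<notin> \<rho> \<and> (\<forall>r\<in>\<rho>. {u, r} \<in> X \<and> {v, r} \<in> X)"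
    using e link_edge_iff[OF X \<rho>] by blast
  have "\<forall>u\<in>U. \<forall>v\<in>U. {u, v} \<in> X" using e' by blast
  then have "U \<in> X" using U flag_simplex_iff[OF X, of U] by blast
  moreover have "u \<notin> \<rho>" if "u \<in> U" for u using e'[OF that that] by blast
  then have "U \<inter> \<rho> = {}" by blast
  moreover have "{x, y} \<in> X" if xy: "x \<in> U \<union> \<rho>" "y \<in> U \<union> \<rho>" for x y
  proof -
    consider "x \<in> U" "y \<in> U" | "x \<in> U" "y \<in> \<rho>" | "y \<in> U" "x \<in> \<rho>" | "x \<in> \<rho>" "y \<in> \<rho>"
      using xy by blast
    then show ?thesis
    proof cases
      case 3 then show ?thesis using e'[of y y] by (simp add: insert_commute)
    next
      case 4 then show ?thesis using \<rho> flag_simplex_empty_iff[OF X, of \<rho>] by blast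
    qed (use e'[of x y] e'[of x x] in simp_all)
  qed
  then have "U \<union> \<rho> \<in> X"
    using \<rho> U(1,2) flag_simplex_iff[OF X, of "U \<union> \<rho>"] flag_simplex_empty_iff[OF X, of \<rho>] by blast
  ultimately show "U \<in> link X \<rho>" unfolding link_def by blast
qed

lemma link_empty: "flag_complex X \<Longrightarrow> link X {} = X"
  unfolding link_def by auto

section \<open>Wheels as patterns of edges and non-edges\<close>

lemma wheel_complex_alt:
  assumes "vs \<noteq> []"
  shows "wheel_complex v0 vs =
    {\<tau>. \<tau> \<noteq> {} \<and> (\<exists>i<length vs. \<tau> \<subseteq> {v0, vs ! i, vs ! (Suc i mod length vs)})}" (is "?L = ?R")
proof
  let ?k = "length vs"
  have k: "0 < ?k" using assms by simp
  show "?L \<subseteq> ?R"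
    unfolding wheel_complex_def cycle_complex_def using k by auto
  show "?R \<subseteq> ?L"
  proof
    fix \<tau> assume "\<tau> \<in> ?R"
    then obtain i where i: "i < ?k" "\<tau> \<noteq> {}" "\<tau> \<subseteq> {v0, vs ! i, vs ! (Suc i mod ?k)}" by blast
    let ?x = "vs ! i" and ?y = "vs ! (Suc i mod ?k)"
    have m: "Suc i mod ?k < ?k" using k by simp
    have c: "{?x} \<in> cycle_complex vs" "{?y} \<in> cycle_complex vs" "{?x, ?y} \<in> cycle_complex vs"
      unfolding cycle_complex_def using i m by blast+
    have s: "\<tau> - {v0} \<in> Pow {?x, ?y}" using i by blast
    have "\<tau> - {v0} \<in> {{}, {?x}, {?y}, {?x, ?y}}" using s unfolding Pow_insert Pow_empty by blast
    then have "\<tau> - {v0} = {} \<or> \<tau> - {v0} \<in> cycle_complex vs" using c by (elim insertE) simp_all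
    moreover have "\<tau> = \<tau> - {v0} \<or> \<tau> = insert v0 (\<tau> - {v0})" by blast
    ultimately consider "\<tau> = {v0}" | "\<tau> \<in> cycle_complex vs" | "\<tau> \<in> insert v0 ` cycle_complex vs"
      using i(2) by (metis image_eqI)
    then show "\<tau> \<in> ?L" unfolding wheel_complex_def by cases simp_all
  qed
qed

lemma simplicial_wheel_complex:
  assumes "vs \<noteq> []"
  shows "simplicial_complex (wheel_complex v0 vs)"
  unfolding simplicial_complex_def wheel_complex_alt[OF assms]
proof (intro conjI ballI allI impI)
  fix \<sigma> assume "\<sigma> \<in> {\<tau>. \<tau> \<noteq> {} \<and> (\<exists>i<length vs. \<tau> \<subseteq> {v0, vs ! i, vs ! (Suc i mod length vs)})}"
  then show "finite \<sigma>" "\<sigma> \<noteq> {}" by (auto intro: finite_subset)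
qed blast

lemma wheel_complex_vertices:
  assumes "vs \<noteq> []"
  shows "\<Union>(wheel_complex v0 vs) = insert v0 (set vs)" (is "?L = ?R")
proof
  have k: "0 < length vs" using assms by simp
  then have m: "Suc i mod length vs < length vs" for i by simp
  show "?L \<subseteq> ?R"
    unfolding wheel_complex_alt[OF assms] using nth_mem[OF m] by fastforce
  have "v \<in> ?L" if v: "v = v0 \<or> v \<in> set vs" for v
  proof -
    obtain i where i: "i < length vs" "v = v0 \<or> v = vs ! i"
      using v k by (auto simp: in_set_conv_nth)
    then have "{v} \<in> wheel_complex v0 vs" unfolding wheel_complex_alt[OF assms] by auto
    then show ?thesis by blast
  qed
  then show "?R \<subseteq> ?L" by blast
qed

text \<open>For \<open>u = v\<close> the condition \<open>{u, v} \<in> X\<close> only says that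
  \<open>u\<close> is a vertex. The two non-edges still force the five vertices to be distinct: an
  equality between two of them would turn a missing diagonal into an edge or a vertex of
  \<open>X\<close>.\<close>

definition wheel4 :: "'a set set \<Rightarrow> 'a \<Rightarrow> 'a \<Rightarrow> 'a \<Rightarrow> 'a \<Rightarrow> 'a \<Rightarrow> bool" where
  "wheel4 X z a b c d \<longleftrightarrow> {z, a} \<in> X \<and> {z, b} \<in> X \<and> {z, c} \<in> X \<and> {z, d} \<in> X \<and>
     {a, b} \<in> X \<and> {b, c} \<in> X \<and> {c, d} \<in> X \<and> {d, a} \<in> X \<and> {a, c} \<notin> X \<and> {b, d} \<notin> X"

definition cycle5 :: "'a set set \<Rightarrow> 'a \<Rightarrow> 'a \<Rightarrow> 'a \<Rightarrow> 'a \<Rightarrow> 'a \<Rightarrow> bool" where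
  "cycle5 X a b c d e \<longleftrightarrow>
     {a, b} \<in> X \<and> {b, c} \<in> X \<and> {c, d} \<in> X \<and> {d, e} \<in> X \<and> {e, a} \<in> X \<and>
     {a, c} \<notin> X \<and> {b, d} \<notin> X \<and> {c, e} \<notin> X \<and> {d, a} \<notin> X \<and> {e, b} \<notin> X"

text \<open>The vertex \<open>v\<close> may belong to \<open>U\<close>, just as the centre belongs
  to its ball of radius 1.\<close>

definition coned :: "'a set set \<Rightarrow> 'a \<Rightarrow> 'a set \<Rightarrow> bool" where
  "coned X v U \<longleftrightarrow> (\<forall>u\<in>U. {v, u} \<in> X)"

lemma ex_less_4: "(\<exists>i<4. P i) \<longleftrightarrow> P 0 \<or> P (1::nat) \<or> P 2 \<or> P 3"
  using less_Suc_eq by (auto simp: numeral_eq_Suc)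

lemma ex_less_5: "(\<exists>i<5. P i) \<longleftrightarrow> P 0 \<or> P (1::nat) \<or> P 2 \<or> P 3 \<or> P 4"
  by (auto simp: numeral_eq_Suc less_Suc_eq)

lemma wheel_complex_4:
  "wheel_complex z [a, b, c, d] =
    {\<tau>. \<tau> \<noteq> {} \<and> (\<tau> \<subseteq> {z, a, b} \<or> \<tau> \<subseteq> {z, b, c} \<or> \<tau> \<subseteq> {z, c, d} \<or> \<tau> \<subseteq> {z, d, a})}"
proof -
  have l: "length [a, b, c, d] = 4" by simp
  show ?thesis
    by (subst wheel_complex_alt) (simp_all only: l ex_less_4, simp_all)
qed

lemma wheel_complex_5:
  "wheel_complex z [a, b, c, d, e] =
    {\<tau>. \<tau> \<noteq> {} \<and> (\<tau> \<subseteq> {z, a, b} \<or> \<tau> \<subseteq> {z, b, c} \<or> \<tau> \<subseteq> {z, c, d} \<or> \<tau> \<subseteq> {z, d, e} \<or> \<tau> \<subseteq> {z, e, a})}"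
proof -
  have l: "length [a, b, c, d, e] = 5" by simp
  show ?thesis
    by (subst wheel_complex_alt) (simp_all only: l ex_less_5, simp_all)
qed

lemma flag_triangle:
  assumes X: "flag_complex X" and e: "{a, b} \<in> X" "{a, c} \<in> X" "{b, c} \<in> X"
  shows "{a, b, c} \<in> X"
proof -
  have "{a} \<in> X" "{b} \<in> X" "{c} \<in> X" using e flag_edge_refl[OF X] by blast+
  then have "\<forall>u\<in>{a, b, c}. \<forall>v\<in>{a, b, c}. {u, v} \<in> X" using e by (simp add: insert_commute)
  then show ?thesis using flag_simplex_iff[OF X, of "{a, b, c}"] by simp
qed

text \<open>A simplex of \<open>X\<close> on the vertices of the wheel that contains neither
  diagonal lies in one of the four triangles, and these are simplices by flagness. So fullness
  amounts to the two missing diagonals.\<close>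

lemma is_wheel_4_iff:
  assumes X: "flag_complex X"
  shows "is_wheel X 4 z vs \<longleftrightarrow> (\<exists>a b c d. vs = [a, b, c, d] \<and> wheel4 X z a b c d)"
proof
  assume w: "is_wheel X 4 z vs"
  then obtain a b c d where vs: "vs = [a, b, c, d]"
    unfolding is_wheel_def by (auto simp: numeral_eq_Suc length_Suc_conv)
  let ?A = "wheel_complex z [a, b, c, d]"
  have vert: "\<Union>?A = {z, a, b, c, d}" using wheel_complex_vertices[of "[a, b, c, d]" z] by simp
  have dist: "distinct [z, a, b, c, d]" and full: "full_subcomplex ?A X"
    using w unfolding is_wheel_def vs by auto
  have sub: "?A \<subseteq> X" using full unfolding full_subcomplex_def by blast
  have "\<forall>U. U \<subseteq> \<Union>?A \<and> U \<noteq> {} \<and> (\<exists>\<sigma>\<in>X. U \<subseteq> \<sigma>) \<longrightarrow> (\<exists>\<tau>\<in>?A. U \<subseteq> \<tau>)"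
    using full unfolding full_subcomplex_def by (elim conjE)
  then have full': "\<exists>\<tau>\<in>?A. U \<subseteq> \<tau>" if "U \<subseteq> {z, a, b, c, d}" "U \<noteq> {}" "U \<in> X" for U
    unfolding vert using that by (metis order_refl)
  have "{a, c} \<notin> X" using full'[of "{a, c}"] dist unfolding wheel_complex_4 by auto
  moreover have "{b, d} \<notin> X" using full'[of "{b, d}"] dist unfolding wheel_complex_4 by auto
  moreover have m: "\<tau> \<in> X" if "\<tau> \<noteq> {}" "\<tau> \<subseteq> {z, a, b} \<or> \<tau> \<subseteq> {z, b, c} \<or> \<tau> \<subseteq> {z, c, d} \<or> \<tau> \<subseteq> {z, d, a}" for \<tau>
    using sub that unfolding wheel_complex_4 by blast
  have "{z, a} \<in> X" "{z, b} \<in> X" "{z, c} \<in> X" "{z, d} \<in> X" "{a, b} \<in> X" "{b, c} \<in> X" "{c, d} \<in> X" "{d, a} \<in> X"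
    by (rule m; simp)+
  ultimately show "\<exists>a b c d. vs = [a, b, c, d] \<and> wheel4 X z a b c d"
    using vs unfolding wheel4_def by blast
next
  assume "\<exists>a b c d. vs = [a, b, c, d] \<and> wheel4 X z a b c d"
  then obtain a b c d where vs: "vs = [a, b, c, d]" and w: "wheel4 X z a b c d" by blast
  let ?A = "wheel_complex z [a, b, c, d]"
  note E = flag_edge_refl[OF X]
  have e: "{z, a} \<in> X" "{z, b} \<in> X" "{z, c} \<in> X" "{z, d} \<in> X"
     "{a, b} \<in> X" "{b, c} \<in> X" "{c, d} \<in> X" "{d, a} \<in> X" and ne: "{a, c} \<notin> X" "{b, d} \<notin> X"
    using w unfolding wheel4_def by auto
  have dist: "distinct [z, a, b, c, d]"
    using e ne E[OF e(3)] E[OF e(4)] by (auto simp: insert_commute)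
  have tri: "{z, a, b} \<in> X" "{z, b, c} \<in> X" "{z, c, d} \<in> X" "{z, d, a} \<in> X"
    using e by (auto intro!: flag_triangle[OF X] simp: insert_commute)
  have "?A \<subseteq> X" unfolding wheel_complex_4 using tri flag_simplexD(3)[OF X] by blast
  moreover have "\<exists>\<tau>\<in>?A. U \<subseteq> \<tau>" if U: "U \<subseteq> \<Union>?A" "U \<noteq> {}" "\<exists>\<sigma>\<in>X. U \<subseteq> \<sigma>" for U
  proof -
    have UX: "U \<in> X" using U flag_simplexD(3)[OF X] by blast
    have "\<not> (a \<in> U \<and> c \<in> U)" "\<not> (b \<in> U \<and> d \<in> U)" using flag_simplexD(4)[OF X UX] ne by blast+
    moreover have "U \<subseteq> {z, a, b, c, d}" using U(1) wheel_complex_vertices[of "[a,b,c,d]" z] by simp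
    ultimately have "U \<subseteq> {z, a, b} \<or> U \<subseteq> {z, b, c} \<or> U \<subseteq> {z, c, d} \<or> U \<subseteq> {z, d, a}" by blast
    then have "U \<in> ?A" unfolding wheel_complex_4 using U by blast
    then show ?thesis by blast
  qed
  ultimately have "full_subcomplex ?A X"
    unfolding full_subcomplex_def using simplicial_wheel_complex[of "[a,b,c,d]" z] by auto
  then show "is_wheel X 4 z vs" using dist unfolding is_wheel_def vs by simp
qed

lemma is_wheel_5_iff:
  assumes X: "flag_complex X"
  shows "is_wheel X 5 z vs \<longleftrightarrow>
    (\<exists>a b c d e. vs = [a, b, c, d, e] \<and> cycle5 X a b c d e \<and> coned X z {a, b, c, d, e})"
proof
  assume w: "is_wheel X 5 z vs"
  then obtain a b c d e where vs: "vs = [a, b, c, d, e]"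
    unfolding is_wheel_def by (auto simp: numeral_eq_Suc length_Suc_conv)
  let ?A = "wheel_complex z [a, b, c, d, e]"
  have vert: "\<Union>?A = {z, a, b, c, d, e}" using wheel_complex_vertices[of "[a, b, c, d, e]" z] by simp
  have dist: "distinct [z, a, b, c, d, e]" and full: "full_subcomplex ?A X"
    using w unfolding is_wheel_def vs by auto
  have sub: "?A \<subseteq> X" using full unfolding full_subcomplex_def by blast
  have "\<forall>U. U \<subseteq> \<Union>?A \<and> U \<noteq> {} \<and> (\<exists>\<sigma>\<in>X. U \<subseteq> \<sigma>) \<longrightarrow> (\<exists>\<tau>\<in>?A. U \<subseteq> \<tau>)"
    using full unfolding full_subcomplex_def by (elim conjE)
  then have full': "\<exists>\<tau>\<in>?A. U \<subseteq> \<tau>" if "U \<subseteq> {z, a, b, c, d, e}" "U \<noteq> {}" "U \<in> X" for U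
    unfolding vert using that by (metis order_refl)
  have "{a, c} \<notin> X" using full'[of "{a, c}"] dist unfolding wheel_complex_5 by auto
  moreover have "{b, d} \<notin> X" using full'[of "{b, d}"] dist unfolding wheel_complex_5 by auto
  moreover have "{c, e} \<notin> X" using full'[of "{c, e}"] dist unfolding wheel_complex_5 by auto
  moreover have "{d, a} \<notin> X" using full'[of "{d, a}"] dist unfolding wheel_complex_5 by auto
  moreover have "{e, b} \<notin> X" using full'[of "{e, b}"] dist unfolding wheel_complex_5 by auto
  moreover have m: "\<tau> \<in> X" if "\<tau> \<noteq> {}" "\<tau> \<subseteq> {z, a, b} \<or> \<tau> \<subseteq> {z, b, c} \<or> \<tau> \<subseteq> {z, c, d} \<or> \<tau> \<subseteq> {z, d, e} \<or> \<tau> \<subseteq> {z, e, a}" for \<tau>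
    using sub that unfolding wheel_complex_5 by blast
  have "{z, a} \<in> X" "{z, b} \<in> X" "{z, c} \<in> X" "{z, d} \<in> X" "{z, e} \<in> X" "{a, b} \<in> X" "{b, c} \<in> X" "{c, d} \<in> X" "{d, e} \<in> X" "{e, a} \<in> X"
    by (rule m; simp)+
  ultimately show "\<exists>a b c d e. vs = [a, b, c, d, e] \<and> cycle5 X a b c d e \<and> coned X z {a, b, c, d, e}"
    using vs unfolding cycle5_def coned_def by blast
next
  assume "\<exists>a b c d e. vs = [a, b, c, d, e] \<and> cycle5 X a b c d e \<and> coned X z {a, b, c, d, e}"
  then obtain a b c d e where vs: "vs = [a, b, c, d, e]"
    and w: "cycle5 X a b c d e" and cn: "coned X z {a, b, c, d, e}" by blast
  let ?A = "wheel_complex z [a, b, c, d, e]"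
  note E = flag_edge_refl[OF X]
  have e: "{z, a} \<in> X" "{z, b} \<in> X" "{z, c} \<in> X" "{z, d} \<in> X" "{z, e} \<in> X"
     "{a, b} \<in> X" "{b, c} \<in> X" "{c, d} \<in> X" "{d, e} \<in> X" "{e, a} \<in> X"
    and ne: "{a, c} \<notin> X" "{b, d} \<notin> X" "{c, e} \<notin> X" "{d, a} \<notin> X" "{e, b} \<notin> X"
    using w cn unfolding cycle5_def coned_def by auto
  have dist: "distinct [z, a, b, c, d, e]"
    using e ne E[OF e(3)] E[OF e(4)] by (auto simp: insert_commute)
  have tri: "{z, a, b} \<in> X" "{z, b, c} \<in> X" "{z, c, d} \<in> X" "{z, d, e} \<in> X" "{z, e, a} \<in> X"
    using e by (auto intro!: flag_triangle[OF X] simp: insert_commute)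
  have "?A \<subseteq> X" unfolding wheel_complex_5 using tri flag_simplexD(3)[OF X] by blast
  moreover have "\<exists>\<tau>\<in>?A. U \<subseteq> \<tau>" if U: "U \<subseteq> \<Union>?A" "U \<noteq> {}" "\<exists>\<sigma>\<in>X. U \<subseteq> \<sigma>" for U
  proof -
    have UX: "U \<in> X" using U flag_simplexD(3)[OF X] by blast
    have "\<not> (a \<in> U \<and> c \<in> U)" "\<not> (b \<in> U \<and> d \<in> U)" "\<not> (c \<in> U \<and> e \<in> U)" "\<not> (d \<in> U \<and> a \<in> U)" "\<not> (e \<in> U \<and> b \<in> U)"
      using flag_simplexD(4)[OF X UX] ne by blast+
    moreover have "U \<subseteq> {z, a, b, c, d, e}" using U(1) wheel_complex_vertices[of "[a,b,c,d,e]" z] by simp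
    ultimately have "U \<subseteq> {z, a, b} \<or> U \<subseteq> {z, b, c} \<or> U \<subseteq> {z, c, d} \<or> U \<subseteq> {z, d, e} \<or> U \<subseteq> {z, e, a}" by blast
    then have "U \<in> ?A" unfolding wheel_complex_5 using U by blast
    then show ?thesis by blast
  qed
  ultimately have "full_subcomplex ?A X"
    unfolding full_subcomplex_def using simplicial_wheel_complex[of "[a,b,c,d,e]" z] by auto
  then show "is_wheel X 5 z vs" using dist unfolding is_wheel_def vs by simp
qed

section \<open>The path metric and the pendant wheel condition\<close>

lemma skeleton_dist_le_iff:
  "skeleton_dist X u v \<le> enat n \<longleftrightarrow> (\<exists>m\<le>n. ((adjacent X) ^^ m) u v)"
proof
  let ?S = "{m. ((adjacent X) ^^ m) u v}"
  assume le: "skeleton_dist X u v \<le> enat n"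
  have "?S \<noteq> {}"
  proof
    assume "?S = {}"
    then have "skeleton_dist X u v = \<infinity>" unfolding skeleton_dist_def by (simp add: top_enat_def)
    with le show False by simp
  qed
  then have "skeleton_dist X u v \<in> enat ` ?S"
    unfolding skeleton_dist_def Inf_enat_def by (auto intro: LeastI)
  then obtain m where "((adjacent X) ^^ m) u v" "skeleton_dist X u v = enat m" by blast
  with le show "\<exists>m\<le>n. ((adjacent X) ^^ m) u v" by auto
next
  assume "\<exists>m\<le>n. ((adjacent X) ^^ m) u v"
  then obtain m where m: "m \<le> n" "((adjacent X) ^^ m) u v" by blast
  then have "skeleton_dist X u v \<le> enat m" unfolding skeleton_dist_def by (intro INF_lower) simp
  with m show "skeleton_dist X u v \<le> enat n" by (meson enat_ord_simps(1) order_trans)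
qed

lemma skeleton_dist_le_1_iff:
  assumes "{v} \<in> X"
  shows "skeleton_dist X v u \<le> enat 1 \<longleftrightarrow> {v, u} \<in> X"
proof -
  have "(\<exists>m\<le>1. ((adjacent X) ^^ m) v u) \<longleftrightarrow> v = u \<or> adjacent X v u"
    unfolding One_nat_def le_Suc_eq ex_disj_distrib conj_disj_distribR by (simp add: eq_commute eq_OO)
  then show ?thesis unfolding skeleton_dist_le_iff adjacent_def using assms by auto
qed

text \<open>The three edges may be degenerate, so only a bound results. It is compared with the
  displacement of the deck transformations.\<close>

lemma skeleton_dist_path3:
  assumes "{u, a} \<in> X" "{a, b} \<in> X" "{b, v} \<in> X"
  shows "skeleton_dist X u v \<le> enat 3"
proof -
  let ?R = "adjacent X"
  have step: "\<exists>m\<le>Suc n. (?R ^^ m) u y" if "\<exists>m\<le>n. (?R ^^ m) u x" "{x, y} \<in> X" for n x y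
  proof -
    obtain m where m: "m \<le> n" "(?R ^^ m) u x" using \<open>\<exists>m\<le>n. (?R ^^ m) u x\<close> by blast
    show ?thesis
    proof (cases "x = y")
      case True then show ?thesis using m le_SucI by blast
    next
      case False
      then have "(?R ^^ Suc m) u y" using m that(2) by (auto simp: adjacent_def)
      then show ?thesis using m by (metis Suc_le_mono)
    qed
  qed
  have "\<exists>m\<le>0. (?R ^^ m) u u" by simp
  from step[OF step[OF step[OF this assms(1)] assms(2)] assms(3)]
  show ?thesis unfolding skeleton_dist_le_iff by (simp add: numeral_eq_Suc)
qed

text \<open>As \<open>vs\<close> is only assumed nonempty, \<open>vs ! 1\<close> need not be one of
  its entries; hence the extra vertices on the right.\<close>

lemma pendant_wheel_in_ball_iff:
  assumes X: "flag_complex X" and vs: "vs \<noteq> []"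
    and w: "wheel_complex z vs \<subseteq> X" and t: "{vs ! 0, vs ! 1, t} \<in> X" and v: "v \<in> \<Union>X"
  shows "pendant_wheel_complex z vs t \<subseteq> comb_ball 1 v X \<longleftrightarrow> coned X v (insert z (insert t (set vs \<union> {vs ! 0, vs ! 1})))"
proof -
  let ?W = "pendant_wheel_complex z vs t" and ?U = "insert z (insert t (set vs \<union> {vs ! 0, vs ! 1}))"
  have v': "{v} \<in> X" using v flag_vertex[OF X] by blast
  have "Pow {vs ! 0, vs ! 1, t} - {{}} \<subseteq> X" using flag_simplexD(3)[OF X t] by blast
  then have sub: "?W \<subseteq> X" unfolding pendant_wheel_complex_def using w by blast
  have "\<Union>(Pow {vs ! 0, vs ! 1, t} - {{}}) = {vs ! 0, vs ! 1, t}" by blast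
  then have U: "\<Union>?W = ?U" unfolding pendant_wheel_complex_def Union_Un_distrib wheel_complex_vertices[OF vs]
    by auto
  have "?W \<subseteq> comb_ball 1 v X \<longleftrightarrow> (\<forall>u\<in>\<Union>?W. u \<in> \<Union>X \<and> {v, u} \<in> X)"
    unfolding comb_ball_def spanned_subcomplex_def skeleton_dist_le_1_iff[OF v'] using sub by blast
  also have "\<dots> \<longleftrightarrow> coned X v ?U" unfolding U coned_def by blast
  finally show ?thesis .
qed

text \<open>The vertex \<open>t\<close> may lie on the wheel here. Being joined to \<open>a\<close>
  and \<open>b\<close> excludes \<open>c\<close>, \<open>d\<close>, \<open>e\<close>, so then
  \<open>t\<close> is one of \<open>z\<close>, \<open>a\<close>, \<open>b\<close>, and
  \<open>z\<close> itself is a cone vertex. In this form the condition passes through liftings and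
  parametrizations without tracking distinctness.\<close>

lemma SD2_star_iff:
  assumes X: "flag_complex X"
  shows "SD2_star X \<longleftrightarrow> (\<forall>z a b c d. \<not> wheel4 X z a b c d) \<and>
    (\<forall>z a b c d e t. cycle5 X a b c d e \<and> coned X z {a, b, c, d, e} \<and> {a, t} \<in> X \<and> {b, t} \<in> X
       \<longrightarrow> (\<exists>v. coned X v {z, a, b, c, d, e, t}))" (is "_ \<longleftrightarrow> ?A \<and> ?B")
proof -
  have "(\<forall>vs z t. is_pendant_wheel X 5 z vs t \<longrightarrow>
        (\<exists>v\<in>\<Union>X. pendant_wheel_complex z vs t \<subseteq> comb_ball 1 v X)) \<longleftrightarrow> ?B" (is "?L \<longleftrightarrow> ?B")
  proof
    assume L: ?L
    show ?B
    proof (intro allI impI)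
      fix z a b c d e t
      assume h: "cycle5 X a b c d e \<and> coned X z {a, b, c, d, e} \<and> {a, t} \<in> X \<and> {b, t} \<in> X"
      show "\<exists>v. coned X v {z, a, b, c, d, e, t}"
      proof (cases "t \<in> {z, a, b, c, d, e}")
        case True
        have "t \<noteq> c" "t \<noteq> d" "t \<noteq> e"
          using h unfolding cycle5_def by (auto simp: insert_commute)
        then have "t \<in> {z, a, b}" using True by blast
        then have "{z, t} \<in> X" using h flag_edge_refl[OF X, of z a] unfolding coned_def by auto
        moreover have "{z, z} \<in> X" using h flag_edge_refl[OF X, of z a] unfolding coned_def by auto
        ultimately have "coned X z {z, a, b, c, d, e, t}" using h unfolding coned_def by simp
        then show ?thesis by blast
      next
        case False
        let ?vs = "[a, b, c, d, e]"
        have w: "is_wheel X 5 z ?vs" using h is_wheel_5_iff[OF X] by blast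
        have tri: "{a, b, t} \<in> X" using h flag_triangle[OF X] unfolding cycle5_def by blast
        have "is_pendant_wheel X 5 z ?vs t"
          unfolding is_pendant_wheel_def using w tri False by simp
        then obtain v where v: "v \<in> \<Union>X" "pendant_wheel_complex z ?vs t \<subseteq> comb_ball 1 v X"
          using L by blast
        have "wheel_complex z ?vs \<subseteq> X" using w unfolding is_wheel_def full_subcomplex_def by blast
        then have "coned X v (insert z (insert t (set ?vs \<union> {?vs ! 0, ?vs ! 1})))"
          using pendant_wheel_in_ball_iff[OF X, of ?vs z t v] tri v by simp
        then show ?thesis unfolding coned_def by auto
      qed
    qed
  next
    assume B: ?B
    show ?L
    proof (intro allI impI)
      fix vs z t assume p: "is_pendant_wheel X 5 z vs t"
      then have w: "is_wheel X 5 z vs" and t: "{vs ! 0, vs ! 1, t} \<in> X"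
        unfolding is_pendant_wheel_def by blast+
      obtain a b c d e where vs: "vs = [a, b, c, d, e]"
        and c: "cycle5 X a b c d e" "coned X z {a, b, c, d, e}"
        using w is_wheel_5_iff[OF X] by blast
      have "{a, t} \<in> X" "{b, t} \<in> X" using flag_simplexD(4)[OF X t] unfolding vs by simp_all
      then obtain v where v: "coned X v {z, a, b, c, d, e, t}" using B c by blast
      then have "v \<in> \<Union>X" unfolding coned_def by blast
      moreover have "wheel_complex z vs \<subseteq> X" using w unfolding is_wheel_def full_subcomplex_def by blast
      ultimately have "pendant_wheel_complex z vs t \<subseteq> comb_ball 1 v X"
        using pendant_wheel_in_ball_iff[OF X _ _ t, of z v] v unfolding vs coned_def by simp
      then show "\<exists>v\<in>\<Union>X. pendant_wheel_complex z vs t \<subseteq> comb_ball 1 v X"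
        using \<open>v \<in> \<Union>X\<close> by blast
    qed
  qed
  moreover have "(\<nexists>v0 vs. is_wheel X 4 v0 vs) \<longleftrightarrow> ?A"
    using is_wheel_4_iff[OF X] by blast
  ultimately show ?thesis unfolding SD2_star_def using X by blast
qed

lemma SD2_star_links_iff:
  assumes X: "flag_complex X"
  shows "SD2_star_links X \<longleftrightarrow> (\<forall>\<rho>\<in>insert {} X. SD2_star (link X \<rho>))"
  unfolding SD2_star_links_def using X link_empty[OF X] by auto

text \<open>If both diagonals were missing, the four vertices would be distinct and span a full
  4-cycle.\<close>

lemma five_large_square:
  assumes "five_large X" and e: "{a, b} \<in> X" "{b, c} \<in> X" "{c, d} \<in> X" "{d, a} \<in> X" and "{a, c} \<notin> X"
  shows "{b, d} \<in> X"
proof (rule ccontr)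
  assume n: "{b, d} \<notin> X"
  have X: "flag_complex X" and no: "\<not> (\<exists>C. is_cycle 4 C \<and> full_subcomplex C X)"
    using assms(1) unfolding five_large_def by blast+
  have r: "{a} \<in> X" "{b} \<in> X" "{c} \<in> X" "{d} \<in> X" using e flag_edge_refl[OF X] by blast+
  have dist: "distinct [a, b, c, d]" using e r n assms(6) by (auto simp: insert_commute)
  define C where "C = cycle_complex [a, b, c, d]"
  have C: "C = {{a}, {b}, {c}, {d}, {a, b}, {b, c}, {c, d}, {d, a}}" (is "_ = ?C")
  proof -
    have "{..<4::nat} = {0, 1, 2, 3}" by auto
    then have "{f i |i. i < 4} = {f 0, f 1, f 2, f (3::nat)}" for f :: "nat \<Rightarrow> 'a set"
      by (simp add: setcompr_eq_image lessThan_def[symmetric])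
    moreover have l: "length [a, b, c, d] = 4" by simp
    ultimately show ?thesis unfolding C_def cycle_complex_def l by (simp add: insert_commute)
  qed
  have "is_cycle 4 C" unfolding is_cycle_def C_def using dist by (intro conjI exI[of _ "[a,b,c,d]"]) simp_all
  moreover have "full_subcomplex C X"
    unfolding full_subcomplex_def
  proof (intro conjI allI impI)
    have P: "\<sigma> \<in> Pow {x, y} \<longleftrightarrow> \<sigma> = {} \<or> \<sigma> = {x} \<or> \<sigma> = {y} \<or> \<sigma> = {x, y}" for \<sigma> x y
      unfolding Pow_insert Pow_empty by auto
    have "\<sigma> \<in> C \<longleftrightarrow> \<sigma> \<noteq> {} \<and> (\<sigma> \<in> Pow {a, b} \<or> \<sigma> \<in> Pow {b, c} \<or> \<sigma> \<in> Pow {c, d} \<or> \<sigma> \<in> Pow {d, a})" for \<sigma>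
      unfolding C P insert_iff empty_iff
      by (rule iffI; elim disjE conjE; simp)
    then have C': "\<And>\<sigma>. \<sigma> \<in> C \<longleftrightarrow> \<sigma> \<noteq> {} \<and> (\<sigma> \<subseteq> {a, b} \<or> \<sigma> \<subseteq> {b, c} \<or> \<sigma> \<subseteq> {c, d} \<or> \<sigma> \<subseteq> {d, a})"
      unfolding Pow_iff .
    have f: "finite \<sigma>" if "\<sigma> \<in> C" for \<sigma> using that unfolding C by auto
    have ne: "\<sigma> \<noteq> {}" if "\<sigma> \<in> C" for \<sigma> using that C' by blast
    have sb: "\<tau> \<in> C" if "\<sigma> \<in> C" "\<tau> \<noteq> {}" "\<tau> \<subseteq> \<sigma>" for \<sigma> \<tau>
      using that(1,2) order_trans[OF that(3)] unfolding C'
      by (elim conjE disjE; intro conjI) (assumption | blast)+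
    show "simplicial_complex C"
      unfolding simplicial_complex_def by (intro conjI ballI allI impI; (elim conjE)?; (rule f ne sb; assumption))
    show "C \<subseteq> X" unfolding C using e r by simp
    fix U assume U: "U \<subseteq> \<Union>C \<and> U \<noteq> {} \<and> (\<exists>\<sigma>\<in>X. U \<subseteq> \<sigma>)"
    then have UX: "U \<in> X" using flag_simplexD(3)[OF X] by blast
    have "U \<subseteq> {a, b, c, d}" using U unfolding C by blast
    moreover have "\<not> (a \<in> U \<and> c \<in> U)" "\<not> (b \<in> U \<and> d \<in> U)"
      using flag_simplexD(4)[OF X UX] n assms(6) by metis+
    ultimately have "U \<subseteq> {a, b} \<or> U \<subseteq> {b, c} \<or> U \<subseteq> {c, d} \<or> U \<subseteq> {d, a}" by blast
    then show "\<exists>\<tau>\<in>C. U \<subseteq> \<tau>" unfolding C by blast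
  qed
  ultimately show False using no by blast
qed

section \<open>Coverings\<close>

text \<open>The hypotheses say that \<open>p\<close> is a covering of 1-skeleta, injective along paths of length at
  most 3.  This covers isomorphisms as well as the quotient map \<open>Th(\<Sigma>) \<rightarrow> Th(Y)\<close>.\<close>

lemma SD2_star_links_covering:
  assumes X: "flag_complex X" and Y: "flag_complex Y" and SD: "SD2_star_links X"
    and surj: "\<And>y. {y} \<in> Y \<Longrightarrow> \<exists>x. {x} \<in> X \<and> p x = y"
    and lift: "\<And>u y. {u} \<in> X \<Longrightarrow> {p u, y} \<in> Y \<Longrightarrow> \<exists>x. {u, x} \<in> X \<and> p x = y"
    and edge: "\<And>u v. {u, v} \<in> X \<Longrightarrow> {p u, p v} \<in> Y"
    and inj: "\<And>u a b v. {u, a} \<in> X \<Longrightarrow> {a, b} \<in> X \<Longrightarrow> {b, v} \<in> X \<Longrightarrow> p u = p v \<Longrightarrow> u = v"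
  shows "SD2_star_links Y"
  unfolding SD2_star_links_iff[OF Y]
proof
  fix \<rho> assume \<rho>: "\<rho> \<in> insert {} Y"
  note LY = link_edge_iff[OF Y \<rho>]
  \<comment> \<open>A section \<open>f\<close> of \<open>p\<close> over the star of \<open>z\<close>
    that also lifts the edges between neighbours of \<open>z\<close>.\<close>
  have star: "\<exists>x f. {x} \<in> X \<and> p x = z \<and> (\<forall>y. {z, y} \<in> Y \<longrightarrow> {x, f y} \<in> X \<and> p (f y) = y) \<and>
      (\<forall>y y'. {z, y} \<in> Y \<longrightarrow> {z, y'} \<in> Y \<longrightarrow> {y, y'} \<in> Y \<longrightarrow> {f y, f y'} \<in> X)"
    if z: "{z} \<in> Y" for z
  proof -
    obtain x where x: "{x} \<in> X" "p x = z" using surj z by blast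
    define f where "f y = (SOME x'. {x, x'} \<in> X \<and> p x' = y)" for y
    have f: "{x, f y} \<in> X \<and> p (f y) = y" if "{z, y} \<in> Y" for y
      unfolding f_def by (rule someI_ex) (use lift[OF x(1)] x(2) that in blast)
    have "{f y, f y'} \<in> X" if y: "{z, y} \<in> Y" "{z, y'} \<in> Y" "{y, y'} \<in> Y" for y y'
    proof -
      have "{f y} \<in> X" using f[OF y(1)] flag_edge_refl[OF X] by blast
      then obtain w where w: "{f y, w} \<in> X" "p w = y'" using lift[of "f y" y'] f[OF y(1)] y(3) by auto
      \<comment> \<open>Both lie over \<open>y'\<close> and are the ends of the path
        \<open>f y'\<close>, \<open>x\<close>, \<open>f y\<close>, \<open>w\<close>, which has
        length 3.\<close>
      have "f y' = w"
        by (rule inj[of _ x "f y"]) (use f[OF y(1)] f[OF y(2)] w in \<open>simp_all add: insert_commute\<close>)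
      with w show ?thesis by simp
    qed
    with x f show ?thesis by blast
  qed
  \<comment> \<open>The pendant vertex may lie outside the star of \<open>z\<close>. It is lifted
    across a set \<open>A\<close> whose members are all joined to \<open>a0\<close>: the lifts from
    \<open>f a0\<close> and from \<open>f a\<close> are ends of a path of length 3 and hence
    equal.\<close>
  have lift_common: "\<exists>s. \<forall>a\<in>A. {f a, s} \<in> X \<and> p s = t"
    if A: "\<And>a. a \<in> A \<Longrightarrow> {f a} \<in> X \<and> p (f a) = a \<and> {a, t} \<in> Y"
      and AA: "\<And>a b. a \<in> A \<Longrightarrow> b \<in> A \<Longrightarrow> {a, b} \<in> Y \<longrightarrow> {f a, f b} \<in> X"
      and m: "a0 \<in> A" "\<And>a. a \<in> A \<Longrightarrow> {a0, a} \<in> Y" for A f t a0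
  proof -
    obtain s where s: "{f a0, s} \<in> X" "p s = t" using lift[of "f a0" t] A[OF m(1)] by auto
    have "{f a, s} \<in> X" if a: "a \<in> A" for a
    proof -
      obtain s' where s': "{f a, s'} \<in> X" "p s' = t" using lift[of "f a" t] A[OF a] by auto
      have "{f a0, f a} \<in> X" using AA[OF m(1) a] m(2)[OF a] by blast
      then have "s = s'"
        by (intro inj[of _ "f a0" "f a"]) (use s s' in \<open>simp_all add: insert_commute\<close>)
      with s' show ?thesis by simp
    qed
    with s show ?thesis by blast
  qed
  show "SD2_star (link Y \<rho>)"
    unfolding SD2_star_iff[OF flag_link[OF Y \<rho>]]
  proof (intro conjI allI impI notI)
    fix z a b c d assume "wheel4 (link Y \<rho>) z a b c d"
    then have w: "wheel4 Y z a b c d" unfolding wheel4_def LY by blast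
    then have "{z} \<in> Y" unfolding wheel4_def using flag_edge_refl[OF Y] by blast
    then obtain x f where x: "p x = z" and f: "\<And>y. {z, y} \<in> Y \<Longrightarrow> {x, f y} \<in> X \<and> p (f y) = y"
      and ff: "\<And>y y'. {z, y} \<in> Y \<Longrightarrow> {z, y'} \<in> Y \<Longrightarrow> {y, y'} \<in> Y \<Longrightarrow> {f y, f y'} \<in> X"
      using star by blast
    have n: "{f y, f y'} \<notin> X" if "{z, y} \<in> Y" "{z, y'} \<in> Y" "{y, y'} \<notin> Y" for y y'
      using edge[of "f y" "f y'"] f that by metis
    have "wheel4 X x (f a) (f b) (f c) (f d)"
      using w f ff n unfolding wheel4_def by (simp add: insert_commute)
    moreover have "SD2_star X" using SD unfolding SD2_star_links_def by blast
    ultimately show False unfolding SD2_star_iff[OF X] by blast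
  next
    fix z a b c d e t
    assume h: "cycle5 (link Y \<rho>) a b c d e \<and> coned (link Y \<rho>) z {a, b, c, d, e} \<and>
      {a, t} \<in> link Y \<rho> \<and> {b, t} \<in> link Y \<rho>"
    let ?V = "{z, a, b, c, d, e}"
    have za: "{z, a} \<in> link Y \<rho>" using h unfolding coned_def by blast
    have z: "{z} \<in> Y" using za unfolding LY using flag_edge_refl[OF Y] by blast
    then obtain x f where x: "{x} \<in> X" "p x = z" and f: "\<And>y. {z, y} \<in> Y \<Longrightarrow> {x, f y} \<in> X \<and> p (f y) = y"
      and ff: "\<And>y y'. {z, y} \<in> Y \<Longrightarrow> {z, y'} \<in> Y \<Longrightarrow> {y, y'} \<in> Y \<Longrightarrow> {f y, f y'} \<in> X"
      using star by blast
    have out: "\<And>y. y \<in> ?V \<union> {t} \<Longrightarrow> y \<notin> \<rho>" and all: "\<And>y r. y \<in> ?V \<union> {t} \<Longrightarrow> r \<in> \<rho> \<Longrightarrow> {y, r} \<in> Y"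
      and at: "{a, t} \<in> Y" "{b, t} \<in> Y"
      and zV: "\<And>y. y \<in> ?V - {z} \<Longrightarrow> {z, y} \<in> Y"
      using h unfolding coned_def LY by blast+
    have V: "{z, y} \<in> Y" if "y \<in> ?V \<union> \<rho>" for y
      using that zV[of y] all[of z y] z by (cases "y = z") auto
    have n: "{f y, f y'} \<notin> X" if "y \<in> ?V \<union> \<rho>" "y' \<in> ?V \<union> \<rho>" "{y, y'} \<notin> Y" for y y'
      using edge[of "f y" "f y'"] f[OF V[OF that(1)]] f[OF V[OF that(2)]] that(3) by metis
    have y: "{f y, f y'} \<in> X \<longleftrightarrow> {y, y'} \<in> Y" if "y \<in> ?V \<union> \<rho>" "y' \<in> ?V \<union> \<rho>" for y y'
      using n[OF that] ff[OF V[OF that(1)] V[OF that(2)]] by blast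
    have fz: "f z = x"
      by (rule inj[of _ x x]) (use f[of z] x z in \<open>simp_all add: insert_commute\<close>)
    have fa: "{f y} \<in> X \<and> p (f y) = y" if "y \<in> ?V \<union> \<rho>" for y
      using f[OF V[OF that]] flag_edge_refl(2)[OF X, of x "f y"] by blast
    let ?A = "{a, b} \<union> \<rho>"
    have ab: "{a, b} \<in> Y" "{a} \<in> Y" using h flag_edge_refl[OF Y] unfolding cycle5_def LY by blast+
    have "\<exists>s. \<forall>r\<in>?A. {f r, s} \<in> X \<and> p s = t"
    proof (rule lift_common[of ?A f t a])
      show "\<And>r. r \<in> ?A \<Longrightarrow> {f r} \<in> X \<and> p (f r) = r \<and> {r, t} \<in> Y"
        using fa at all[of t] by (auto simp: insert_commute)
      show "\<And>r r'. r \<in> ?A \<Longrightarrow> r' \<in> ?A \<Longrightarrow> {r, r'} \<in> Y \<longrightarrow> {f r, f r'} \<in> X"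
        using y by auto
      show "\<And>r. r \<in> ?A \<Longrightarrow> {a, r} \<in> Y" using ab all[of a] by auto
    qed simp
    then obtain s where s: "\<And>r. r \<in> ?A \<Longrightarrow> {f r, s} \<in> X" "p s = t" by blast
    have rY: "{r, r'} \<in> Y" if "r \<in> \<rho>" "r' \<in> \<rho>" for r r'
      using that \<rho> flag_simplexD(4)[OF Y, of \<rho> r r'] by auto
    have \<sigma>: "f ` \<rho> \<in> insert {} X"
    proof -
      have "finite \<rho>" using \<rho> flag_simplexD(1)[OF Y] by auto
      moreover have "\<forall>u\<in>f ` \<rho>. \<forall>v\<in>f ` \<rho>. {u, v} \<in> X" using y rY by auto
      ultimately show ?thesis using flag_simplex_empty_iff[OF X, of "f ` \<rho>"] by blast
    qed
    note LX = link_edge_iff[OF X \<sigma>]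
    have fout: "f v \<notin> f ` \<rho>" if "v \<in> ?V" for v
      using out[of v] that fa[of v] fa by (metis UnI1 UnI2 image_iff)
    have sout: "s \<notin> f ` \<rho>" using out[of t] s(2) fa by (metis UnI1 UnI2 image_iff singletonI)
    have L1: "{f v, f w} \<in> link X (f ` \<rho>) \<longleftrightarrow> {v, w} \<in> link Y \<rho>" if "v \<in> ?V" "w \<in> ?V" for v w
    proof -
      have "{v, r} \<in> Y" "{w, r} \<in> Y" "{f v, f r} \<in> X" "{f w, f r} \<in> X" if "r \<in> \<rho>" for r
        using all[of v r] all[of w r] y[of v r] y[of w r] that \<open>v \<in> ?V\<close> \<open>w \<in> ?V\<close> by blast+
      moreover have "v \<notin> \<rho>" "w \<notin> \<rho>" using out that by blast+
      moreover have "{f v, f w} \<in> X \<longleftrightarrow> {v, w} \<in> Y" using y that by blast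
      ultimately show ?thesis unfolding LX LY using fout that by auto
    qed
    have L2: "{f v, s} \<in> link X (f ` \<rho>)" if "v \<in> {a, b}" for v
    proof -
      have "{f v, f r} \<in> X" "{s, f r} \<in> X" if "r \<in> \<rho>" for r
        using all[of v r] y[of v r] s(1)[of r] that \<open>v \<in> {a, b}\<close> by (auto simp: insert_commute)
      then show ?thesis unfolding LX using s(1)[of v] that fout[of v] sout by auto
    qed
    have "SD2_star (link X (f ` \<rho>))" using SD \<sigma> unfolding SD2_star_links_iff[OF X] by blast
    moreover have "cycle5 (link X (f ` \<rho>)) (f a) (f b) (f c) (f d) (f e)"
      using h L1 unfolding cycle5_def by simp
    moreover have "coned (link X (f ` \<rho>)) (f z) {f a, f b, f c, f d, f e}"
      using h L1[of z] unfolding coned_def by simp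
    moreover have "{f a, s} \<in> link X (f ` \<rho>)" "{f b, s} \<in> link X (f ` \<rho>)" using L2 by simp_all
    ultimately obtain v where v: "coned (link X (f ` \<rho>)) v {f z, f a, f b, f c, f d, f e, s}"
      unfolding SD2_star_iff[OF flag_link[OF X \<sigma>]] by blast
    have vX: "{v, f w} \<in> X" if "w \<in> ?V" for w using v that unfolding coned_def LX by blast
    have vs: "{v, s} \<in> X" and vr: "\<And>r. r \<in> \<rho> \<Longrightarrow> {v, f r} \<in> X" and vn: "v \<notin> f ` \<rho>"
      using v unfolding coned_def LX by blast+
    \<comment> \<open>Otherwise \<open>v\<close> and \<open>f (p v)\<close> would be adjacent
      vertices over the same point, hence equal, although \<open>v\<close> is a vertex of the link
      of the lifted simplex.\<close>
    have pv: "p v \<notin> \<rho>"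
    proof
      assume r: "p v \<in> \<rho>"
      have "v = f (p v)"
        by (rule inj[of _ "f (p v)" "f (p v)"]) (use vr[OF r] fa[of "p v"] r in simp_all)
      then show False using vn r by blast
    qed
    have "{p v, w} \<in> link Y \<rho>" if w: "w \<in> ?V \<union> {t}" for w
    proof -
      have "{p v, w} \<in> Y" using w edge[OF vX[of w]] fa[of w] edge[OF vs] s(2) by auto
      moreover have "{p v, r} \<in> Y" if "r \<in> \<rho>" for r using edge[OF vr[OF that]] fa[of r] that by simp
      ultimately show ?thesis unfolding LY using pv out[OF w] all[OF w] by blast
    qed
    then show "\<exists>v. coned (link Y \<rho>) v {z, a, b, c, d, e, t}" unfolding coned_def by blast
  qed
qed

section \<open>Invariance under simplicial isomorphism\<close>

lemma simplicial_iso_sym: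
  assumes "simplicial_iso X Y" shows "simplicial_iso Y X"
proof -
  obtain f where f: "inj_on f (\<Union>X)" "(\<lambda>\<sigma>. f ` \<sigma>) ` X = Y" using assms unfolding simplicial_iso_def by blast
  let ?g = "inv_into (\<Union>X) f"
  have V: "\<Union>Y = f ` \<Union>X" using f(2) by blast
  have "?g ` f ` \<sigma> = \<sigma>" if "\<sigma> \<in> X" for \<sigma>
    using inv_into_image_cancel[OF f(1), of \<sigma>] that by blast
  then have "(\<lambda>\<sigma>. ?g ` \<sigma>) ` Y = X" unfolding f(2)[symmetric] by (force simp: image_image)
  moreover have "inj_on ?g (\<Union>Y)" unfolding V by (rule inj_on_inv_into) blast
  ultimately show ?thesis unfolding simplicial_iso_def by blast
qed

lemma flag_complex_iso:
  assumes X: "flag_complex X" and "simplicial_iso X Y"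
  shows "flag_complex Y"
proof -
  obtain f where f: "inj_on f (\<Union>X)" "(\<lambda>\<sigma>. f ` \<sigma>) ` X = Y" using assms unfolding simplicial_iso_def by blast
  show ?thesis
  proof (rule flag_complexI)
    fix \<sigma> assume "\<sigma> \<in> Y"
    then show "finite \<sigma> \<and> \<sigma> \<noteq> {}" using f(2) flag_simplexD(1,2)[OF X] by blast
  next
    fix \<sigma> \<tau> assume s: "\<sigma> \<in> Y" "\<tau> \<subseteq> \<sigma>" "\<tau> \<noteq> {}"
    then obtain \<sigma>' where \<sigma>': "\<sigma>' \<in> X" "\<sigma> = f ` \<sigma>'" using f(2) by blast
    then obtain \<tau>' where \<tau>': "\<tau>' \<subseteq> \<sigma>'" "\<tau> = f ` \<tau>'" using s subset_imageE by metis
    then have "\<tau>' \<in> X" using s flag_simplexD(3)[OF X \<sigma>'(1)] by blast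
    then show "\<tau> \<in> Y" using f(2) \<tau>' by blast
  next
    fix U assume U: "finite U" "U \<noteq> {}" and e: "\<And>u v. u \<in> U \<Longrightarrow> v \<in> U \<Longrightarrow> {u, v} \<in> Y"
    have "U \<subseteq> f ` \<Union>X" using e f(2) by blast
    then obtain U' where U': "U' \<subseteq> \<Union>X" "U = f ` U'" using subset_imageE by metis
    have fin: "finite U'" using U(1) inj_on_subset[OF f(1) U'(1)] finite_imageD unfolding U'(2) by blast
    have "{u, v} \<in> X" if uv: "u \<in> U'" "v \<in> U'" for u v
    proof -
      have "{f u, f v} \<in> Y" using e uv U' by blast
      then obtain \<sigma> where \<sigma>: "\<sigma> \<in> X" "{f u, f v} = f ` \<sigma>" using f(2) by blast
      have "f ` {u, v} = f ` \<sigma>" using \<sigma>(2) by simp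
      moreover have "{u, v} \<subseteq> \<Union>X" "\<sigma> \<subseteq> \<Union>X" using uv U'(1) \<sigma>(1) by blast+
      ultimately show ?thesis using inj_on_image_eq_iff[OF f(1)] \<sigma>(1) by metis
    qed
    then have "U' \<in> X" using fin U(2) U'(2) flag_simplex_iff[OF X, of U'] by blast
    then show "U \<in> Y" using f(2) U'(2) by blast
  qed
qed

lemma SD2_star_links_iso:
  assumes X: "flag_complex X" and iso: "simplicial_iso X Y" and SD: "SD2_star_links X"
  shows "SD2_star_links Y"
proof -
  obtain f where f: "inj_on f (\<Union>X)" "(\<lambda>\<sigma>. f ` \<sigma>) ` X = Y" using iso unfolding simplicial_iso_def by blast
  have inj: "u = v" if "{u, a} \<in> X" "{b, v} \<in> X" "f u = f v" for u a b v
    using inj_onD[OF f(1) that(3)] that(1,2) by blast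
  have edge: "{f u, f v} \<in> Y" if "{u, v} \<in> X" for u v
  proof -
    have "f ` {u, v} \<in> Y" using that f(2) by blast
    then show ?thesis by simp
  qed
  have lift: "\<exists>x. {u, x} \<in> X \<and> f x = y" if u: "{u} \<in> X" "{f u, y} \<in> Y" for u y
  proof -
    obtain \<sigma> where \<sigma>: "\<sigma> \<in> X" "{f u, y} = f ` \<sigma>" using u f(2) by blast
    obtain u' x where x: "u' \<in> \<sigma>" "f u' = f u" "x \<in> \<sigma>" "f x = y" using \<sigma>(2) by (metis imageE insertI1 insertI2)
    have "u' = u" using inj_onD[OF f(1) x(2)] x(1) \<sigma>(1) u(1) by blast
    then show ?thesis using flag_simplexD(4)[OF X \<sigma>(1)] x by blast
  qed
  have surj: "\<exists>x. {x} \<in> X \<and> f x = y" if y: "{y} \<in> Y" for y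
  proof -
    obtain \<sigma> where \<sigma>: "\<sigma> \<in> X" "{y} = f ` \<sigma>" using y f(2) by blast
    then obtain x where "x \<in> \<sigma>" "f x = y" by (metis imageE insertI1)
    then show ?thesis using flag_simplexD(4)[OF X \<sigma>(1), of x x] by auto
  qed
  show ?thesis
    by (rule SD2_star_links_covering[OF X flag_complex_iso[OF X iso] SD, of f])
      (use surj lift edge inj in blast)+
qed

section \<open>Heaps of pieces\<close>

text \<open>As \<open>adjacent\<close> is irreflexive, pieces \<open>t\<close> already in
  \<open>P\<close> block a new \<open>t\<close> just as non-commuting letters do.\<close>

definition height :: "'a set set \<Rightarrow> ('a \<times> nat) set \<Rightarrow> 'a \<Rightarrow> nat" where
  "height X P t = (LEAST h. \<forall>(r, j)\<in>P. \<not> adjacent X r t \<longrightarrow> j < h)"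

text \<open>The layer in which multiplication by \<open>t\<close> acts: that of the topmost \<open>t\<close> if this one can be cancelled,
  and otherwise the one in which a new \<open>t\<close> comes to rest.\<close>

definition slot :: "'a set set \<Rightarrow> ('a \<times> nat) set \<Rightarrow> 'a \<Rightarrow> nat" where
  "slot X P t = (if 0 < height X P t \<and> (t, height X P t - 1) \<in> P then height X P t - 1 else height X P t)"

text \<open>All slots are taken in the same \<open>P\<close>. For commuting letters this agrees with
  multiplying by them one after the other, so one edge of Th(\<Sigma>) is a single toggle.\<close>

definition toggle :: "'a set set \<Rightarrow> 'a set \<Rightarrow> ('a \<times> nat) set \<Rightarrow> ('a \<times> nat) set" where
  "toggle X \<sigma> P = {(t, k). ((t, k) \<in> P) \<noteq> (t \<in> \<sigma> \<and> k = slot X P t)}"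

text \<open>This is the Cartier-Foata normal form of a reduced word: every layer consists of
  commuting letters, and every letter above the ground rests on one that it does not commute with.
  The clause \<open>(t, k) \<notin> P\<close> makes the latter a different letter; two equal letters
  in consecutive layers would cancel.\<close>

definition heap :: "'a set set \<Rightarrow> ('a \<times> nat) set \<Rightarrow> bool" where
  "heap X P \<longleftrightarrow> finite P \<and>
     (\<forall>r t k. (r, k) \<in> P \<longrightarrow> (t, k) \<in> P \<longrightarrow> r = t \<or> adjacent X r t) \<and>
     (\<forall>t k. (t, Suc k) \<in> P \<longrightarrow> (t, k) \<notin> P \<and> (\<exists>r. (r, k) \<in> P \<and> \<not> adjacent X r t))"

lemma adjacent_sym: "adjacent X s t \<longleftrightarrow> adjacent X t s"
  unfolding adjacent_def by (auto simp: insert_commute)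

lemma adjacent_irrefl: "\<not> adjacent X t t"
  unfolding adjacent_def by blast

lemma height_bound:
  assumes "finite P" "(r, j) \<in> P" "\<not> adjacent X r t"
  shows "j < height X P t"
proof -
  have "\<forall>(r, j)\<in>P. \<not> adjacent X r t \<longrightarrow> j < Suc (Max (snd ` P))"
    using assms(1) by (auto intro!: le_imp_less_Suc Max_ge rev_image_eqI)
  then have "\<forall>(r, j)\<in>P. \<not> adjacent X r t \<longrightarrow> j < height X P t"
    unfolding height_def by (rule LeastI)
  with assms show ?thesis by blast
qed

lemma height_attained:
  assumes "finite P" "height X P t = Suc k"
  obtains r where "(r, k) \<in> P" "\<not> adjacent X r t"
proof -
  have "\<not> (\<forall>(r, j)\<in>P. \<not> adjacent X r t \<longrightarrow> j < k)"
    using assms not_less_Least[of k "\<lambda>h. \<forall>(r, j)\<in>P. \<not> adjacent X r t \<longrightarrow> j < h"]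
    unfolding height_def by simp
  then obtain r j where r: "(r, j) \<in> P" "\<not> adjacent X r t" "k \<le> j" using not_less by blast
  moreover have "j < Suc k" using height_bound[OF assms(1) r(1,2)] assms(2) by simp
  ultimately show ?thesis using that by (metis le_antisym less_Suc_eq_le)
qed

lemma height_eqI:
  assumes "finite P" "\<And>r j. (r, j) \<in> P \<Longrightarrow> \<not> adjacent X r t \<Longrightarrow> j < h"
    and "\<And>k. h = Suc k \<Longrightarrow> \<exists>r. (r, k) \<in> P \<and> \<not> adjacent X r t"
  shows "height X P t = h"
proof (rule antisym)
  show "height X P t \<le> h" unfolding height_def by (rule Least_le) (use assms(2) in auto)
  show "h \<le> height X P t"
  proof (cases h)
    case (Suc k)
    then show ?thesis using assms(3) height_bound[OF assms(1)] by (metis Suc_leI)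
  qed simp
qed

lemma height_cong:
  assumes "\<And>r j. \<not> adjacent X r t \<Longrightarrow> (r, j) \<in> P \<longleftrightarrow> (r, j) \<in> Q"
  shows "height X P t = height X Q t"
proof -
  have "(\<forall>(r, j)\<in>P. \<not> adjacent X r t \<longrightarrow> j < h) \<longleftrightarrow> (\<forall>(r, j)\<in>Q. \<not> adjacent X r t \<longrightarrow> j < h)" for h
    using assms by blast
  then show ?thesis unfolding height_def by simp
qed

lemma slot_cong:
  assumes "\<And>r j. \<not> adjacent X r t \<Longrightarrow> (r, j) \<in> P \<longleftrightarrow> (r, j) \<in> Q"
  shows "slot X P t = slot X Q t"
  using height_cong[of X t P Q] assms adjacent_irrefl[of X t] unfolding slot_def by metis

lemma toggle_iff: "(t, k) \<in> toggle X \<sigma> P \<longleftrightarrow> ((t, k) \<in> P) \<noteq> (t \<in> \<sigma> \<and> k = slot X P t)"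
  unfolding toggle_def by simp

lemma toggle_empty [simp]: "toggle X {} P = P"
  unfolding toggle_def by simp

lemma finite_toggle:
  assumes "finite P" "finite \<sigma>" shows "finite (toggle X \<sigma> P)"
proof (rule finite_subset)
  show "toggle X \<sigma> P \<subseteq> P \<union> (\<lambda>t. (t, slot X P t)) ` \<sigma>" unfolding toggle_def by auto
qed (use assms in simp)

text \<open>The slot of \<open>t\<close> depends only on pieces that do not commute with
  \<open>t\<close>, and these are untouched.\<close>

lemma slot_toggle_other:
  assumes "t \<notin> \<sigma>" "\<And>s. s \<in> \<sigma> \<Longrightarrow> adjacent X s t"
  shows "slot X (toggle X \<sigma> P) t = slot X P t"
  by (rule slot_cong) (use assms in \<open>auto simp: toggle_iff\<close>)

lemma slot_add:
  assumes "finite P" "(t, slot X P t) \<notin> P" shows "slot X P t = height X P t"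
  using assms unfolding slot_def by (auto split: if_splits)

lemma slot_remove:
  assumes "finite P" "(t, slot X P t) \<in> P" shows "height X P t = Suc (slot X P t)"
  using assms height_bound[of P t "height X P t" X t] adjacent_irrefl[of X t]
  unfolding slot_def by (auto split: if_splits)

text \<open>An added \<open>t\<close> becomes the topmost obstacle to itself, so the next
  \<open>t\<close> cancels it. After a removal, the obstacle one layer below, which is not
  \<open>t\<close>, fixes the resting place at the same layer. Hence toggling is an
  involution.\<close>

lemma slot_toggle_same:
  assumes P: "heap X P"
  shows "slot X (toggle X {t} P) t = slot X P t"
proof -
  let ?h = "slot X P t" and ?Q = "toggle X {t} P"
  have fP: "finite P" and fQ: "finite ?Q" using P finite_toggle unfolding heap_def by blast+
  show ?thesis
  proof (cases "(t, ?h) \<in> P")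
    case False
    note h = slot_add[OF fP False]
    have "height X ?Q t = Suc ?h"
    proof (rule height_eqI[OF fQ])
      fix r j assume "(r, j) \<in> ?Q" "\<not> adjacent X r t"
      then show "j < Suc ?h" using height_bound[OF fP, of r j X t] h by (auto simp: toggle_iff split: if_splits)
    next
      fix k assume "Suc ?h = Suc k"
      then show "\<exists>r. (r, k) \<in> ?Q \<and> \<not> adjacent X r t"
        using False adjacent_irrefl[of X t] by (intro exI[of _ t]) (simp add: toggle_iff)
    qed
    then show ?thesis using False unfolding slot_def[of X ?Q t] by (simp add: toggle_iff)
  next
    case True
    note h = slot_remove[OF fP True]
    have "height X ?Q t = ?h"
    proof (rule height_eqI[OF fQ])
      fix r j assume r: "(r, j) \<in> ?Q" "\<not> adjacent X r t"
      then have rP: "(r, j) \<in> P" and ne: "\<not> (r = t \<and> j = ?h)" using True by (auto simp: toggle_iff)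
      have "j < Suc ?h" using height_bound[OF fP rP r(2)] h by simp
      moreover have "j \<noteq> ?h" using P True rP r(2) ne unfolding heap_def by blast
      ultimately show "j < ?h" by simp
    next
      fix k assume k: "?h = Suc k"
      then obtain r where "(r, k) \<in> P" "\<not> adjacent X r t" using P True unfolding heap_def by metis
      then show "\<exists>r. (r, k) \<in> ?Q \<and> \<not> adjacent X r t" using k by (intro exI[of _ r]) (simp add: toggle_iff)
    qed
    moreover have "(t, ?h - 1) \<notin> ?Q" if "0 < ?h"
      using P True that unfolding heap_def by (cases ?h) (auto simp: toggle_iff)
    ultimately show ?thesis unfolding slot_def[of X ?Q t] by auto
  qed
qed

lemma heap_toggle_singleton:
  assumes P: "heap X P" shows "heap X (toggle X {t} P)"
proof -
  let ?h = "slot X P t" and ?Q = "toggle X {t} P"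
  have fP: "finite P" and fQ: "finite ?Q" using P finite_toggle unfolding heap_def by blast+
  have cl: "\<And>r s k. (r, k) \<in> P \<Longrightarrow> (s, k) \<in> P \<Longrightarrow> r = s \<or> adjacent X r s"
    and up: "\<And>s k. (s, Suc k) \<in> P \<Longrightarrow> (s, k) \<notin> P \<and> (\<exists>r. (r, k) \<in> P \<and> \<not> adjacent X r s)"
    using P unfolding heap_def by blast+
  show ?thesis
  proof (cases "(t, ?h) \<in> P")
    case False
    note h = slot_add[OF fP False]
    have Q: "(r, j) \<in> ?Q \<longleftrightarrow> (r, j) \<in> P \<or> r = t \<and> j = ?h" for r j using False by (auto simp: toggle_iff)
    have lt: "j < ?h" if "(r, j) \<in> P" "\<not> adjacent X r t" for r j
      using height_bound[OF fP that] h by simp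
    have top: "adjacent X r t" if "(r, ?h) \<in> P" for r using lt[OF that] by blast
    show ?thesis unfolding heap_def
    proof (intro conjI allI impI fQ)
      fix r s k assume "(r, k) \<in> ?Q" "(s, k) \<in> ?Q"
      then show "r = s \<or> adjacent X r s" using cl top adjacent_sym[of X] unfolding Q by metis
    next
      fix s k assume s: "(s, Suc k) \<in> ?Q"
      show "(s, k) \<notin> ?Q"
      proof
        assume s': "(s, k) \<in> ?Q"
        consider "(s, Suc k) \<in> P" "(s, k) \<in> P" | "s = t" "Suc k = ?h" "(s, k) \<in> P" | "s = t" "k = ?h" "(s, Suc k) \<in> P"
          using s s' unfolding Q by auto
        then show False
        proof cases
          case 1 then show ?thesis using up by blast
        next
          \<comment> \<open>With a copy of \<open>t\<close> directly below the resting place,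
            \<open>slot\<close> would have selected that copy for cancellation and nothing would
            have been added.\<close>
          case 2
          then have "height X P t = Suc k" using h by simp
          with 2 have "(t, height X P t - 1) \<in> P" "0 < height X P t" by (metis diff_Suc_1 zero_less_Suc)+
          then show ?thesis using h unfolding slot_def by simp
        next
          case 3 then show ?thesis using lt[of s "Suc k"] adjacent_irrefl[of X t] by simp
        qed
      qed
      show "\<exists>r. (r, k) \<in> ?Q \<and> \<not> adjacent X r s"
      proof (cases "(s, Suc k) \<in> P")
        case True then show ?thesis using up Q by blast
      next
        case False
        then have "s = t" "height X P t = Suc k" using s h unfolding Q by auto
        then show ?thesis using height_attained[OF fP] Q by metis
      qed
    qed
  next
    case True
    note h = slot_remove[OF fP True]
    have Q: "(r, j) \<in> ?Q \<longleftrightarrow> (r, j) \<in> P \<and> \<not> (r = t \<and> j = ?h)" for r j using True by (auto simp: toggle_iff)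
    show ?thesis unfolding heap_def
    proof (intro conjI allI impI fQ)
      fix r s k assume "(r, k) \<in> ?Q" "(s, k) \<in> ?Q"
      then show "r = s \<or> adjacent X r s" using cl unfolding Q by blast
    next
      fix s k assume s: "(s, Suc k) \<in> ?Q"
      show "(s, k) \<notin> ?Q" using s up unfolding Q by blast
      obtain r where r: "(r, k) \<in> P" "\<not> adjacent X r s" using up s unfolding Q by blast
      \<comment> \<open>The removed \<open>t\<close> supports nothing: a non-commuting piece above
        it would raise \<open>height X P t\<close> beyond \<open>Suc ?h\<close>.\<close>
      have "\<not> (r = t \<and> k = ?h)"
      proof
        assume rt: "r = t \<and> k = ?h"
        then have "\<not> adjacent X s t" using r(2) adjacent_sym[of X] by blast
        then have "Suc k < Suc ?h" using height_bound[OF fP, of s "Suc k" X t] s h unfolding Q by simp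
        then show False using rt by simp
      qed
      then show "\<exists>r. (r, k) \<in> ?Q \<and> \<not> adjacent X r s" using r Q by blast
    qed
  qed
qed

lemma toggle_insert:
  assumes "t \<notin> \<sigma>" "\<And>s. s \<in> \<sigma> \<Longrightarrow> adjacent X s t"
  shows "toggle X (insert t \<sigma>) P = toggle X {t} (toggle X \<sigma> P)"
  using assms slot_toggle_other[OF assms] by (auto simp: toggle_iff)

definition commuting :: "'a set set \<Rightarrow> 'a set \<Rightarrow> bool" where
  "commuting X \<sigma> \<longleftrightarrow> finite \<sigma> \<and> (\<forall>s\<in>\<sigma>. \<forall>t\<in>\<sigma>. s \<noteq> t \<longrightarrow> adjacent X s t)"

lemma heap_toggle:
  assumes P: "heap X P" and \<sigma>: "commuting X \<sigma>"
  shows "heap X (toggle X \<sigma> P)"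
proof -
  have "finite \<sigma>" using \<sigma> unfolding commuting_def by blast
  then show ?thesis using \<sigma>
  proof (induction \<sigma>)
    case empty then show ?case using P by simp
  next
    case (insert t \<sigma>)
    then have "commuting X \<sigma>" "\<And>s. s \<in> \<sigma> \<Longrightarrow> adjacent X s t" unfolding commuting_def by auto
    then show ?case using insert heap_toggle_singleton toggle_insert[of t \<sigma> X P] by metis
  qed
qed

lemma slot_toggle:
  assumes P: "heap X P" and \<sigma>: "commuting X (insert t \<sigma>)"
  shows "slot X (toggle X \<sigma> P) t = slot X P t"
proof -
  let ?\<tau> = "\<sigma> - {t}"
  have \<tau>: "commuting X ?\<tau>" "\<And>s. s \<in> ?\<tau> \<Longrightarrow> adjacent X s t" "t \<notin> ?\<tau>"
    using \<sigma> unfolding commuting_def by auto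
  have *: "slot X (toggle X ?\<tau> P) t = slot X P t" using slot_toggle_other \<tau>(2,3) by metis
  show ?thesis
  proof (cases "t \<in> \<sigma>")
    case True
    then have "toggle X \<sigma> P = toggle X {t} (toggle X ?\<tau> P)"
      using toggle_insert[of t ?\<tau> X P] \<tau> by (simp add: insert_absorb)
    then show ?thesis using * slot_toggle_same[OF heap_toggle[OF P \<tau>(1)]] by simp
  qed (use * in simp)
qed

text \<open>Slots do not move under commuting toggles, so the subsets of a set of commuting letters
  act as a group under symmetric difference.\<close>

lemma toggle_toggle:
  assumes P: "heap X P" and c: "commuting X (\<sigma> \<union> \<tau>)"
  shows "toggle X \<tau> (toggle X \<sigma> P) = toggle X (sym_diff \<sigma> \<tau>) P"
proof -
  have "slot X (toggle X \<sigma> P) t = slot X P t" if "t \<in> \<tau>" for t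
    by (rule slot_toggle[OF P]) (use c that in \<open>auto simp: commuting_def\<close>)
  then show ?thesis by (auto simp: toggle_iff)
qed

lemma toggle_cancel:
  assumes "heap X P" "commuting X \<sigma>"
  shows "toggle X \<sigma> (toggle X \<sigma> P) = P"
  using toggle_toggle[of X P \<sigma> \<sigma>] assms by simp

section \<open>The word problem in right-angled Coxeter groups\<close>

definition word_heap :: "'a set set \<Rightarrow> 'a list \<Rightarrow> ('a \<times> nat) set \<Rightarrow> ('a \<times> nat) set" where
  "word_heap X xs P = fold (\<lambda>t. toggle X {t}) xs P"

lemma word_heap_simps [simp]:
  "word_heap X [] P = P" "word_heap X (x # xs) P = word_heap X xs (toggle X {x} P)"
  "word_heap X (xs @ ys) P = word_heap X ys (word_heap X xs P)"
  unfolding word_heap_def by simp_all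

lemma commuting_singleton: "commuting X {t}"
  unfolding commuting_def by simp

lemma heap_empty: "heap X {}"
  unfolding heap_def by simp

lemma heap_word_heap: "heap X P \<Longrightarrow> heap X (word_heap X xs P)"
  by (induction xs arbitrary: P) (simp_all add: heap_toggle commuting_singleton)

text \<open>The relators act trivially on heaps: toggling one letter is an involution, and for
  commuting \<open>s\<close>, \<open>t\<close> the word \<open>stst\<close> toggles
  \<open>{s, t}\<close> twice.\<close>

lemma word_heap_racg_eq:
  assumes "racg_eq X xs ys" "heap X P"
  shows "word_heap X xs P = word_heap X ys P"
  using assms
proof (induction arbitrary: P)
  case (square s xs ys)
  then show ?case using toggle_cancel[OF heap_word_heap[OF square(2)] commuting_singleton] by simp
next
  case (edge s t xs ys)
  let ?P = "word_heap X xs P"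
  have c: "commuting X ({s} \<union> {t})" using edge(1) adjacent_sym[of X] unfolding commuting_def by auto
  have P: "heap X ?P" using edge heap_word_heap by blast
  have d: "sym_diff {s} {t} = {s} \<union> {t}" using edge(1) adjacent_irrefl[of X s] by auto
  have "toggle X {t} (toggle X {s} (toggle X {t} (toggle X {s} ?P))) = ?P"
    using toggle_toggle[OF P c] toggle_toggle[OF heap_toggle[OF P c] c] toggle_cancel[OF P c] unfolding d by simp
  then show ?case by simp
qed simp_all

lemma racg_eq_cong: "racg_eq X xs ys \<Longrightarrow> racg_eq X (us @ xs @ vs) (us @ ys @ vs)"
proof (induction rule: racg_eq.induct)
  case (square s xs ys)
  then show ?case using racg_eq.square[of s X "us @ xs" "ys @ vs"] by simp
next
  case (edge s t xs ys)
  then show ?case using racg_eq.edge[of X s t "us @ xs" "ys @ vs"] by simp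
qed (blast intro: racg_eq.intros)+

lemma racg_eq_append: "racg_eq X xs ys \<Longrightarrow> racg_eq X us vs \<Longrightarrow> racg_eq X (xs @ us) (ys @ vs)"
  using racg_eq_cong[of X xs ys "[]" us] racg_eq_cong[of X us vs ys "[]"] by (auto intro: racg_eq.trans)

lemma racg_eq_swap:
  assumes "adjacent X s t"
  shows "racg_eq X [s, t] [t, s]"
proof -
  have v: "s \<in> \<Union>X" "t \<in> \<Union>X" using assms unfolding adjacent_def by blast+
  have "racg_eq X ([s, t, s, t] @ [t, s]) [t, s]" using racg_eq.edge[OF assms, of "[]" "[t, s]"] by simp
  moreover have "racg_eq X ([s, t, s] @ [t, t] @ [s]) ([s, t, s] @ [s])" using v by (intro racg_eq.square)
  moreover have "racg_eq X ([s, t] @ [s, s] @ []) ([s, t] @ [])" using v by (intro racg_eq.square)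
  ultimately show ?thesis
    using racg_eq.sym racg_eq.trans by (metis append_Cons append_Nil append_Nil2)
qed

lemma racg_eq_rev: "set xs \<subseteq> \<Union>X \<Longrightarrow> racg_eq X (xs @ rev xs) []"
proof (induction xs)
  case (Cons x xs)
  then have "racg_eq X ([x] @ (xs @ rev xs) @ [x]) ([x] @ [] @ [x])" by (intro racg_eq_cong) simp
  moreover have "racg_eq X ([] @ [x, x] @ []) ([] @ [])" using Cons by (intro racg_eq.square) simp
  ultimately show ?case by (auto intro: racg_eq.trans)
qed (simp add: racg_eq.refl)

lemma toggle_singleton_insert:
  "(t, slot X P t) \<notin> P \<Longrightarrow> toggle X {t} P = insert (t, slot X P t) P"
  "(t, slot X P t) \<in> P \<Longrightarrow> toggle X {t} P = P - {(t, slot X P t)}"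
  unfolding toggle_def by auto

lemma card_word_heap_le: "card (word_heap X xs {}) \<le> length xs"
proof (induction xs rule: rev_induct)
  case (snoc t xs)
  let ?P = "word_heap X xs {}"
  have "finite ?P" using heap_word_heap[OF heap_empty] unfolding heap_def by blast
  then have "card (toggle X {t} ?P) \<le> Suc (card ?P)"
  proof (cases "(t, slot X ?P t) \<in> ?P")
    case True
    then show ?thesis unfolding toggle_singleton_insert(2)[OF True] using card_Diff1_le le_SucI by metis
  next
    case False
    then show ?thesis unfolding toggle_singleton_insert(1)[OF False] using \<open>finite ?P\<close> by simp
  qed
  then show ?case using snoc by simp
qed simp

text \<open>The exchange property: a \<open>t\<close> that can be cancelled from the heap of a
  reduced word can be moved to the end of the word. If the last letter differs from
  \<open>t\<close>, it commutes with \<open>t\<close>, and the induction hypothesis applies to the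
  word before it.\<close>

lemma racg_exchange:
  assumes "card (word_heap X xs {}) = length xs"
    and "(t, slot X (word_heap X xs {}) t) \<in> word_heap X xs {}"
  shows "\<exists>zs. set zs \<subseteq> set xs \<and> length xs = Suc (length zs) \<and> racg_eq X xs (zs @ [t])"
  using assms
proof (induction xs rule: rev_induct)
  case (snoc u ys)
  let ?Q = "word_heap X ys {}"
  let ?P = "toggle X {u} ?Q"
  have F0: "finite ?Q" using heap_word_heap[OF heap_empty] unfolding heap_def by blast
  then have "finite ?P" by (rule finite_toggle) simp
  note F = F0 this
  have le: "card ?Q \<le> length ys" by (rule card_word_heap_le)
  have new: "(u, slot X ?Q u) \<notin> ?Q"
  proof
    assume "(u, slot X ?Q u) \<in> ?Q"
    then have "card ?P \<le> card ?Q" using toggle_singleton_insert(2) F by (metis card_Diff1_le)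
    then show False using snoc.prems(1) le by simp
  qed
  have P: "?P = insert (u, slot X ?Q u) ?Q" using toggle_singleton_insert(1)[OF new] .
  have card0: "card ?Q = length ys" using snoc.prems(1) new F P by simp
  show ?case
  proof (cases "t = u")
    case True
    then show ?thesis by (intro exI[of _ ys]) (auto intro: racg_eq.refl)
  next
    case False
    have tP: "(t, slot X ?P t) \<in> ?P" using snoc.prems(2) by simp
    then have tP0: "(t, slot X ?P t) \<in> ?Q" using False P by blast
    \<comment> \<open>Otherwise the pieces of \<open>u\<close> and \<open>t\<close> block each
      other: \<open>u\<close> is the last to fall and so lies strictly above \<open>t\<close>, while
      \<open>t\<close> is cancellable and so lies at least as high as \<open>u\<close>.\<close>
    have adj: "adjacent X u t"
    proof (rule ccontr)
      assume n: "\<not> adjacent X u t"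
      have "slot X ?Q u < height X ?P t"
        using height_bound[OF F(2), of u "slot X ?Q u" X t] n P by blast
      then have "slot X ?Q u \<le> slot X ?P t" using slot_remove[OF F(2) tP] by simp
      moreover have "slot X ?P t < slot X ?Q u"
        using height_bound[OF F(1) tP0, of X u] n adjacent_sym[of X] slot_add[OF F(1) new] by metis
      ultimately show False by simp
    qed
    have "slot X ?P t = slot X ?Q t" using False adj by (intro slot_toggle_other) auto
    then obtain zs where zs: "set zs \<subseteq> set ys" "length ys = Suc (length zs)" "racg_eq X ys (zs @ [t])"
      using snoc.IH[OF card0] tP0 by auto
    have "racg_eq X (ys @ [u]) ((zs @ [t]) @ [u])" using zs(3) by (intro racg_eq_append racg_eq.refl)
    moreover have "racg_eq X (zs @ [t, u] @ []) (zs @ [u, t] @ [])"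
      using adj adjacent_sym[of X] by (intro racg_eq_cong racg_eq_swap) blast
    ultimately have "racg_eq X (ys @ [u]) ((zs @ [u]) @ [t])" by (auto intro: racg_eq.trans)
    then show ?thesis using zs by (intro exI[of _ "zs @ [u]"]) auto
  qed
qed simp

text \<open>Appending a letter either adds a piece and lengthens the word, or removes one, in which
  case the exchange property deletes a letter. So the number of pieces is the word length.\<close>

lemma racg_reduced_word:
  assumes "set xs \<subseteq> \<Union>X"
  shows "\<exists>ys. set ys \<subseteq> \<Union>X \<and> racg_eq X xs ys \<and> length ys = card (word_heap X xs {})"
  using assms
proof (induction xs rule: rev_induct)
  case Nil then show ?case by (auto intro: racg_eq.refl)
next
  case (snoc t xs)
  let ?P = "word_heap X xs {}"
  obtain ys where ys: "set ys \<subseteq> \<Union>X" "racg_eq X xs ys" "length ys = card ?P" using snoc by auto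
  have Pe: "word_heap X ys {} = ?P" using word_heap_racg_eq[OF ys(2) heap_empty] by simp
  have F: "finite ?P" using heap_word_heap[OF heap_empty] unfolding heap_def by blast
  have e: "racg_eq X (xs @ [t]) (ys @ [t])" using ys(2) by (intro racg_eq_append racg_eq.refl)
  show ?case
  proof (cases "(t, slot X ?P t) \<in> ?P")
    case False
    then have "card (toggle X {t} ?P) = Suc (card ?P)" using F toggle_singleton_insert(1)[OF False] by simp
    then show ?thesis using ys e snoc.prems by (intro exI[of _ "ys @ [t]"]) auto
  next
    case True
    then have c: "Suc (card (toggle X {t} ?P)) = card ?P"
      using F toggle_singleton_insert(2)[OF True] by (metis card_Suc_Diff1)
    obtain zs where zs: "set zs \<subseteq> set ys" "length ys = Suc (length zs)" "racg_eq X ys (zs @ [t])"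
      using racg_exchange[of X ys t] ys(3) True unfolding Pe by auto
    have "racg_eq X (ys @ [t]) ((zs @ [t]) @ [t])" using zs(3) by (intro racg_eq_append racg_eq.refl)
    moreover have "racg_eq X (zs @ [t, t] @ []) (zs @ [])" using snoc.prems by (intro racg_eq.square) simp
    ultimately have "racg_eq X (xs @ [t]) zs" using e by (auto intro: racg_eq.trans)
    then show ?thesis using zs ys c by (intro exI[of _ zs]) auto
  qed
qed

text \<open>Equal heaps make the heap of \<open>xs @ rev ys\<close> empty; a reduced word for it
  then has length 0, and \<open>rev ys\<close> represents the inverse of \<open>ys\<close>.\<close>

lemma racg_eq_iff_word_heap:
  assumes "set xs \<subseteq> \<Union>X" "set ys \<subseteq> \<Union>X"
  shows "racg_eq X xs ys \<longleftrightarrow> word_heap X xs {} = word_heap X ys {}"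
proof
  show "racg_eq X xs ys \<Longrightarrow> word_heap X xs {} = word_heap X ys {}"
    by (rule word_heap_racg_eq[OF _ heap_empty])
next
  assume eq: "word_heap X xs {} = word_heap X ys {}"
  have "word_heap X (xs @ rev ys) {} = word_heap X (ys @ rev ys) {}" using eq by simp
  also have "\<dots> = {}" using word_heap_racg_eq[OF racg_eq_rev[OF assms(2)] heap_empty] by simp
  finally have "racg_eq X (xs @ rev ys) []"
    using racg_reduced_word[of "xs @ rev ys" X] assms by auto
  then have "racg_eq X ((xs @ rev ys) @ ys) ([] @ ys)" by (intro racg_eq_append racg_eq.refl)
  moreover have "racg_eq X (xs @ (rev ys @ rev (rev ys)) @ []) (xs @ [] @ [])"
    using assms by (intro racg_eq_cong racg_eq_rev) simp
  ultimately show "racg_eq X xs ys" by (auto intro: racg_eq.trans racg_eq.sym)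
qed

section \<open>The group of word classes and its embedding into heaps\<close>

definition racg_class :: "'a set set \<Rightarrow> 'a list \<Rightarrow> 'a list set" where
  "racg_class X xs = racg_rel X `` {xs}"

lemma equiv_racg_rel: "equiv (lists (\<Union>X)) (racg_rel X)"
  unfolding racg_rel_def
  by (rule equivI) (auto simp: refl_on_def sym_def trans_def intro: racg_eq.intros)

lemma racg_class_eq_iff:
  assumes "set xs \<subseteq> \<Union>X" "set ys \<subseteq> \<Union>X"
  shows "racg_class X xs = racg_class X ys \<longleftrightarrow> racg_eq X xs ys"
  using eq_equiv_class_iff[OF equiv_racg_rel, of xs X ys] assms
  unfolding racg_class_def by (auto simp: racg_rel_def lists_eq_set)

lemma in_racg_class: "set xs \<subseteq> \<Union>X \<Longrightarrow> ys \<in> racg_class X xs \<longleftrightarrow> set ys \<subseteq> \<Union>X \<and> racg_eq X xs ys"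
  unfolding racg_class_def racg_rel_def by (auto simp: lists_eq_set)

lemma racg_carrier: "carrier (racg X) = racg_class X ` {xs. set xs \<subseteq> \<Union>X}"
  unfolding racg_def racg_class_def quotient_def by (auto simp: lists_eq_set)

lemma racg_mult_class:
  assumes "set xs \<subseteq> \<Union>X" "set ys \<subseteq> \<Union>X"
  shows "racg_class X xs \<otimes>\<^bsub>racg X\<^esub> racg_class X ys = racg_class X (xs @ ys)"
proof -
  have "racg_rel X `` {xs' @ ys'} = racg_class X (xs @ ys)"
    if "xs' \<in> racg_class X xs" "ys' \<in> racg_class X ys" for xs' ys'
  proof -
    have "racg_class X (xs' @ ys') = racg_class X (xs @ ys)"
      using that assms in_racg_class[of xs X] in_racg_class[of ys X]
      by (subst racg_class_eq_iff) (auto intro: racg_eq_append racg_eq.sym)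
    then show ?thesis unfolding racg_class_def .
  qed
  moreover have "xs \<in> racg_class X xs" "ys \<in> racg_class X ys"
    using assms in_racg_class[of xs X] in_racg_class[of ys X] racg_eq.refl by blast+
  ultimately show ?thesis unfolding racg_def by auto
qed

lemma racg_one: "\<one>\<^bsub>racg X\<^esub> = racg_class X []"
  unfolding racg_def racg_class_def by simp

lemma group_racg: "group (racg X)"
proof (rule groupI)
  fix x y z assume x: "x \<in> carrier (racg X)" and y: "y \<in> carrier (racg X)" and z: "z \<in> carrier (racg X)"
  then obtain xs ys zs where w: "x = racg_class X xs" "set xs \<subseteq> \<Union>X" "y = racg_class X ys" "set ys \<subseteq> \<Union>X"
    "z = racg_class X zs" "set zs \<subseteq> \<Union>X" unfolding racg_carrier by auto
  then show "x \<otimes>\<^bsub>racg X\<^esub> y \<otimes>\<^bsub>racg X\<^esub> z = x \<otimes>\<^bsub>racg X\<^esub> (y \<otimes>\<^bsub>racg X\<^esub> z)"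
    by (simp add: racg_mult_class)
next
  fix x y assume "x \<in> carrier (racg X)" "y \<in> carrier (racg X)"
  then obtain xs ys where w: "x = racg_class X xs" "set xs \<subseteq> \<Union>X" "y = racg_class X ys" "set ys \<subseteq> \<Union>X"
    unfolding racg_carrier by auto
  then have "x \<otimes>\<^bsub>racg X\<^esub> y = racg_class X (xs @ ys)" by (simp add: racg_mult_class)
  then show "x \<otimes>\<^bsub>racg X\<^esub> y \<in> carrier (racg X)" unfolding racg_carrier using w by auto
next
  show "\<one>\<^bsub>racg X\<^esub> \<in> carrier (racg X)" unfolding racg_one racg_carrier by auto
next
  fix x assume "x \<in> carrier (racg X)"
  then obtain xs where w: "x = racg_class X xs" "set xs \<subseteq> \<Union>X" unfolding racg_carrier by auto
  then show "\<one>\<^bsub>racg X\<^esub> \<otimes>\<^bsub>racg X\<^esub> x = x" unfolding racg_one by (simp add: racg_mult_class)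
  have "racg_class X (rev xs) \<otimes>\<^bsub>racg X\<^esub> x = \<one>\<^bsub>racg X\<^esub>"
    using racg_eq_rev[of "rev xs" X] w unfolding racg_one by (simp add: racg_mult_class racg_class_eq_iff)
  moreover have "racg_class X (rev xs) \<in> carrier (racg X)" unfolding racg_carrier using w by auto
  ultimately show "\<exists>y\<in>carrier (racg X). y \<otimes>\<^bsub>racg X\<^esub> x = \<one>\<^bsub>racg X\<^esub>" by blast
qed

definition heap_of :: "'a set set \<Rightarrow> 'a list set \<Rightarrow> ('a \<times> nat) set" where
  "heap_of X A = word_heap X (SOME xs. xs \<in> A) {}"

lemma heap_of_class: "set xs \<subseteq> \<Union>X \<Longrightarrow> heap_of X (racg_class X xs) = word_heap X xs {}"
proof -
  assume xs: "set xs \<subseteq> \<Union>X"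
  have "xs \<in> racg_class X xs" using in_racg_class[OF xs] xs racg_eq.refl by blast
  then have "(SOME xs'. xs' \<in> racg_class X xs) \<in> racg_class X xs" by (rule someI)
  then have "racg_eq X xs (SOME xs'. xs' \<in> racg_class X xs)" using in_racg_class[OF xs] by blast
  then show ?thesis unfolding heap_of_def using word_heap_racg_eq[OF _ heap_empty] by metis
qed

lemma heap_heap_of: "heap X (heap_of X A)"
  unfolding heap_of_def by (rule heap_word_heap[OF heap_empty])

lemma heap_of_one: "heap_of X \<one>\<^bsub>racg X\<^esub> = {}"
  unfolding racg_one by (simp add: heap_of_class)

lemma inj_on_heap_of: "inj_on (heap_of X) (carrier (racg X))"
proof (rule inj_onI)
  fix A B assume A: "A \<in> carrier (racg X)" "B \<in> carrier (racg X)" "heap_of X A = heap_of X B"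
  then obtain xs ys where "A = racg_class X xs" "set xs \<subseteq> \<Union>X" "B = racg_class X ys" "set ys \<subseteq> \<Union>X"
    unfolding racg_carrier by auto
  then show "A = B" using A(3) by (simp add: heap_of_class racg_class_eq_iff racg_eq_iff_word_heap)
qed

lemma heap_of_letters:
  assumes "A \<in> carrier (racg X)" "(t, k) \<in> heap_of X A"
  shows "t \<in> \<Union>X"
proof -
  obtain xs where xs: "A = racg_class X xs" "set xs \<subseteq> \<Union>X" using assms unfolding racg_carrier by auto
  have "fst ` word_heap X xs P \<subseteq> fst ` P \<union> set xs" for P
  proof (induction xs arbitrary: P)
    case (Cons x xs)
    have "fst ` word_heap X (x # xs) P \<subseteq> fst ` toggle X {x} P \<union> set xs" using Cons[of "toggle X {x} P"] by simp
    also have "fst ` toggle X {x} P \<subseteq> insert x (fst ` P)" unfolding toggle_def by auto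
    finally show ?case by auto
  qed simp
  then have "fst ` heap_of X A \<subseteq> set xs" using xs heap_of_class[of xs X] by fastforce
  then show ?thesis using assms(2) xs(2) by (metis fst_conv image_eqI subsetD)
qed

text \<open>On a simplex the choice of the enumeration is immaterial, since its vertices
  commute.\<close>

definition simplex_elt :: "'a set set \<Rightarrow> 'a set \<Rightarrow> 'a list set" where
  "simplex_elt X \<sigma> = racg_class X (SOME xs. set xs = \<sigma> \<and> distinct xs)"

lemma word_heap_commuting:
  "distinct xs \<Longrightarrow> commuting X (set xs) \<Longrightarrow> word_heap X xs P = toggle X (set xs) P"
proof (induction xs rule: rev_induct)
  case (snoc t xs)
  then have c: "commuting X (set xs)" "t \<notin> set xs" "\<And>s. s \<in> set xs \<Longrightarrow> adjacent X s t"
    unfolding commuting_def by auto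
  then show ?case using snoc toggle_insert[of t "set xs" X P] by simp
qed simp

locale flag_nerve =
  fixes X :: "'a set set"
  assumes flag: "flag_complex X"
begin

abbreviation W where "W \<equiv> racg X"
abbreviation w where "w \<equiv> simplex_elt X"
abbreviation \<Phi> where "\<Phi> \<equiv> heap_of X"
text \<open>The empty face gives the identity element, so that a vertex of Th(\<Sigma>) is
  parametrized from itself by \<open>{}\<close>.\<close>

definition faces where "faces = insert {} X"

sublocale W: group W by (rule group_racg)

lemma faces_iff: "\<sigma> \<in> faces \<longleftrightarrow> finite \<sigma> \<and> (\<forall>u\<in>\<sigma>. \<forall>v\<in>\<sigma>. {u, v} \<in> X)"
  unfolding faces_def by (rule flag_simplex_empty_iff[OF flag])

lemma empty_faces [simp]: "{} \<in> faces"
  unfolding faces_def by simp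

lemma faces_subset: "\<sigma> \<in> faces \<Longrightarrow> \<tau> \<subseteq> \<sigma> \<Longrightarrow> \<tau> \<in> faces"
  unfolding faces_def using flag_simplexD(3)[OF flag, of \<sigma> \<tau>] by blast

lemma faces_vertices: "\<sigma> \<in> faces \<Longrightarrow> \<sigma> \<subseteq> \<Union>X"
  unfolding faces_def by auto

lemma faces_commuting_iff: "\<sigma> \<in> faces \<longleftrightarrow> commuting X \<sigma> \<and> \<sigma> \<subseteq> \<Union>X"
  unfolding faces_iff commuting_def adjacent_def using flag_vertex[OF flag] by fastforce

lemma faces_Un_iff:
  assumes "\<sigma> \<in> faces" "\<tau> \<in> faces"
  shows "\<sigma> \<union> \<tau> \<in> faces \<longleftrightarrow> (\<forall>s\<in>\<sigma>. \<forall>t\<in>\<tau>. {s, t} \<in> X)"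
  using assms unfolding faces_iff by (simp add: ball_Un) (metis insert_commute)

lemma simplex_word:
  assumes "\<sigma> \<in> faces"
  obtains xs where "w \<sigma> = racg_class X xs" "set xs = \<sigma>" "distinct xs"
proof -
  have "finite \<sigma>" using assms faces_iff by blast
  then have "\<exists>xs. set xs = \<sigma> \<and> distinct xs" by (rule finite_distinct_list)
  then have "set (SOME xs. set xs = \<sigma> \<and> distinct xs) = \<sigma> \<and> distinct (SOME xs. set xs = \<sigma> \<and> distinct xs)"
    by (rule someI_ex)
  then show ?thesis using that unfolding simplex_elt_def by blast
qed

lemma w_closed: "\<sigma> \<in> faces \<Longrightarrow> w \<sigma> \<in> carrier W"
  using simplex_word[of \<sigma>] faces_vertices[of \<sigma>] unfolding racg_carrier by (metis (mono_tags) image_eqI mem_Collect_eq)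

lemma heap_of_mult_class:
  assumes "A \<in> carrier W" "set xs \<subseteq> \<Union>X"
  shows "\<Phi> (A \<otimes>\<^bsub>W\<^esub> racg_class X xs) = word_heap X xs (\<Phi> A)"
proof -
  obtain as where "A = racg_class X as" "set as \<subseteq> \<Union>X" using assms unfolding racg_carrier by auto
  then show ?thesis using assms by (simp add: racg_mult_class heap_of_class)
qed

lemma heap_of_mult_w:
  assumes "A \<in> carrier W" "\<sigma> \<in> faces"
  shows "\<Phi> (A \<otimes>\<^bsub>W\<^esub> w \<sigma>) = toggle X \<sigma> (\<Phi> A)"
proof -
  obtain xs where xs: "w \<sigma> = racg_class X xs" "set xs = \<sigma>" "distinct xs" using simplex_word[OF assms(2)] .
  then show ?thesis using heap_of_mult_class[OF assms(1), of xs] faces_vertices[OF assms(2)]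
      word_heap_commuting[OF xs(3)] assms(2) faces_commuting_iff by simp
qed

lemma w_empty: "w {} = \<one>\<^bsub>W\<^esub>"
proof -
  have "(SOME xs. set xs = {} \<and> distinct xs) = []" by (rule some_equality) simp_all
  then show ?thesis unfolding simplex_elt_def racg_one by (rule arg_cong)
qed

lemma w_singleton: "w {t} = racg_gen X t"
proof -
  have "(SOME xs. set xs = {t} \<and> distinct xs) = [t]"
  proof (rule some_equality)
    fix xs assume xs: "set xs = {t} \<and> distinct xs"
    then have "length xs = 1" using distinct_card[of xs] by simp
    then obtain x where "xs = [x]" by (cases xs) simp_all
    then show "xs = [t]" using xs by simp
  qed simp
  then show ?thesis unfolding simplex_elt_def racg_gen_def racg_class_def by simp
qed

lemma w_mult_w:
  assumes "\<sigma> \<in> faces" "\<tau> \<in> faces" "\<sigma> \<union> \<tau> \<in> faces"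
  shows "w \<sigma> \<otimes>\<^bsub>W\<^esub> w \<tau> = w (sym_diff \<sigma> \<tau>)"
proof -
  have c: "commuting X (\<sigma> \<union> \<tau>)" using assms(3) faces_commuting_iff by blast
  have d: "sym_diff \<sigma> \<tau> \<in> faces" by (rule faces_subset[OF assms(3)]) auto
  have \<Phi>: "\<Phi> (w \<rho>) = toggle X \<rho> {}" if "\<rho> \<in> faces" for \<rho>
    using heap_of_mult_w[OF W.one_closed that] w_closed[OF that] heap_of_one[of X] by simp
  have "\<Phi> (w \<sigma> \<otimes>\<^bsub>W\<^esub> w \<tau>) = \<Phi> (w (sym_diff \<sigma> \<tau>))"
    using heap_of_mult_w[OF w_closed[OF assms(1)] assms(2)] \<Phi>[OF assms(1)] \<Phi>[OF d]
      toggle_toggle[OF heap_empty c] by simp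
  then show ?thesis using inj_onD[OF inj_on_heap_of] w_closed d assms(1,2) by (metis W.m_closed)
qed

lemma w_mult_cancel:
  assumes "A \<in> carrier W" "\<sigma> \<in> faces"
  shows "A \<otimes>\<^bsub>W\<^esub> w \<sigma> \<otimes>\<^bsub>W\<^esub> w \<sigma> = A"
  using assms w_mult_w[of \<sigma> \<sigma>] w_closed[of \<sigma>] w_empty by (simp add: W.m_assoc)

lemma slot_empty: "slot X {} t = 0"
  using height_eqI[of "{}" X t 0] unfolding slot_def by simp

lemma toggle_empty_heap: "toggle X \<sigma> {} = (\<lambda>s. (s, 0)) ` \<sigma>"
  by (auto simp: toggle_iff slot_empty)

text \<open>If \<open>t \<in> \<rho>\<close> did not commute with some \<open>s \<in> \<sigma>\<close>, the heap of \<open>w\<^sub>\<sigma> w\<^sub>\<rho>\<close> would have a second layer.\<close>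

lemma w_mult_eq_w:
  assumes "A \<in> carrier W" "\<sigma> \<in> faces" "\<rho> \<in> faces" "\<tau> \<in> faces" "A \<otimes>\<^bsub>W\<^esub> w \<sigma> \<otimes>\<^bsub>W\<^esub> w \<rho> = A \<otimes>\<^bsub>W\<^esub> w \<tau>"
  shows "\<sigma> \<union> \<rho> \<in> faces" "\<tau> = sym_diff \<sigma> \<rho>"
proof -
  have "w \<sigma> \<otimes>\<^bsub>W\<^esub> w \<rho> = w \<tau>"
    using assms w_closed by (simp add: W.m_assoc)
  then have "toggle X \<rho> (\<Phi> (\<one>\<^bsub>W\<^esub> \<otimes>\<^bsub>W\<^esub> w \<sigma>)) = \<Phi> (\<one>\<^bsub>W\<^esub> \<otimes>\<^bsub>W\<^esub> w \<tau>)"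
    using heap_of_mult_w[OF w_closed[OF assms(2)] assms(3)] w_closed assms by simp
  then have eq: "toggle X \<rho> ((\<lambda>s. (s, 0)) ` \<sigma>) = (\<lambda>s. (s, 0)) ` \<tau>"
    using assms heap_of_mult_w[OF W.one_closed] by (simp add: heap_of_one toggle_empty_heap del: W.l_one)
  let ?P = "(\<lambda>s. (s, 0::nat)) ` \<sigma>"
  have fP: "finite ?P" using assms(2) faces_iff by blast
  have "{s, t} \<in> X" if st: "s \<in> \<sigma>" "t \<in> \<rho>" for s t
  proof (rule ccontr)
    assume n: "{s, t} \<notin> X"
    have "\<not> adjacent X s t" using n unfolding adjacent_def by blast
    then have h: "0 < height X ?P t" using height_bound[OF fP, of s 0 X t] st by blast
    have "t \<notin> \<sigma>" using n st assms(2) faces_iff by blast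
    then have "slot X ?P t = height X ?P t" unfolding slot_def by auto
    then have "(t, height X ?P t) \<in> toggle X \<rho> ?P" using st \<open>t \<notin> \<sigma>\<close> by (auto simp: toggle_iff)
    then show False using h unfolding eq by auto
  qed
  then show u: "\<sigma> \<union> \<rho> \<in> faces" using faces_Un_iff assms by simp
  have c: "commuting X (\<sigma> \<union> \<rho>)" using u faces_commuting_iff by blast
  have "toggle X \<rho> (toggle X \<sigma> {}) = toggle X (sym_diff \<sigma> \<rho>) {}" by (rule toggle_toggle[OF heap_empty c])
  then have "(\<lambda>s. (s, 0::nat)) ` \<tau> = (\<lambda>s. (s, 0)) ` (sym_diff \<sigma> \<rho>)"
    using eq unfolding toggle_empty_heap by simp
  then show "\<tau> = sym_diff \<sigma> \<rho>" by (subst (asm) inj_image_eq_iff) (auto intro: injI)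
qed

lemma w_inj:
  assumes "A \<in> carrier W" "\<sigma> \<in> faces" "\<tau> \<in> faces" "A \<otimes>\<^bsub>W\<^esub> w \<sigma> = A \<otimes>\<^bsub>W\<^esub> w \<tau>"
  shows "\<sigma> = \<tau>"
  using w_mult_eq_w(2)[of A \<sigma> "{}" \<tau>] assms w_empty w_closed by auto

end

section \<open>The thickened Davis complex\<close>

lemma (in flag_nerve) w_inv: "\<sigma> \<in> faces \<Longrightarrow> inv\<^bsub>W\<^esub> (w \<sigma>) = w \<sigma>"
  using w_mult_w[of \<sigma> \<sigma>] w_empty w_closed[of \<sigma>] by (intro W.inv_equality) simp_all

text \<open>Elements \<open>w \<sigma>\<close> with \<sigma> inside a common simplex multiply by
  symmetric difference, so these elements are already closed under products: the subgroup is
  elementary abelian of exponent 2.\<close>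

lemma (in flag_nerve) special_subgroup_simplex:
  assumes T: "T \<in> faces"
  shows "special_subgroup X T = w ` Pow T"
proof
  have P: "\<sigma> \<in> faces" if "\<sigma> \<subseteq> T" for \<sigma> using faces_subset[OF T that] .
  show "special_subgroup X T \<subseteq> w ` Pow T"
  proof
    fix x assume "x \<in> special_subgroup X T"
    then have "x \<in> generate W (racg_gen X ` T)" unfolding special_subgroup_def .
    then show "x \<in> w ` Pow T"
    proof induction
      case one then show ?case using w_empty by (metis Pow_bottom image_eqI)
    next
      case (incl h)
      then obtain t where "t \<in> T" "h = w {t}" using w_singleton by auto
      then show ?case by blast
    next
      case (inv h)
      then obtain t where t: "t \<in> T" "h = w {t}" using w_singleton by auto
      then have "inv\<^bsub>W\<^esub> h = w {t}" using w_inv[of "{t}"] P[of "{t}"] by simp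
      then show ?case using t by blast
    next
      case (eng h1 h2)
      then obtain \<sigma> \<tau> where s: "\<sigma> \<subseteq> T" "\<tau> \<subseteq> T" "h1 = w \<sigma>" "h2 = w \<tau>" by blast
      then have "h1 \<otimes>\<^bsub>W\<^esub> h2 = w (sym_diff \<sigma> \<tau>)" using w_mult_w[of \<sigma> \<tau>] P[of \<sigma>] P[of \<tau>] P[of "\<sigma> \<union> \<tau>"] by simp
      moreover have "sym_diff \<sigma> \<tau> \<in> Pow T" using s by auto
      ultimately show ?case by blast
    qed
  qed
  show "w ` Pow T \<subseteq> special_subgroup X T"
  proof
    fix x assume "x \<in> w ` Pow T"
    then obtain \<sigma> where \<sigma>: "\<sigma> \<subseteq> T" "x = w \<sigma>" by blast
    have "finite \<sigma>" using \<sigma> P faces_iff by blast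
    then have "w \<sigma> \<in> generate W (racg_gen X ` T)" using \<sigma>(1)
    proof (induction \<sigma>)
      case empty then show ?case using w_empty generate.one by simp
    next
      case (insert t \<sigma>)
      have "w \<sigma> \<otimes>\<^bsub>W\<^esub> w {t} = w (insert t \<sigma>)"
        using w_mult_w[of \<sigma> "{t}"] P[of \<sigma>] P[of "{t}"] P[of "insert t \<sigma>"] insert by (simp add: insert_Diff_if)
      moreover have "w {t} \<in> generate W (racg_gen X ` T)"
        using insert.prems w_singleton by (auto intro: generate.incl)
      ultimately show ?case using insert generate.eng by (metis insert_subset)
    qed
    then show "x \<in> special_subgroup X T" unfolding special_subgroup_def \<sigma>(2) .
  qed
qed

text \<open>The heap of the alternating word in \<open>s\<close> and \<open>t\<close> of length \<open>n\<close> is a tower of height \<open>n\<close>.\<close>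

lemma (in flag_nerve) infinite_special_subgroup:
  assumes st: "s \<in> T" "t \<in> T" "{s} \<in> X" "{t} \<in> X" "{s, t} \<notin> X"
  shows "infinite (special_subgroup X T)"
proof
  assume fin: "finite (special_subgroup X T)"
  define x where "x n = (if even n then s else t)" for n :: nat
  define a where "a n = rec_nat \<one>\<^bsub>W\<^esub> (\<lambda>n y. y \<otimes>\<^bsub>W\<^esub> w {x n}) n" for n
  have a0: "a 0 = \<one>\<^bsub>W\<^esub>" and aS: "\<And>n. a (Suc n) = a n \<otimes>\<^bsub>W\<^esub> w {x n}" unfolding a_def by simp_all
  have xX: "{x n} \<in> faces" "x n \<in> T" for n using st unfolding x_def faces_def by auto
  have ne: "x (Suc n) \<noteq> x n" for n using st unfolding x_def by auto
  have nadj: "\<not> adjacent X (x n) (x m)" for n m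
    using st unfolding x_def adjacent_def by (auto simp: insert_commute)
  have a: "a n \<in> carrier W" for n
    by (induction n) (use a0 aS xX w_closed in simp_all)
  have "a n \<in> generate W (racg_gen X ` T)" for n
  proof (induction n)
    case 0 then show ?case unfolding a0 by (rule generate.one)
  next
    case (Suc n)
    have "w {x n} \<in> racg_gen X ` T" using xX(2) w_singleton by simp
    from generate.eng[OF Suc generate.incl[OF this]] show ?case unfolding aS .
  qed
  then have sub: "range a \<subseteq> special_subgroup X T" unfolding special_subgroup_def by blast
  define Q where "Q n = (\<lambda>k. (x k, k)) ` {..<n}" for n
  have "\<Phi> (a n) = Q n" for n
  proof (induction n)
    case 0 then show ?case unfolding a0 Q_def by (simp add: heap_of_one)
  next
    case (Suc n)
    have h: "height X (Q n) (x n) = n"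
      by (rule height_eqI) (use nadj in \<open>auto simp: Q_def\<close>)
    \<comment> \<open>The letters alternate, so the new letter differs from the one on top and does
      not cancel it.\<close>
    have new: "(x n, n - 1) \<notin> Q n" if "0 < n" using ne[of "n - 1"] that unfolding Q_def by auto
    have slot: "slot X (Q n) (x n) = n" unfolding slot_def h using new by auto
    have "(x n, n) \<notin> Q n" unfolding Q_def by auto
    then have "toggle X {x n} (Q n) = insert (x n, n) (Q n)"
      using toggle_singleton_insert(1)[of "x n" X "Q n"] slot by simp
    also have "\<dots> = Q (Suc n)" unfolding Q_def by (simp add: lessThan_Suc)
    finally show ?case unfolding aS using heap_of_mult_w[OF a xX(1)] Suc by simp
  qed
  moreover have "card (Q n) = n" for n unfolding Q_def by (subst card_image) (auto intro: inj_onI)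
  ultimately have "inj a" by (intro injI) metis
  then show False using fin sub finite_subset range_inj_infinite by blast
qed

locale finite_flag_nerve = flag_nerve +
  assumes fin: "finite X"
begin

lemma finite_faces: "finite faces"
  unfolding faces_def using fin by simp

text \<open>Two distinct non-adjacent vertices generate an infinite dihedral group, so only cliques
  are spherical. The cubes of \<Sigma> are thereby indexed by group elements and faces of
  \<open>X\<close>.\<close>

lemma spherical_iff: "spherical X T \<longleftrightarrow> T \<in> faces"
proof
  assume T: "T \<in> faces"
  then have "finite (w ` Pow T)" using faces_iff by blast
  then show "spherical X T"
    unfolding spherical_def special_subgroup_simplex[OF T] using faces_vertices[OF T] by blast
next
  assume T: "spherical X T"
  have V: "T \<subseteq> \<Union>X" using T unfolding spherical_def by blast
  have "finite (\<Union>X)" using fin flag_simplexD(1)[OF flag] by blast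
  then have "finite T" using V finite_subset by blast
  moreover have "{s, t} \<in> X" if "s \<in> T" "t \<in> T" for s t
    using infinite_special_subgroup[of s T t] T that V flag_vertex[OF flag] unfolding spherical_def by blast
  ultimately show "T \<in> faces" unfolding faces_iff by blast
qed

definition cube :: "'a list set \<Rightarrow> 'a set \<Rightarrow> 'a list set set" where
  "cube A T = (\<lambda>\<sigma>. A \<otimes>\<^bsub>W\<^esub> w \<sigma>) ` Pow T"

lemma coset_eq_cube: "T \<in> faces \<Longrightarrow> A <#\<^bsub>W\<^esub> special_subgroup X T = cube A T"
  unfolding special_subgroup_simplex cube_def l_coset_def by auto

lemma davis_complex_cubes: "davis_complex X = {cube A T | A T. A \<in> carrier W \<and> T \<in> faces}"
  unfolding davis_complex_def spherical_iff using coset_eq_cube by (metis (lifting))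

abbreviation Th where "Th \<equiv> thickening (davis_complex X)"

lemma Th_iff: "U \<in> Th \<longleftrightarrow> U \<noteq> {} \<and> (\<exists>A\<in>carrier W. \<exists>T\<in>faces. U \<subseteq> cube A T)"
  unfolding thickening_def davis_complex_cubes by blast

lemma mult_w_closed: "A \<in> carrier W \<Longrightarrow> \<sigma> \<in> faces \<Longrightarrow> A \<otimes>\<^bsub>W\<^esub> w \<sigma> \<in> carrier W"
  using w_closed by simp

lemma cube_closed: "A \<in> carrier W \<Longrightarrow> T \<in> faces \<Longrightarrow> cube A T \<subseteq> carrier W"
  unfolding cube_def using mult_w_closed faces_subset[of T] by (meson PowD image_subsetI)

lemma mult_w_sym_diff:
  assumes "A \<in> carrier W" "\<sigma> \<union> \<tau> \<in> faces"
  shows "A \<otimes>\<^bsub>W\<^esub> w \<sigma> \<otimes>\<^bsub>W\<^esub> w \<tau> = A \<otimes>\<^bsub>W\<^esub> w (sym_diff \<sigma> \<tau>)"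
proof -
  have \<sigma>: "\<sigma> \<in> faces" and \<tau>: "\<tau> \<in> faces" using faces_subset[OF assms(2)] by (meson Un_upper1 Un_upper2)+
  show ?thesis
    unfolding W.m_assoc[OF assms(1) w_closed[OF \<sigma>] w_closed[OF \<tau>]] w_mult_w[OF \<sigma> \<tau> assms(2)] ..
qed

lemma Th_edge_iff: "{A, B} \<in> Th \<longleftrightarrow> A \<in> carrier W \<and> (\<exists>\<sigma>\<in>faces. B = A \<otimes>\<^bsub>W\<^esub> w \<sigma>)"
proof
  assume "{A, B} \<in> Th"
  then obtain C T where C: "C \<in> carrier W" "T \<in> faces" "{A, B} \<subseteq> cube C T" unfolding Th_iff by blast
  then have "A \<in> cube C T" "B \<in> cube C T" by simp_all
  then obtain \<sigma> \<tau> where s: "\<sigma> \<subseteq> T" "\<tau> \<subseteq> T" "A = C \<otimes>\<^bsub>W\<^esub> w \<sigma>" "B = C \<otimes>\<^bsub>W\<^esub> w \<tau>"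
    unfolding cube_def by (elim imageE) simp
  let ?\<delta> = "sym_diff \<sigma> \<tau>"
  have "\<sigma> \<union> ?\<delta> \<subseteq> T" using s by auto
  then have "\<sigma> \<union> ?\<delta> \<in> faces" by (rule faces_subset[OF C(2)])
  moreover have "sym_diff \<sigma> ?\<delta> = \<tau>" by auto
  ultimately have "B = A \<otimes>\<^bsub>W\<^esub> w ?\<delta>" using mult_w_sym_diff[OF C(1), of \<sigma> ?\<delta>] s by simp
  moreover have "?\<delta> \<in> faces" by (rule faces_subset[OF C(2)]) (use s in auto)
  moreover have "A \<in> carrier W" using C s mult_w_closed faces_subset by simp
  ultimately show "A \<in> carrier W \<and> (\<exists>\<sigma>\<in>faces. B = A \<otimes>\<^bsub>W\<^esub> w \<sigma>)" by blast
next
  assume "A \<in> carrier W \<and> (\<exists>\<sigma>\<in>faces. B = A \<otimes>\<^bsub>W\<^esub> w \<sigma>)"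
  then obtain \<sigma> where \<sigma>: "A \<in> carrier W" "\<sigma> \<in> faces" "B = A \<otimes>\<^bsub>W\<^esub> w \<sigma>" by blast
  have "A \<in> cube A \<sigma>" unfolding cube_def using \<sigma>(1) w_empty by (intro image_eqI[of _ _ "{}"]) simp_all
  moreover have "B \<in> cube A \<sigma>" unfolding cube_def \<sigma>(3) by blast
  ultimately show "{A, B} \<in> Th" unfolding Th_iff using \<sigma> by blast
qed

text \<open>An edge between the two yields \<rho> with \<open>w \<sigma>\<close> times
  \<open>w \<rho>\<close> equal to \<open>w \<tau>\<close>; by the heap criterion \<sigma> and
  \<rho> then span a face, which also contains \<tau>. Conversely both vertices lie in the cube at
  \<open>A\<close> over the union.\<close>

lemma Th_neighbours_iff:
  assumes "A \<in> carrier W" "\<sigma> \<in> faces" "\<tau> \<in> faces"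
  shows "{A \<otimes>\<^bsub>W\<^esub> w \<sigma>, A \<otimes>\<^bsub>W\<^esub> w \<tau>} \<in> Th \<longleftrightarrow> \<sigma> \<union> \<tau> \<in> faces"
proof
  assume "{A \<otimes>\<^bsub>W\<^esub> w \<sigma>, A \<otimes>\<^bsub>W\<^esub> w \<tau>} \<in> Th"
  then obtain \<rho> where "\<rho> \<in> faces" "A \<otimes>\<^bsub>W\<^esub> w \<tau> = A \<otimes>\<^bsub>W\<^esub> w \<sigma> \<otimes>\<^bsub>W\<^esub> w \<rho>" unfolding Th_edge_iff by blast
  then have "\<sigma> \<union> \<rho> \<in> faces" "\<tau> = sym_diff \<sigma> \<rho>" using w_mult_eq_w[of A \<sigma> \<rho> \<tau>] assms by simp_all
  then show "\<sigma> \<union> \<tau> \<in> faces" by (elim faces_subset) auto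
next
  assume "\<sigma> \<union> \<tau> \<in> faces"
  moreover have "{A \<otimes>\<^bsub>W\<^esub> w \<sigma>, A \<otimes>\<^bsub>W\<^esub> w \<tau>} \<subseteq> cube A (\<sigma> \<union> \<tau>)" unfolding cube_def by blast
  ultimately show "{A \<otimes>\<^bsub>W\<^esub> w \<sigma>, A \<otimes>\<^bsub>W\<^esub> w \<tau>} \<in> Th" unfolding Th_iff using assms(1) by blast
qed

text \<open>Pairwise unions of the parameters are faces, so flagness of \<open>X\<close> makes the
  total union a face; it is finite because \<open>X\<close> has finitely many vertices. A clique
  thus lies in one cube at \<open>A\<close>.\<close>

lemma Th_clique_params:
  assumes A: "A \<in> U" and e: "\<And>B C. B \<in> U \<Longrightarrow> C \<in> U \<Longrightarrow> {B, C} \<in> Th"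
  obtains f where "\<And>B. B \<in> U \<Longrightarrow> f B \<in> faces \<and> B = A \<otimes>\<^bsub>W\<^esub> w (f B)"
    and "\<Union>(f ` U) \<in> faces"
proof -
  have cA: "A \<in> carrier W" using e[OF A A] unfolding Th_edge_iff by blast
  have "\<forall>B\<in>U. \<exists>\<sigma>. \<sigma> \<in> faces \<and> B = A \<otimes>\<^bsub>W\<^esub> w \<sigma>" using e[OF A] unfolding Th_edge_iff by blast
  then obtain f where f: "\<And>B. B \<in> U \<Longrightarrow> f B \<in> faces \<and> B = A \<otimes>\<^bsub>W\<^esub> w (f B)" by metis
  have u: "f B \<union> f C \<in> faces" if "B \<in> U" "C \<in> U" for B C
    using e[OF that] f[OF that(1)] f[OF that(2)] Th_neighbours_iff[OF cA] by metis
  have "\<forall>s\<in>\<Union>(f ` U). \<forall>t\<in>\<Union>(f ` U). {s, t} \<in> X"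
    using u unfolding faces_iff by blast
  moreover have "finite (\<Union>(f ` U))"
  proof (rule finite_subset)
    show "\<Union>(f ` U) \<subseteq> \<Union>X" using f faces_vertices by blast
    show "finite (\<Union>X)" using fin flag_simplexD(1)[OF flag] by blast
  qed
  ultimately have "\<Union>(f ` U) \<in> faces" unfolding faces_iff by blast
  with f show ?thesis using that by blast
qed

lemma flag_Th: "flag_complex Th"
proof (rule flag_complexI)
  fix \<sigma> assume "\<sigma> \<in> Th"
  then obtain A T where "T \<in> faces" "\<sigma> \<subseteq> cube A T" "\<sigma> \<noteq> {}" unfolding Th_iff by blast
  moreover from this have "finite (cube A T)" unfolding cube_def using faces_iff by blast
  ultimately show "finite \<sigma> \<and> \<sigma> \<noteq> {}" using finite_subset by blast
next
  fix \<sigma> \<tau> assume "\<sigma> \<in> Th" "\<tau> \<subseteq> \<sigma>" "\<tau> \<noteq> {}"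
  then show "\<tau> \<in> Th" unfolding Th_iff by blast
next
  fix U assume U: "finite U" "U \<noteq> {}" and e: "\<And>u v. u \<in> U \<Longrightarrow> v \<in> U \<Longrightarrow> {u, v} \<in> Th"
  obtain A where A: "A \<in> U" using U by blast
  then have cA: "A \<in> carrier W" using e[OF A A] unfolding Th_edge_iff by blast
  obtain f where f: "\<And>B. B \<in> U \<Longrightarrow> f B \<in> faces \<and> B = A \<otimes>\<^bsub>W\<^esub> w (f B)" and T: "\<Union>(f ` U) \<in> faces"
    using Th_clique_params[OF A e] by metis
  have "U \<subseteq> cube A (\<Union>(f ` U))"
  proof
    fix B assume "B \<in> U"
    then show "B \<in> cube A (\<Union>(f ` U))" using f[of B] unfolding cube_def by blast
  qed
  then show "U \<in> Th" unfolding Th_iff using cA T U by blast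
qed

lemma vertices_Th: "\<Union>Th = carrier W"
proof
  show "\<Union>Th \<subseteq> carrier W"
  proof
    fix A assume "A \<in> \<Union>Th"
    then obtain U where U: "U \<in> Th" "A \<in> U" by blast
    then obtain B T where "B \<in> carrier W" "T \<in> faces" "U \<subseteq> cube B T" unfolding Th_iff by blast
    then show "A \<in> carrier W" using cube_closed[of B T] U(2) by (simp add: subset_iff)
  qed
  show "carrier W \<subseteq> \<Union>Th"
  proof
    fix A assume "A \<in> carrier W"
    then have "{A, A} \<in> Th" unfolding Th_edge_iff using w_empty by (metis W.r_one empty_faces)
    then show "A \<in> \<Union>Th" by blast
  qed
qed

end

section \<open>Links of the thickened Davis complex\<close>

text \<open>The sets of non-neighbours in one clique of the vertices of another clique form a chain:
  incomparable ones would give a full 4-cycle.\<close>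

lemma five_large_dominating_vertex:
  assumes X: "five_large X" and S: "finite S" "S \<noteq> {}" "\<And>a b. a \<in> S \<Longrightarrow> b \<in> S \<Longrightarrow> {a, b} \<in> X"
    and D: "\<And>a b. a \<in> D \<Longrightarrow> b \<in> D \<Longrightarrow> {a, b} \<in> X"
  obtains s where "s \<in> S" "\<And>a d. a \<in> S \<Longrightarrow> d \<in> D \<Longrightarrow> {a, d} \<notin> X \<Longrightarrow> {s, d} \<notin> X"
proof -
  have "\<exists>s\<in>S. \<forall>a\<in>S. \<forall>d\<in>D. {a, d} \<notin> X \<longrightarrow> {s, d} \<notin> X"
    using S
  proof (induction S rule: finite_ne_induct)
    case (insert x F)
    have "\<exists>s\<in>F. \<forall>a\<in>F. \<forall>d\<in>D. {a, d} \<notin> X \<longrightarrow> {s, d} \<notin> X"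
      by (rule insert.IH) (simp add: insert.prems)
    then obtain s where s: "s \<in> F" "\<And>a d. a \<in> F \<Longrightarrow> d \<in> D \<Longrightarrow> {a, d} \<notin> X \<Longrightarrow> {s, d} \<notin> X" by blast
    consider "\<And>d. d \<in> D \<Longrightarrow> {x, d} \<notin> X \<Longrightarrow> {s, d} \<notin> X" | "\<And>d. d \<in> D \<Longrightarrow> {s, d} \<notin> X \<Longrightarrow> {x, d} \<notin> X"
    proof (rule ccontr)
      assume n: "\<not> thesis" and c: "(\<And>d. d \<in> D \<Longrightarrow> {x, d} \<notin> X \<Longrightarrow> {s, d} \<notin> X) \<Longrightarrow> thesis"
        "(\<And>d. d \<in> D \<Longrightarrow> {s, d} \<notin> X \<Longrightarrow> {x, d} \<notin> X) \<Longrightarrow> thesis"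
      obtain d where d: "d \<in> D" "{x, d} \<notin> X" "{s, d} \<in> X" using n c(1) by blast
      obtain d' where d': "d' \<in> D" "{s, d'} \<notin> X" "{x, d'} \<in> X" using n c(2) by blast
      have "{s, d'} \<in> X"
        by (rule five_large_square[OF X, of x s d d'])
          (use d d' D[OF d(1) d'(1)] insert.prems[of x s] s(1) in \<open>simp_all add: insert_commute\<close>)
      then show False using d' by simp
    qed
    then show ?case
    proof cases
      case 1 then show ?thesis using s by (intro bexI[of _ s]) auto
    next
      case 2
      then have "\<And>a d. a \<in> F \<Longrightarrow> d \<in> D \<Longrightarrow> {a, d} \<notin> X \<Longrightarrow> {x, d} \<notin> X" using s(2) by blast
      then show ?thesis by (intro bexI[of _ x]) auto
    qed
  qed simp
  then show ?thesis using that by blast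
qed

locale five_large_nerve = finite_flag_nerve +
  assumes five_large: "five_large X"
begin

lemma square:
  "{a, b} \<in> X \<Longrightarrow> {b, c} \<in> X \<Longrightarrow> {c, d} \<in> X \<Longrightarrow> {d, a} \<in> X \<Longrightarrow> {a, c} \<notin> X \<Longrightarrow> {b, d} \<in> X"
  by (rule five_large_square[OF five_large])

text \<open>5-largeness in the form used below: the common neighbours of a non-adjacent pair are
  pairwise equal or adjacent. Vertices joined to a whole rim are compared in this way.\<close>

lemma common_neighbours:
  assumes "{a, c} \<notin> X" "{u, a} \<in> X" "{u, c} \<in> X" "{v, a} \<in> X" "{v, c} \<in> X"
  shows "{u, v} \<in> X"
  using square[of a u c v] assms by (simp add: insert_commute)

lemma faces_edge: "\<sigma> \<union> \<tau> \<in> faces \<Longrightarrow> a \<in> \<sigma> \<Longrightarrow> b \<in> \<tau> \<Longrightarrow> {a, b} \<in> X"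
  unfolding faces_iff by blast

text \<open>Opposite simplices of the rim fail to span a face, so each of the two pairs contains a
  non-edge. Any such choice gives a square in \<open>X\<close> without diagonals.\<close>

lemma no_wheel4_Th: "\<not> wheel4 Th A B1 B2 B3 B4"
proof
  assume h: "wheel4 Th A B1 B2 B3 B4"
  have A: "A \<in> carrier W" using h Th_edge_iff unfolding wheel4_def by blast
  note N = Th_neighbours_iff[OF A]
  obtain \<sigma>1 \<sigma>2 \<sigma>3 \<sigma>4 where s: "\<sigma>1 \<in> faces" "\<sigma>2 \<in> faces" "\<sigma>3 \<in> faces" "\<sigma>4 \<in> faces"
    and B: "B1 = A \<otimes>\<^bsub>W\<^esub> w \<sigma>1" "B2 = A \<otimes>\<^bsub>W\<^esub> w \<sigma>2" "B3 = A \<otimes>\<^bsub>W\<^esub> w \<sigma>3" "B4 = A \<otimes>\<^bsub>W\<^esub> w \<sigma>4"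
    using h unfolding wheel4_def Th_edge_iff[of A] by metis
  have u: "\<sigma>1 \<union> \<sigma>2 \<in> faces" "\<sigma>2 \<union> \<sigma>3 \<in> faces" "\<sigma>3 \<union> \<sigma>4 \<in> faces" "\<sigma>4 \<union> \<sigma>1 \<in> faces"
    and n: "\<sigma>1 \<union> \<sigma>3 \<notin> faces" "\<sigma>2 \<union> \<sigma>4 \<notin> faces"
    using h s unfolding wheel4_def B by (simp_all add: N)
  obtain a c where a: "a \<in> \<sigma>1" "c \<in> \<sigma>3" "{a, c} \<notin> X" using n(1) faces_Un_iff[OF s(1,3)] by blast
  obtain b d where b: "b \<in> \<sigma>2" "d \<in> \<sigma>4" "{b, d} \<notin> X" using n(2) faces_Un_iff[OF s(2,4)] by blast
  show False using square[of a b c d] a b faces_edge[OF u(1)] faces_edge[OF u(2)] faces_edge[OF u(3)] faces_edge[OF u(4)] by blast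
qed

lemma dominating_vertex:
  assumes "S \<in> faces" "S \<noteq> {}" "D \<in> faces"
  obtains s where "s \<in> S" "\<And>a d. a \<in> S \<Longrightarrow> d \<in> D \<Longrightarrow> {a, d} \<notin> X \<Longrightarrow> {s, d} \<notin> X"
  using five_large_dominating_vertex[OF five_large, of S D] assms unfolding faces_iff by blast

text \<open>Each vertex has to be non-adjacent to two others at once. So it is chosen dominating
  against the union of the two opposite simplices, which is a face because these are neighbours on
  the rim.\<close>

lemma rim_vertices:
  assumes s: "\<sigma>1 \<in> faces" "\<sigma>2 \<in> faces" "\<sigma>3 \<in> faces" "\<sigma>4 \<in> faces" "\<sigma>5 \<in> faces"
    and u: "\<sigma>1 \<union> \<sigma>2 \<in> faces" "\<sigma>2 \<union> \<sigma>3 \<in> faces" "\<sigma>3 \<union> \<sigma>4 \<in> faces" "\<sigma>4 \<union> \<sigma>5 \<in> faces" "\<sigma>5 \<union> \<sigma>1 \<in> faces"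
    and n: "\<sigma>1 \<union> \<sigma>3 \<notin> faces" "\<sigma>2 \<union> \<sigma>4 \<notin> faces" "\<sigma>3 \<union> \<sigma>5 \<notin> faces" "\<sigma>4 \<union> \<sigma>1 \<notin> faces" "\<sigma>5 \<union> \<sigma>2 \<notin> faces"
  obtains s1 s2 s3 s4 s5 where "s1 \<in> \<sigma>1" "s2 \<in> \<sigma>2" "s3 \<in> \<sigma>3" "s4 \<in> \<sigma>4" "s5 \<in> \<sigma>5" "cycle5 X s1 s2 s3 s4 s5"
proof -
  have ne: "\<sigma>1 \<noteq> {}" "\<sigma>2 \<noteq> {}" "\<sigma>3 \<noteq> {}" "\<sigma>4 \<noteq> {}" "\<sigma>5 \<noteq> {}" using n s by auto
  obtain s1 where s1: "s1 \<in> \<sigma>1" and d1: "\<And>a d. a \<in> \<sigma>1 \<Longrightarrow> d \<in> \<sigma>3 \<union> \<sigma>4 \<Longrightarrow> {a, d} \<notin> X \<Longrightarrow> {s1, d} \<notin> X"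
    by (rule dominating_vertex[OF s(1) ne(1) u(3)]) blast
  obtain s2 where s2: "s2 \<in> \<sigma>2" and d2: "\<And>a d. a \<in> \<sigma>2 \<Longrightarrow> d \<in> \<sigma>4 \<union> \<sigma>5 \<Longrightarrow> {a, d} \<notin> X \<Longrightarrow> {s2, d} \<notin> X"
    by (rule dominating_vertex[OF s(2) ne(2) u(4)]) blast
  obtain s3 where s3: "s3 \<in> \<sigma>3" and d3: "\<And>a d. a \<in> \<sigma>3 \<Longrightarrow> d \<in> \<sigma>5 \<union> \<sigma>1 \<Longrightarrow> {a, d} \<notin> X \<Longrightarrow> {s3, d} \<notin> X"
    by (rule dominating_vertex[OF s(3) ne(3) u(5)]) blast
  obtain s4 where s4: "s4 \<in> \<sigma>4" and d4: "\<And>a d. a \<in> \<sigma>4 \<Longrightarrow> d \<in> \<sigma>1 \<union> \<sigma>2 \<Longrightarrow> {a, d} \<notin> X \<Longrightarrow> {s4, d} \<notin> X"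
    by (rule dominating_vertex[OF s(4) ne(4) u(1)]) blast
  obtain s5 where s5: "s5 \<in> \<sigma>5" and d5: "\<And>a d. a \<in> \<sigma>5 \<Longrightarrow> d \<in> \<sigma>2 \<union> \<sigma>3 \<Longrightarrow> {a, d} \<notin> X \<Longrightarrow> {s5, d} \<notin> X"
    by (rule dominating_vertex[OF s(5) ne(5) u(2)]) blast
  \<comment> \<open>Start from any non-edge between the two simplices and replace its ends by the
    dominating vertices, one after the other.\<close>
  have far: "{x, y} \<notin> X"
    if nn: "\<sigma> \<union> \<tau> \<notin> faces" "\<sigma> \<in> faces" "\<tau> \<in> faces" and x: "x \<in> \<sigma>" "y \<in> \<tau>"
      and dx: "\<And>a d. a \<in> \<sigma> \<Longrightarrow> d \<in> \<tau> \<Longrightarrow> {a, d} \<notin> X \<Longrightarrow> {x, d} \<notin> X"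
      and dy: "\<And>a d. a \<in> \<tau> \<Longrightarrow> d \<in> \<sigma> \<Longrightarrow> {a, d} \<notin> X \<Longrightarrow> {y, d} \<notin> X" for x y \<sigma> \<tau>
  proof -
    obtain a b where ab: "a \<in> \<sigma>" "b \<in> \<tau>" "{a, b} \<notin> X" using faces_Un_iff[OF nn(2,3)] nn(1) by blast
    then have "{b, x} \<notin> X" using dx[of a b] by (simp add: insert_commute)
    then show ?thesis using dy[OF ab(2) x(1)] by (simp add: insert_commute)
  qed
  have "cycle5 X s1 s2 s3 s4 s5" unfolding cycle5_def
  proof (intro conjI)
    show "{s1, s2} \<in> X" using faces_edge[OF u(1) s1 s2] .
    show "{s2, s3} \<in> X" using faces_edge[OF u(2) s2 s3] .
    show "{s3, s4} \<in> X" using faces_edge[OF u(3) s3 s4] .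
    show "{s4, s5} \<in> X" using faces_edge[OF u(4) s4 s5] .
    show "{s5, s1} \<in> X" using faces_edge[OF u(5) s5 s1] .
    show "{s1, s3} \<notin> X" by (rule far[OF n(1) s(1) s(3) s1 s3], rule d1[OF _ UnI1], assumption+, rule d3[OF _ UnI2], assumption+)
    show "{s2, s4} \<notin> X" by (rule far[OF n(2) s(2) s(4) s2 s4], rule d2[OF _ UnI1], assumption+, rule d4[OF _ UnI2], assumption+)
    show "{s3, s5} \<notin> X" by (rule far[OF n(3) s(3) s(5) s3 s5], rule d3[OF _ UnI1], assumption+, rule d5[OF _ UnI2], assumption+)
    show "{s4, s1} \<notin> X" by (rule far[OF n(4) s(4) s(1) s4 s1], rule d4[OF _ UnI1], assumption+, rule d1[OF _ UnI2], assumption+)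
    show "{s5, s2} \<notin> X" by (rule far[OF n(5) s(5) s(2) s5 s2], rule d5[OF _ UnI1], assumption+, rule d2[OF _ UnI2], assumption+)
  qed
  with s1 s2 s3 s4 s5 show ?thesis using that by blast
qed

lemma cycle5_params:
  assumes A: "A \<in> carrier W" and s: "\<sigma>1 \<in> faces" "\<sigma>2 \<in> faces" "\<sigma>3 \<in> faces" "\<sigma>4 \<in> faces" "\<sigma>5 \<in> faces"
  shows "cycle5 Th (A \<otimes>\<^bsub>W\<^esub> w \<sigma>1) (A \<otimes>\<^bsub>W\<^esub> w \<sigma>2) (A \<otimes>\<^bsub>W\<^esub> w \<sigma>3) (A \<otimes>\<^bsub>W\<^esub> w \<sigma>4) (A \<otimes>\<^bsub>W\<^esub> w \<sigma>5) \<longleftrightarrow>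
    \<sigma>1 \<union> \<sigma>2 \<in> faces \<and> \<sigma>2 \<union> \<sigma>3 \<in> faces \<and> \<sigma>3 \<union> \<sigma>4 \<in> faces \<and> \<sigma>4 \<union> \<sigma>5 \<in> faces \<and> \<sigma>5 \<union> \<sigma>1 \<in> faces \<and>
    \<sigma>1 \<union> \<sigma>3 \<notin> faces \<and> \<sigma>2 \<union> \<sigma>4 \<notin> faces \<and> \<sigma>3 \<union> \<sigma>5 \<notin> faces \<and> \<sigma>4 \<union> \<sigma>1 \<notin> faces \<and> \<sigma>5 \<union> \<sigma>2 \<notin> faces"
  using s unfolding cycle5_def by (simp add: Th_neighbours_iff[OF A])

text \<open>The cone vertex is \<open>A w\<^sub>\<kappa>\<close> with \<open>\<kappa> = \<sigma>\<^sub>1 \<inter> \<sigma>\<^sub>2\<close>.  By 5-largeness \<open>\<kappa>\<close> is joined to the opposite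
  simplex \<open>\<sigma>\<^sub>4\<close> of the rim, as both are joined to the non-adjacent vertices \<open>s\<^sub>3\<close> and \<open>s\<^sub>5\<close>.\<close>

lemma pendant_wheel_Th:
  assumes c: "cycle5 Th B1 B2 B3 B4 B5" and z: "coned Th A {B1, B2, B3, B4, B5}"
    and t: "{B1, t} \<in> Th" "{B2, t} \<in> Th"
  shows "\<exists>v. coned Th v {A, B1, B2, B3, B4, B5, t}"
proof -
  have A: "A \<in> carrier W" using z Th_edge_iff unfolding coned_def by blast
  obtain \<sigma>1 \<sigma>2 \<sigma>3 \<sigma>4 \<sigma>5 where s: "\<sigma>1 \<in> faces" "\<sigma>2 \<in> faces" "\<sigma>3 \<in> faces" "\<sigma>4 \<in> faces" "\<sigma>5 \<in> faces"
    and B: "B1 = A \<otimes>\<^bsub>W\<^esub> w \<sigma>1" "B2 = A \<otimes>\<^bsub>W\<^esub> w \<sigma>2" "B3 = A \<otimes>\<^bsub>W\<^esub> w \<sigma>3" "B4 = A \<otimes>\<^bsub>W\<^esub> w \<sigma>4" "B5 = A \<otimes>\<^bsub>W\<^esub> w \<sigma>5"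
    using z unfolding coned_def Th_edge_iff[of A] by (metis insertI1 insertI2)
  have u: "\<sigma>1 \<union> \<sigma>2 \<in> faces" "\<sigma>2 \<union> \<sigma>3 \<in> faces" "\<sigma>3 \<union> \<sigma>4 \<in> faces" "\<sigma>4 \<union> \<sigma>5 \<in> faces" "\<sigma>5 \<union> \<sigma>1 \<in> faces"
    and n: "\<sigma>1 \<union> \<sigma>3 \<notin> faces" "\<sigma>2 \<union> \<sigma>4 \<notin> faces" "\<sigma>3 \<union> \<sigma>5 \<notin> faces" "\<sigma>4 \<union> \<sigma>1 \<notin> faces" "\<sigma>5 \<union> \<sigma>2 \<notin> faces"
    using c unfolding B cycle5_params[OF A s] by blast+
  obtain s1 s2 s3 s4 s5 where r: "s1 \<in> \<sigma>1" "s2 \<in> \<sigma>2" "s3 \<in> \<sigma>3" "s4 \<in> \<sigma>4" "s5 \<in> \<sigma>5" and cyc: "cycle5 X s1 s2 s3 s4 s5"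
    using rim_vertices[OF s u n] .
  define \<kappa> where "\<kappa> = \<sigma>1 \<inter> \<sigma>2"
  let ?\<gamma> = "sym_diff \<sigma>1 \<sigma>2"
  have \<kappa>: "\<kappa> \<in> faces" using faces_subset[OF s(1)] unfolding \<kappa>_def by blast
  have \<gamma>: "?\<gamma> \<in> faces" by (rule faces_subset[OF u(1)]) auto
  \<comment> \<open>Only \<open>B1\<close> and \<open>B2\<close> are known neighbours of
    \<open>t\<close>, so \<open>t\<close> is reached from both of them and the two expressions are
    compared.\<close>
  obtain \<alpha> \<beta> where \<alpha>: "\<alpha> \<in> faces" "t = A \<otimes>\<^bsub>W\<^esub> w \<sigma>1 \<otimes>\<^bsub>W\<^esub> w \<alpha>" and \<beta>: "\<beta> \<in> faces" "t = A \<otimes>\<^bsub>W\<^esub> w \<sigma>2 \<otimes>\<^bsub>W\<^esub> w \<beta>"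
    using t unfolding B Th_edge_iff by blast
  have "\<sigma>1 \<union> ?\<gamma> \<in> faces" by (rule faces_subset[OF u(1)]) auto
  moreover have "sym_diff \<sigma>1 ?\<gamma> = \<sigma>2" by auto
  ultimately have "A \<otimes>\<^bsub>W\<^esub> w \<sigma>1 \<otimes>\<^bsub>W\<^esub> w ?\<gamma> = A \<otimes>\<^bsub>W\<^esub> w \<sigma>2" using mult_w_sym_diff[OF A, of \<sigma>1 ?\<gamma>] by simp
  then have eq: "A \<otimes>\<^bsub>W\<^esub> w \<sigma>1 \<otimes>\<^bsub>W\<^esub> w ?\<gamma> \<otimes>\<^bsub>W\<^esub> w \<beta> = A \<otimes>\<^bsub>W\<^esub> w \<sigma>1 \<otimes>\<^bsub>W\<^esub> w \<alpha>" using \<alpha>(2) \<beta>(2) by simp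
  \<comment> \<open>From \<open>B1\<close> the vertex \<open>t\<close> is reached by
    \<open>w \<alpha>\<close> and also by \<open>w ?\<gamma>\<close> followed by
    \<open>w \<beta>\<close>. So \<alpha> lies in the face
    \<open>?\<gamma> \<union> \<beta>\<close>, which contains \<open>\<sigma>1 - \<kappa>\<close>
    too; hence going from \<open>A\<close> times \<open>w \<kappa>\<close> via \<open>B1\<close> to
    \<open>t\<close> is a single edge.\<close>
  have "?\<gamma> \<union> \<beta> \<in> faces" "\<alpha> = sym_diff ?\<gamma> \<beta>"
    using w_mult_eq_w[OF mult_w_closed[OF A s(1)] \<gamma> \<beta>(1) \<alpha>(1) eq] by blast+
  then have \<gamma>\<alpha>: "(\<sigma>1 - \<kappa>) \<union> \<alpha> \<in> faces" by (elim faces_subset) (auto simp: \<kappa>_def)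
  have "\<kappa> \<union> \<sigma>4 \<in> faces" unfolding faces_Un_iff[OF \<kappa> s(4)]
  proof (intro ballI)
    fix x y assume x: "x \<in> \<kappa>" and y: "y \<in> \<sigma>4"
    show "{x, y} \<in> X"
    proof (rule common_neighbours[of s3 s5])
      show "{s3, s5} \<notin> X" using cyc unfolding cycle5_def by blast
      show "{x, s3} \<in> X" using faces_edge[OF u(2)] x r unfolding \<kappa>_def by blast
      show "{x, s5} \<in> X" using faces_edge[OF u(5), of s5 x] x r unfolding \<kappa>_def by (simp add: insert_commute)
      show "{y, s3} \<in> X" using faces_edge[OF u(3), of s3 y] y r by (simp add: insert_commute)
      show "{y, s5} \<in> X" using faces_edge[OF u(4)] y r by blast
    qed
  qed
  moreover have "\<kappa> \<union> \<sigma>1 \<in> faces" "\<kappa> \<union> \<sigma>2 \<in> faces" unfolding \<kappa>_def using s by (auto elim!: faces_subset)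
  moreover have "\<kappa> \<union> \<sigma>3 \<in> faces" "\<kappa> \<union> \<sigma>5 \<in> faces"
    by (rule faces_subset[OF u(2)], auto simp: \<kappa>_def, rule faces_subset[OF u(5)], auto simp: \<kappa>_def)
  moreover have "{A \<otimes>\<^bsub>W\<^esub> w \<kappa>, A} \<in> Th"
    using Th_neighbours_iff[OF A \<kappa> empty_faces] \<kappa> w_empty A by simp
  moreover have "{A \<otimes>\<^bsub>W\<^esub> w \<kappa>, t} \<in> Th"
  proof -
    let ?\<delta> = "\<sigma>1 - \<kappa>"
    have \<delta>: "?\<delta> \<in> faces" "\<kappa> \<union> ?\<delta> \<in> faces" using s(1) by (auto elim!: faces_subset simp: \<kappa>_def)
    have "sym_diff \<kappa> ?\<delta> = \<sigma>1" unfolding \<kappa>_def by auto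
    then have "A \<otimes>\<^bsub>W\<^esub> w \<sigma>1 = A \<otimes>\<^bsub>W\<^esub> w \<kappa> \<otimes>\<^bsub>W\<^esub> w ?\<delta>" using mult_w_sym_diff[OF A \<delta>(2)] by simp
    then have "t = A \<otimes>\<^bsub>W\<^esub> w \<kappa> \<otimes>\<^bsub>W\<^esub> w (sym_diff ?\<delta> \<alpha>)"
      using \<alpha>(2) mult_w_sym_diff[OF mult_w_closed[OF A \<kappa>] \<gamma>\<alpha>] by simp
    moreover have "sym_diff ?\<delta> \<alpha> \<in> faces" by (rule faces_subset[OF \<gamma>\<alpha>]) auto
    ultimately show ?thesis unfolding Th_edge_iff using mult_w_closed[OF A \<kappa>] by blast
  qed
  ultimately have "coned Th (A \<otimes>\<^bsub>W\<^esub> w \<kappa>) {A, B1, B2, B3, B4, B5, t}"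
    unfolding coned_def B by (simp add: Th_neighbours_iff[OF A \<kappa>] s)
  then show ?thesis by blast
qed

text \<open>With the base point in \<open>R\<close>, the pendant vertex also has a parameter \<tau>.
  If \<tau> spans a face with the hub parameter \<sigma>0, the hub is a cone vertex. Otherwise
  single vertices of the parameters form a pendant wheel in the link of \<rho> in \<open>X\<close>,
  and the vertex supplied there by \<open>SD2_star\<close> turns out to be joined to the full
  simplices.\<close>

lemma pendant_wheel_link_Th:
  assumes SD: "SD2_star_links X" and R: "R \<in> Th"
    and c: "cycle5 (link Th R) B1 B2 B3 B4 B5" and z: "coned (link Th R) B0 {B1, B2, B3, B4, B5}"
    and t: "{B1, t} \<in> link Th R" "{B2, t} \<in> link Th R"
  shows "\<exists>v. coned (link Th R) v {B0, B1, B2, B3, B4, B5, t}"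
proof -
  have R': "R \<in> insert {} Th" using R by blast
  note L = link_edge_iff[OF flag_Th R']
  obtain A where AR: "A \<in> R" using flag_simplexD(2)[OF flag_Th R] by blast
  have RR: "\<And>B C. B \<in> R \<Longrightarrow> C \<in> R \<Longrightarrow> {B, C} \<in> Th" using flag_simplexD(4)[OF flag_Th R] .
  have A: "A \<in> carrier W" using RR[OF AR AR] Th_edge_iff by blast
  obtain f where f: "\<And>B. B \<in> R \<Longrightarrow> f B \<in> faces \<and> B = A \<otimes>\<^bsub>W\<^esub> w (f B)"
    and \<rho>: "\<Union>(f ` R) \<in> faces" using Th_clique_params[OF AR RR] by metis
  \<comment> \<open>Being joined to all of \<open>R\<close> amounts to spanning a face with \<rho>,
    so \<rho> stands in for \<open>R\<close>.\<close>
  define \<rho> where "\<rho> = \<Union>(f ` R)"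
  have \<rho>X: "\<rho> \<in> faces" using \<rho> unfolding \<rho>_def .
  have eL: "{A \<otimes>\<^bsub>W\<^esub> w \<sigma>, A \<otimes>\<^bsub>W\<^esub> w \<tau>} \<in> link Th R \<longleftrightarrow> \<sigma> \<union> \<tau> \<in> faces \<and> \<sigma> \<union> \<rho> \<in> faces \<and> \<tau> \<union> \<rho> \<in> faces \<and>
      A \<otimes>\<^bsub>W\<^esub> w \<sigma> \<notin> R \<and> A \<otimes>\<^bsub>W\<^esub> w \<tau> \<notin> R" if s: "\<sigma> \<in> faces" "\<tau> \<in> faces" for \<sigma> \<tau>
  proof -
    have "(\<forall>B\<in>R. {A \<otimes>\<^bsub>W\<^esub> w \<sigma>, B} \<in> Th) \<longleftrightarrow> \<sigma> \<union> \<rho> \<in> faces" if s: "\<sigma> \<in> faces" for \<sigma>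
    proof -
      have "{A \<otimes>\<^bsub>W\<^esub> w \<sigma>, B} \<in> Th \<longleftrightarrow> (\<forall>s\<in>\<sigma>. \<forall>t\<in>f B. {s, t} \<in> X)" if B: "B \<in> R" for B
        using Th_neighbours_iff[OF A s, of "f B"] f[OF B] faces_Un_iff[OF s, of "f B"] by simp
      then show ?thesis unfolding faces_Un_iff[OF s \<rho>X] unfolding \<rho>_def by blast
    qed
    then show ?thesis unfolding L Th_neighbours_iff[OF A s] using s by blast
  qed
  have param: "\<exists>\<sigma>\<in>faces. B = A \<otimes>\<^bsub>W\<^esub> w \<sigma>" if "{B, C} \<in> link Th R" for B C
    using that AR unfolding L by (metis Th_edge_iff insert_commute)
  have z': "{B0, B1} \<in> link Th R" "{B1, B0} \<in> link Th R" "{B2, B0} \<in> link Th R" "{B3, B0} \<in> link Th R"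
      "{B4, B0} \<in> link Th R" "{B5, B0} \<in> link Th R"
    using z unfolding coned_def by (simp_all add: insert_commute)
  obtain \<sigma>0 where s0: "\<sigma>0 \<in> faces" "B0 = A \<otimes>\<^bsub>W\<^esub> w \<sigma>0" using param[OF z'(1)] by blast
  obtain \<sigma>1 where s1: "\<sigma>1 \<in> faces" "B1 = A \<otimes>\<^bsub>W\<^esub> w \<sigma>1" using param[OF z'(2)] by blast
  obtain \<sigma>2 where s2: "\<sigma>2 \<in> faces" "B2 = A \<otimes>\<^bsub>W\<^esub> w \<sigma>2" using param[OF z'(3)] by blast
  obtain \<sigma>3 where s3: "\<sigma>3 \<in> faces" "B3 = A \<otimes>\<^bsub>W\<^esub> w \<sigma>3" using param[OF z'(4)] by blast
  obtain \<sigma>4 where s4: "\<sigma>4 \<in> faces" "B4 = A \<otimes>\<^bsub>W\<^esub> w \<sigma>4" using param[OF z'(5)] by blast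
  obtain \<sigma>5 where s5: "\<sigma>5 \<in> faces" "B5 = A \<otimes>\<^bsub>W\<^esub> w \<sigma>5" using param[OF z'(6)] by blast
  obtain \<tau> where s6: "\<tau> \<in> faces" "t = A \<otimes>\<^bsub>W\<^esub> w \<tau>" using param[of t B1] t by (auto simp: insert_commute)
  note s = s1(1) s2(1) s3(1) s4(1) s5(1) and B = s0(2) s1(2) s2(2) s3(2) s4(2) s5(2) s6(2)
  have out: "B0 \<notin> R" "B1 \<notin> R" "B2 \<notin> R" "B3 \<notin> R" "B4 \<notin> R" "B5 \<notin> R" "t \<notin> R"
    using z' t unfolding L by blast+
  have zu: "\<sigma>0 \<union> \<sigma>1 \<in> faces" "\<sigma>0 \<union> \<sigma>2 \<in> faces" "\<sigma>0 \<union> \<sigma>3 \<in> faces" "\<sigma>0 \<union> \<sigma>4 \<in> faces" "\<sigma>0 \<union> \<sigma>5 \<in> faces"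
    and \<rho>u: "\<sigma>0 \<union> \<rho> \<in> faces" "\<sigma>1 \<union> \<rho> \<in> faces" "\<sigma>2 \<union> \<rho> \<in> faces" "\<sigma>3 \<union> \<rho> \<in> faces" "\<sigma>4 \<union> \<rho> \<in> faces" "\<sigma>5 \<union> \<rho> \<in> faces" "\<tau> \<union> \<rho> \<in> faces"
    and tu: "\<sigma>1 \<union> \<tau> \<in> faces" "\<sigma>2 \<union> \<tau> \<in> faces"
    using z' t s s0(1) s6(1) unfolding B by (simp_all add: eL Un_commute)
  have "cycle5 Th B1 B2 B3 B4 B5"
    using c out \<rho>u s unfolding cycle5_def B by (simp add: eL Th_neighbours_iff[OF A])
  then have u: "\<sigma>1 \<union> \<sigma>2 \<in> faces" "\<sigma>2 \<union> \<sigma>3 \<in> faces" "\<sigma>3 \<union> \<sigma>4 \<in> faces" "\<sigma>4 \<union> \<sigma>5 \<in> faces" "\<sigma>5 \<union> \<sigma>1 \<in> faces"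
    and n: "\<sigma>1 \<union> \<sigma>3 \<notin> faces" "\<sigma>2 \<union> \<sigma>4 \<notin> faces" "\<sigma>3 \<union> \<sigma>5 \<notin> faces" "\<sigma>4 \<union> \<sigma>1 \<notin> faces" "\<sigma>5 \<union> \<sigma>2 \<notin> faces"
    unfolding B cycle5_params[OF A s] by blast+
  obtain r1 r2 r3 r4 r5 where r: "r1 \<in> \<sigma>1" "r2 \<in> \<sigma>2" "r3 \<in> \<sigma>3" "r4 \<in> \<sigma>4" "r5 \<in> \<sigma>5" and cyc: "cycle5 X r1 r2 r3 r4 r5"
    using rim_vertices[OF s u n] .
  have nr: "{r1, r3} \<notin> X" "{r2, r4} \<notin> X" "{r3, r5} \<notin> X" "{r4, r1} \<notin> X" "{r5, r2} \<notin> X"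
    using cyc unfolding cycle5_def by blast+
  have conclude: "\<exists>v. coned (link Th R) v {B0, B1, B2, B3, B4, B5, t}"
    if "\<nu> \<in> faces" "A \<otimes>\<^bsub>W\<^esub> w \<nu> \<notin> R" "\<nu> \<union> \<rho> \<in> faces" "\<nu> \<union> \<sigma>0 \<in> faces" "\<nu> \<union> \<sigma>1 \<in> faces" "\<nu> \<union> \<sigma>2 \<in> faces" "\<nu> \<union> \<sigma>3 \<in> faces"
      "\<nu> \<union> \<sigma>4 \<in> faces" "\<nu> \<union> \<sigma>5 \<in> faces" "\<nu> \<union> \<tau> \<in> faces" for \<nu>
  proof -
    have "coned (link Th R) (A \<otimes>\<^bsub>W\<^esub> w \<nu>) {B0, B1, B2, B3, B4, B5, t}"
      unfolding coned_def B using that s s0(1) s6(1) \<rho>u out unfolding B by (simp add: eL)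
    then show ?thesis by blast
  qed
  show ?thesis
  proof (cases "\<sigma>0 \<union> \<tau> \<in> faces")
    case True
    then show ?thesis using conclude[of \<sigma>0] s0(1) out(1) zu \<rho>u unfolding B by simp
  next
    case False
    \<comment> \<open>The cone vertices over the rim in \<open>X\<close>. They form a clique because
      \<open>r1\<close> and \<open>r3\<close> are not adjacent, and both \<sigma>0 and \<rho> lie
      among them.\<close>
    define C where "C = {v. {v, r1} \<in> X \<and> {v, r2} \<in> X \<and> {v, r3} \<in> X \<and> {v, r4} \<in> X \<and> {v, r5} \<in> X}"
    have Ccl: "{v, v'} \<in> X" if "v \<in> C" "v' \<in> C" for v v'
      by (rule common_neighbours[OF nr(1)]) (use that in \<open>auto simp: C_def\<close>)
    have \<sigma>0C: "\<sigma>0 \<subseteq> C"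
      using faces_edge[OF zu(1)] faces_edge[OF zu(2)] faces_edge[OF zu(3)] faces_edge[OF zu(4)] faces_edge[OF zu(5)] r
      unfolding C_def by blast
    have \<rho>r: "{x, y} \<in> X" if "x \<in> \<rho>" "y \<in> \<sigma>0 \<union> \<sigma>1 \<union> \<sigma>2 \<union> \<sigma>3 \<union> \<sigma>4 \<union> \<sigma>5 \<union> \<tau>" for x y
      using that faces_edge[OF \<rho>u(1), of y x] faces_edge[OF \<rho>u(2), of y x] faces_edge[OF \<rho>u(3), of y x] faces_edge[OF \<rho>u(4), of y x]
        faces_edge[OF \<rho>u(5), of y x] faces_edge[OF \<rho>u(6), of y x] faces_edge[OF \<rho>u(7), of y x] by (auto simp: insert_commute)
    have \<rho>C: "\<rho> \<subseteq> C" using \<rho>r r unfolding C_def by blast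
    have "\<tau> \<noteq> {}" using False s0(1) by auto
    moreover have "finite \<tau>" "\<And>a b. a \<in> \<tau> \<Longrightarrow> b \<in> \<tau> \<Longrightarrow> {a, b} \<in> X" using s6(1) faces_iff by blast+
    \<comment> \<open>Domination is required against all of \<open>C\<close>, not just \<sigma>0,
      because the cone vertex \<open>v\<close> found later lies in \<open>C\<close> as well:
      adjacency of \<open>v\<close> to \<open>p\<close> then gives adjacency to all of
      \<tau>.\<close>
    ultimately obtain p where p: "p \<in> \<tau>" and dom: "\<And>a d. a \<in> \<tau> \<Longrightarrow> d \<in> C \<Longrightarrow> {a, d} \<notin> X \<Longrightarrow> {p, d} \<notin> X"
      using five_large_dominating_vertex[OF five_large, of \<tau> C] Ccl by blast
    obtain a p' where a0: "a \<in> \<sigma>0" "p' \<in> \<tau>" "{a, p'} \<notin> X" using False faces_Un_iff[OF s0(1) s6(1)] by blast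
    then have a: "a \<in> C" "{p, a} \<notin> X" using \<sigma>0C dom[of p' a] by (auto simp: insert_commute)
    have a\<rho>: "a \<notin> \<rho>" using \<rho>r[of a p] a p by (auto simp: insert_commute)
    have p\<rho>: "p \<notin> \<rho>" using \<rho>r[of p a] a a0 by auto
    have r\<rho>: "r1 \<notin> \<rho>" "r2 \<notin> \<rho>" "r3 \<notin> \<rho>" "r4 \<notin> \<rho>" "r5 \<notin> \<rho>"
      using \<rho>r[of r1 r3] \<rho>r[of r2 r4] \<rho>r[of r3 r5] \<rho>r[of r4 r1] \<rho>r[of r5 r2] nr r by auto
    have \<rho>X': "\<rho> \<in> insert {} X" using \<rho>X unfolding faces_def .
    note LX = link_edge_iff[OF flag \<rho>X']
    have lk: "{x, y} \<in> link X \<rho> \<longleftrightarrow> {x, y} \<in> X"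
      if "x \<in> {a, r1, r2, r3, r4, r5, p}" "y \<in> {a, r1, r2, r3, r4, r5, p}" for x y
    proof -
      have "x \<in> \<sigma>0 \<union> \<sigma>1 \<union> \<sigma>2 \<union> \<sigma>3 \<union> \<sigma>4 \<union> \<sigma>5 \<union> \<tau>" "y \<in> \<sigma>0 \<union> \<sigma>1 \<union> \<sigma>2 \<union> \<sigma>3 \<union> \<sigma>4 \<union> \<sigma>5 \<union> \<tau>"
        using that r a0 p by blast+
      then have "\<forall>q\<in>\<rho>. {x, q} \<in> X \<and> {y, q} \<in> X" using \<rho>r by (simp add: insert_commute)
      moreover have "x \<notin> \<rho>" "y \<notin> \<rho>" using that a\<rho> p\<rho> r\<rho> by blast+
      ultimately show ?thesis unfolding LX by blast
    qed
    have "cycle5 (link X \<rho>) r1 r2 r3 r4 r5" using cyc unfolding cycle5_def by (simp add: lk)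
    moreover have "coned (link X \<rho>) a {r1, r2, r3, r4, r5}" using a(1) unfolding coned_def C_def by (simp add: lk)
    moreover have "{r1, p} \<in> link X \<rho>" "{r2, p} \<in> link X \<rho>"
      using faces_edge[OF tu(1) r(1) p] faces_edge[OF tu(2) r(2) p] by (simp_all add: lk)
    moreover have "SD2_star (link X \<rho>)" using SD \<rho>X' unfolding SD2_star_links_iff[OF flag] by blast
    ultimately obtain v where v: "coned (link X \<rho>) v {a, r1, r2, r3, r4, r5, p}"
      unfolding SD2_star_iff[OF flag_link[OF flag \<rho>X']] by blast
    have vr: "{v, r1} \<in> X" "{v, r2} \<in> X" "{v, r3} \<in> X" "{v, r4} \<in> X" "{v, r5} \<in> X" "{v, p} \<in> X"
      and v\<rho>: "v \<notin> \<rho>" "\<And>q. q \<in> \<rho> \<Longrightarrow> {v, q} \<in> X"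
      using v unfolding coned_def LX by blast+
    have vC: "v \<in> C" using vr unfolding C_def by blast
    have vX: "{v} \<in> faces" using flag_edge_refl(1)[OF flag vr(1)] unfolding faces_def by blast
    have U: "{v} \<union> \<sigma> \<in> faces" if "\<sigma> \<in> faces" "\<And>x. x \<in> \<sigma> \<Longrightarrow> {v, x} \<in> X" for \<sigma>
      using faces_Un_iff[OF vX that(1)] that(2) by blast
    have near: "{v} \<union> \<sigma> \<in> faces"
      if "\<sigma> \<in> faces" "{x, y} \<notin> X" "x \<in> {r1, r2, r3, r4, r5}" "y \<in> {r1, r2, r3, r4, r5}"
        "\<And>q. q \<in> \<sigma> \<Longrightarrow> {q, x} \<in> X" "\<And>q. q \<in> \<sigma> \<Longrightarrow> {q, y} \<in> X" for \<sigma> x y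
    proof (rule U[OF that(1)])
      fix q assume q: "q \<in> \<sigma>"
      show "{v, q} \<in> X"
        by (rule common_neighbours[OF that(2)]) (use that(3-6) q vr in auto)
    qed
    have "A \<otimes>\<^bsub>W\<^esub> w {v} \<notin> R"
    proof
      assume h: "A \<otimes>\<^bsub>W\<^esub> w {v} \<in> R"
      have "f (A \<otimes>\<^bsub>W\<^esub> w {v}) = {v}" using f[OF h] w_inj[OF A vX, of "f (A \<otimes>\<^bsub>W\<^esub> w {v})"] by simp
      then have "v \<in> \<rho>" using h unfolding \<rho>_def by blast
      then show False using v\<rho>(1) by blast
    qed
    moreover have "{v} \<union> \<rho> \<in> faces" using U[OF \<rho>X v\<rho>(2)] .
    moreover have "{v} \<union> \<sigma>0 \<in> faces" using U[OF s0(1)] Ccl vC \<sigma>0C by blast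
    moreover have "{v} \<union> \<tau> \<in> faces"
    proof (rule U[OF s6(1)])
      fix q assume "q \<in> \<tau>"
      then show "{v, q} \<in> X" using dom[of q v] vC vr(6) by (auto simp: insert_commute)
    qed
    moreover have "{v} \<union> \<sigma>1 \<in> faces"
      by (rule near[OF s(1) nr(5)]) (use faces_edge[OF u(5) r(5)] faces_edge[OF u(1) _ r(2)] in \<open>auto simp: insert_commute\<close>)
    moreover have "{v} \<union> \<sigma>2 \<in> faces"
      by (rule near[OF s(2) nr(1)]) (use faces_edge[OF u(1) r(1)] faces_edge[OF u(2) _ r(3)] in \<open>auto simp: insert_commute\<close>)
    moreover have "{v} \<union> \<sigma>3 \<in> faces"
      by (rule near[OF s(3) nr(2)]) (use faces_edge[OF u(2) r(2)] faces_edge[OF u(3) _ r(4)] in \<open>auto simp: insert_commute\<close>)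
    moreover have "{v} \<union> \<sigma>4 \<in> faces"
      by (rule near[OF s(4) nr(3)]) (use faces_edge[OF u(3) r(3)] faces_edge[OF u(4) _ r(5)] in \<open>auto simp: insert_commute\<close>)
    moreover have "{v} \<union> \<sigma>5 \<in> faces"
      by (rule near[OF s(5) nr(4)]) (use faces_edge[OF u(4) r(4)] faces_edge[OF u(5) _ r(1)] in \<open>auto simp: insert_commute\<close>)
    ultimately show ?thesis using conclude[OF vX] by blast
  qed
qed

theorem SD2_star_links_Th:
  assumes SD: "SD2_star_links X"
  shows "SD2_star_links Th"
  unfolding SD2_star_links_iff[OF flag_Th]
proof
  fix R assume R: "R \<in> insert {} Th"
  note L = link_edge_iff[OF flag_Th R]
  show "SD2_star (link Th R)"
    unfolding SD2_star_iff[OF flag_link[OF flag_Th R]]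
  proof (intro conjI allI impI)
    fix z a b c d
    show "\<not> wheel4 (link Th R) z a b c d"
    proof
      assume "wheel4 (link Th R) z a b c d"
      then have "wheel4 Th z a b c d" unfolding wheel4_def L by blast
      then show False using no_wheel4_Th by blast
    qed
  next
    fix z a b c d e t
    assume h: "cycle5 (link Th R) a b c d e \<and> coned (link Th R) z {a, b, c, d, e} \<and>
      {a, t} \<in> link Th R \<and> {b, t} \<in> link Th R"
    show "\<exists>v. coned (link Th R) v {z, a, b, c, d, e, t}"
    proof (cases "R = {}")
      case True
      then show ?thesis using h pendant_wheel_Th unfolding True link_empty[OF flag_Th] by blast
    next
      case False
      then show ?thesis using h R pendant_wheel_link_Th[OF SD] by blast
    qed
  qed
qed

end

section \<open>Weak systolicity\<close>

definition depth_le :: "('a \<times> nat) set \<Rightarrow> nat \<Rightarrow> bool" where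
  "depth_le P n \<longleftrightarrow> (\<forall>(t, k)\<in>P. k < n)"

lemma depth_leD: "depth_le P n \<Longrightarrow> (t, k) \<in> P \<Longrightarrow> k < n"
  unfolding depth_le_def by blast

lemma depth_leI: "(\<And>t k. (t, k) \<in> P \<Longrightarrow> k < n) \<Longrightarrow> depth_le P n"
  unfolding depth_le_def by blast

lemma height_le: "depth_le P n \<Longrightarrow> height X P t \<le> n"
  unfolding height_def depth_le_def by (rule Least_le) auto

lemma slot_le_height: "slot X P t \<le> height X P t"
  unfolding slot_def by simp

text \<open>A toggled piece rests on the existing layers, so one edge of Th(\<Sigma>) adds at most
  one layer.\<close>

lemma depth_le_toggle: "depth_le P n \<Longrightarrow> depth_le (toggle X \<sigma> P) (Suc n)"
  using order_trans[OF slot_le_height height_le[of P n]]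
  by (intro depth_leI) (auto simp: toggle_iff less_Suc_eq_le dest: depth_leD split: if_splits)

lemma slot_top:
  assumes "finite P" "depth_le P (Suc n)" "(t, n) \<in> P"
  shows "slot X P t = n"
proof -
  have "n < height X P t" using height_bound[OF assms(1,3)] adjacent_irrefl[of X t] by simp
  moreover have "height X P t \<le> Suc n" by (rule height_le[OF assms(2)])
  ultimately have "height X P t = Suc n" by simp
  then show ?thesis unfolding slot_def using assms(3) by simp
qed

text \<open>Every piece of the last layer sits in its own slot, so toggling these letters removes
  exactly that layer. This gives the step back towards the origin.\<close>

lemma depth_le_toggle_top:
  assumes "finite P" "depth_le P (Suc n)"
  shows "depth_le (toggle X {t. (t, n) \<in> P} P) n"
proof (rule depth_leI)
  fix t k assume h: "(t, k) \<in> toggle X {t. (t, n) \<in> P} P"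
  have "\<not> ((t, n) \<in> P \<and> k = n)" "(t, k) \<in> P"
    using h slot_top[OF assms] by (auto simp: toggle_iff)
  then show "k < n" using depth_leD[OF assms(2)] less_Suc_eq by blast
qed

context finite_flag_nerve
begin

lemma top_faces: "A \<in> carrier W \<Longrightarrow> {t. (t, n) \<in> \<Phi> A} \<in> faces"
proof -
  assume A: "A \<in> carrier W"
  have "commuting X {t. (t, n) \<in> \<Phi> A}"
  proof -
    have h: "heap X (\<Phi> A)" by (rule heap_heap_of)
    then have "finite (fst ` \<Phi> A)" unfolding heap_def by blast
    then have "finite {t. (t, n) \<in> \<Phi> A}" by (rule rev_finite_subset) force
    then show ?thesis using h unfolding heap_def commuting_def by blast
  qed
  then show ?thesis using heap_of_letters[OF A] unfolding faces_commuting_iff by blast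
qed

lemma finite_heap_of: "finite (\<Phi> A)"
  using heap_heap_of unfolding heap_def by blast

text \<open>Left translation by the inverse of \<open>v\<close> moves the origin to 1, and edges act
  by right multiplication, so every edge is one toggle.\<close>

lemma depth_le_if_path:
  assumes v: "v \<in> carrier W"
  shows "((adjacent Th) ^^ m) v u \<Longrightarrow> u \<in> carrier W \<and> depth_le (\<Phi> (inv\<^bsub>W\<^esub> v \<otimes>\<^bsub>W\<^esub> u)) m"
proof (induction m arbitrary: u)
  case 0
  then show ?case using v by (simp add: depth_le_def heap_of_one)
next
  case (Suc m)
  then obtain u' where u': "((adjacent Th) ^^ m) v u'" "{u', u} \<in> Th" unfolding adjacent_def by auto
  have IH: "u' \<in> carrier W" "depth_le (\<Phi> (inv\<^bsub>W\<^esub> v \<otimes>\<^bsub>W\<^esub> u')) m" using Suc.IH[OF u'(1)] by blast+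
  obtain \<sigma> where \<sigma>: "\<sigma> \<in> faces" "u = u' \<otimes>\<^bsub>W\<^esub> w \<sigma>" using u'(2) unfolding Th_edge_iff by blast
  have "inv\<^bsub>W\<^esub> v \<otimes>\<^bsub>W\<^esub> u = inv\<^bsub>W\<^esub> v \<otimes>\<^bsub>W\<^esub> u' \<otimes>\<^bsub>W\<^esub> w \<sigma>"
    using \<sigma>(2) v IH(1) w_closed[OF \<sigma>(1)] by (simp add: W.m_assoc)
  then have "\<Phi> (inv\<^bsub>W\<^esub> v \<otimes>\<^bsub>W\<^esub> u) = toggle X \<sigma> (\<Phi> (inv\<^bsub>W\<^esub> v \<otimes>\<^bsub>W\<^esub> u'))"
    using heap_of_mult_w[OF _ \<sigma>(1)] v IH(1) by simp
  then show ?case using depth_le_toggle[OF IH(2)] mult_w_closed[OF IH(1) \<sigma>(1)] \<sigma>(2) by simp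
qed

lemma path_if_depth_le:
  assumes v: "v \<in> carrier W"
  shows "u \<in> carrier W \<Longrightarrow> depth_le (\<Phi> (inv\<^bsub>W\<^esub> v \<otimes>\<^bsub>W\<^esub> u)) n \<Longrightarrow> \<exists>m\<le>n. ((adjacent Th) ^^ m) v u"
proof (induction n arbitrary: u)
  case 0
  then have "\<Phi> (inv\<^bsub>W\<^esub> v \<otimes>\<^bsub>W\<^esub> u) = {}" unfolding depth_le_def by auto
  then have "inv\<^bsub>W\<^esub> v \<otimes>\<^bsub>W\<^esub> u = \<one>\<^bsub>W\<^esub>"
    using inj_onD[OF inj_on_heap_of, of X "inv\<^bsub>W\<^esub> v \<otimes>\<^bsub>W\<^esub> u" "\<one>\<^bsub>W\<^esub>"] heap_of_one[of X] v 0 by simp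
  then have "v = u" using v 0 by (metis W.inv_closed W.inv_equality W.inv_inv)
  then show ?case by simp
next
  case (Suc n)
  let ?A = "inv\<^bsub>W\<^esub> v \<otimes>\<^bsub>W\<^esub> u"
  let ?\<sigma> = "{t. (t, n) \<in> \<Phi> ?A}"
  let ?u = "u \<otimes>\<^bsub>W\<^esub> w ?\<sigma>"
  have A: "?A \<in> carrier W" using v Suc by simp
  note \<sigma> = top_faces[OF A, of n]
  have u': "?u \<in> carrier W" using mult_w_closed[OF Suc.prems(1) \<sigma>] .
  have "inv\<^bsub>W\<^esub> v \<otimes>\<^bsub>W\<^esub> ?u = ?A \<otimes>\<^bsub>W\<^esub> w ?\<sigma>" using v Suc w_closed[OF \<sigma>] by (simp add: W.m_assoc)
  then have "\<Phi> (inv\<^bsub>W\<^esub> v \<otimes>\<^bsub>W\<^esub> ?u) = toggle X ?\<sigma> (\<Phi> ?A)" using heap_of_mult_w[OF A \<sigma>] by simp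
  then have "depth_le (\<Phi> (inv\<^bsub>W\<^esub> v \<otimes>\<^bsub>W\<^esub> ?u)) n"
    using depth_le_toggle_top[OF finite_heap_of Suc.prems(2)] by simp
  then obtain m where m: "m \<le> n" "((adjacent Th) ^^ m) v ?u" using Suc.IH[OF u'] by blast
  have e: "{?u, u} \<in> Th"
    unfolding Th_edge_iff using u' \<sigma> w_mult_cancel[OF Suc.prems(1) \<sigma>] by metis
  \<comment> \<open>If layer \<open>n\<close> is empty, stripping it does not move \<open>u\<close>,
    and there is no last edge to append.\<close>
  show ?case
  proof (cases "?u = u")
    case True then show ?thesis using m by (metis le_SucI)
  next
    case False
    then have "((adjacent Th) ^^ Suc m) v u" using m(2) e unfolding adjacent_def by auto
    then show ?thesis using m(1) by (metis Suc_le_mono)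
  qed
qed

lemma Th_dist_le_iff:
  assumes "v \<in> carrier W" "u \<in> carrier W"
  shows "skeleton_dist Th v u \<le> enat n \<longleftrightarrow> depth_le (\<Phi> (inv\<^bsub>W\<^esub> v \<otimes>\<^bsub>W\<^esub> u)) n"
proof
  assume "skeleton_dist Th v u \<le> enat n"
  then obtain m where m: "m \<le> n" "((adjacent Th) ^^ m) v u" unfolding skeleton_dist_le_iff by blast
  then have "depth_le (\<Phi> (inv\<^bsub>W\<^esub> v \<otimes>\<^bsub>W\<^esub> u)) m" using depth_le_if_path[OF assms(1)] by blast
  then show "depth_le (\<Phi> (inv\<^bsub>W\<^esub> v \<otimes>\<^bsub>W\<^esub> u)) n" using m(1) unfolding depth_le_def by fastforce
next
  assume "depth_le (\<Phi> (inv\<^bsub>W\<^esub> v \<otimes>\<^bsub>W\<^esub> u)) n"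
  then show "skeleton_dist Th v u \<le> enat n"
    unfolding skeleton_dist_le_iff by (rule path_if_depth_le[OF assms])
qed

lemma Th_dist_eq_Suc_iff:
  assumes "v \<in> carrier W" "u \<in> carrier W"
  shows "skeleton_dist Th v u = enat (Suc n) \<longleftrightarrow>
    depth_le (\<Phi> (inv\<^bsub>W\<^esub> v \<otimes>\<^bsub>W\<^esub> u)) (Suc n) \<and> \<not> depth_le (\<Phi> (inv\<^bsub>W\<^esub> v \<otimes>\<^bsub>W\<^esub> u)) n"
  unfolding Th_dist_le_iff[OF assms, symmetric]
  by (cases "skeleton_dist Th v u") auto

lemma connected_Th: "connected_complex Th"
  unfolding connected_complex_def
proof (intro conjI ballI)
  show "Th \<noteq> {}" using vertices_Th W.one_closed by auto
  fix u v assume "u \<in> \<Union>Th" "v \<in> \<Union>Th"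
  then have uv: "u \<in> carrier W" "v \<in> carrier W" using vertices_Th by simp_all
  let ?P = "\<Phi> (inv\<^bsub>W\<^esub> u \<otimes>\<^bsub>W\<^esub> v)"
  have "depth_le ?P (Suc (Max (snd ` ?P)))"
    using finite_heap_of by (auto intro!: depth_leI le_imp_less_Suc Max_ge rev_image_eqI)
  then have "skeleton_dist Th u v \<le> enat (Suc (Max (snd ` ?P)))" using Th_dist_le_iff[OF uv] by blast
  then show "skeleton_dist Th u v < \<infinity>" by (rule order_le_less_trans) simp
qed

text \<open>If all of \<open>\<sigma>\<close> lies at distance \<open>n + 1\<close>, let \<open>C\<close> be the shortest element of a cube containing
  \<open>\<sigma>\<close>; then \<open>C\<close>, or \<open>C\<close> stripped of its top layer, is joined to \<open>\<sigma>\<close> and closer to \<open>v\<close>.\<close>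

lemma Th_common_neighbour:
  assumes v: "v \<in> carrier W" and \<sigma>: "\<sigma> \<in> Th"
    and d: "\<And>s. s \<in> \<sigma> \<Longrightarrow> depth_le (\<Phi> (inv\<^bsub>W\<^esub> v \<otimes>\<^bsub>W\<^esub> s)) (Suc n)"
  shows "\<exists>u\<in>carrier W. depth_le (\<Phi> (inv\<^bsub>W\<^esub> v \<otimes>\<^bsub>W\<^esub> u)) n \<and> (\<forall>s\<in>\<sigma>. {u, s} \<in> Th)"
proof -
  obtain A T where A: "A \<in> carrier W" and T: "T \<in> faces" and sub: "\<sigma> \<subseteq> cube A T" using \<sigma> unfolding Th_iff by blast
  \<comment> \<open>The number of pieces is the word length. Minimizing it, rather than the number
    of layers, ensures that no single letter of \<open>T\<close> cancels a piece.\<close>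
  define C where "C = arg_min_on (\<lambda>C. card (\<Phi> (inv\<^bsub>W\<^esub> v \<otimes>\<^bsub>W\<^esub> C))) (cube A T)"
  have fc: "finite (cube A T)" "cube A T \<noteq> {}" unfolding cube_def using T faces_iff by blast+
  have C: "C \<in> cube A T" unfolding C_def by (rule arg_min_if_finite(1)[OF fc])
  have Cmin: "card (\<Phi> (inv\<^bsub>W\<^esub> v \<otimes>\<^bsub>W\<^esub> C)) \<le> card (\<Phi> (inv\<^bsub>W\<^esub> v \<otimes>\<^bsub>W\<^esub> B))" if "B \<in> cube A T" for B
    unfolding C_def by (rule arg_min_least[OF fc that])
  have cC: "C \<in> carrier W" using C cube_closed[OF A T] by blast
  obtain \<gamma> where \<gamma>: "\<gamma> \<subseteq> T" "C = A \<otimes>\<^bsub>W\<^esub> w \<gamma>" using C unfolding cube_def by blast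
  let ?P = "\<Phi> (inv\<^bsub>W\<^esub> v \<otimes>\<^bsub>W\<^esub> C)"
  have in_cube: "C \<otimes>\<^bsub>W\<^esub> w \<delta> \<in> cube A T" if \<delta>: "\<delta> \<subseteq> T" for \<delta>
  proof -
    have "\<gamma> \<union> \<delta> \<in> faces" by (rule faces_subset[OF T]) (use \<gamma> \<delta> in blast)
    then have "C \<otimes>\<^bsub>W\<^esub> w \<delta> = A \<otimes>\<^bsub>W\<^esub> w (sym_diff \<gamma> \<delta>)" using mult_w_sym_diff[OF A] \<gamma>(2) by simp
    moreover have "sym_diff \<gamma> \<delta> \<in> Pow T" using \<gamma> \<delta> by auto
    ultimately show ?thesis unfolding cube_def by blast
  qed
  have P: "\<Phi> (inv\<^bsub>W\<^esub> v \<otimes>\<^bsub>W\<^esub> (C \<otimes>\<^bsub>W\<^esub> w \<delta>)) = toggle X \<delta> ?P" if \<delta>: "\<delta> \<in> faces" for \<delta>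
  proof -
    have "inv\<^bsub>W\<^esub> v \<otimes>\<^bsub>W\<^esub> (C \<otimes>\<^bsub>W\<^esub> w \<delta>) = inv\<^bsub>W\<^esub> v \<otimes>\<^bsub>W\<^esub> C \<otimes>\<^bsub>W\<^esub> w \<delta>"
      using v cC w_closed[OF \<delta>] by (simp add: W.m_assoc)
    then show ?thesis using heap_of_mult_w[OF _ \<delta>] v cC by simp
  qed
  have asc: "(t, slot X ?P t) \<notin> ?P" if t: "t \<in> T" for t
  proof
    assume h: "(t, slot X ?P t) \<in> ?P"
    have "{t} \<in> faces" by (rule faces_subset[OF T]) (use t in simp)
    then have "\<Phi> (inv\<^bsub>W\<^esub> v \<otimes>\<^bsub>W\<^esub> (C \<otimes>\<^bsub>W\<^esub> w {t})) = ?P - {(t, slot X ?P t)}"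
      using P toggle_singleton_insert(2)[OF h] by simp
    then have "card ?P \<le> card (?P - {(t, slot X ?P t)})" using Cmin[OF in_cube[of "{t}"]] t by simp
    moreover have "card (?P - {(t, slot X ?P t)}) < card ?P" using finite_heap_of h by (rule card_Diff1_less)
    ultimately show False by simp
  qed
  \<comment> \<open>Toggling letters of \<open>T\<close> only adds pieces to \<open>?P\<close>. So
    the depth of \<open>s\<close> bounds both \<open>?P\<close> and the resting heights of the
    letters that lead from \<open>C\<close> to \<open>s\<close>.\<close>
  have params: "\<exists>\<delta>. \<delta> \<subseteq> T \<and> \<delta> \<in> faces \<and> s = C \<otimes>\<^bsub>W\<^esub> w \<delta> \<and> depth_le ?P (Suc n) \<and> (\<forall>t\<in>\<delta>. height X ?P t \<le> n)"
    if s: "s \<in> \<sigma>" for s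
  proof -
    obtain \<tau> where \<tau>: "\<tau> \<subseteq> T" "s = A \<otimes>\<^bsub>W\<^esub> w \<tau>" using s sub unfolding cube_def by blast
    let ?\<delta> = "sym_diff \<gamma> \<tau>"
    have u: "\<gamma> \<union> ?\<delta> \<in> faces" by (rule faces_subset[OF T]) (use \<gamma> \<tau> in auto)
    have \<delta>: "?\<delta> \<in> faces" by (rule faces_subset[OF u]) auto
    have "sym_diff \<gamma> ?\<delta> = \<tau>" by auto
    then have eq: "s = C \<otimes>\<^bsub>W\<^esub> w ?\<delta>" using mult_w_sym_diff[OF A u] \<gamma>(2) \<tau>(2) by simp
    have dep: "depth_le (toggle X ?\<delta> ?P) (Suc n)" using d[OF s] P[OF \<delta>] unfolding eq by simp
    have \<delta>T: "?\<delta> \<subseteq> T" using \<gamma> \<tau> by auto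
    have "depth_le ?P (Suc n)"
    proof (rule depth_leI)
      fix t k assume h: "(t, k) \<in> ?P"
      then have "(t, k) \<in> toggle X ?\<delta> ?P" using asc[of t] \<delta>T unfolding toggle_iff by blast
      then show "k < Suc n" by (rule depth_leD[OF dep])
    qed
    moreover have "height X ?P t \<le> n" if t: "t \<in> ?\<delta>" for t
    proof -
      have "(t, slot X ?P t) \<notin> ?P" using asc t \<delta>T by blast
      then have "(t, slot X ?P t) \<in> toggle X ?\<delta> ?P" "slot X ?P t = height X ?P t"
        using t slot_add[OF finite_heap_of] unfolding toggle_iff by blast+
      then show ?thesis using depth_leD[OF dep] by fastforce
    qed
    ultimately show ?thesis using \<delta> \<delta>T eq by blast
  qed
  show ?thesis
  proof (cases "depth_le ?P n")
    case True
    moreover have "{C, s} \<in> Th" if "s \<in> \<sigma>" for s using params[OF that] cC unfolding Th_edge_iff by blast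
    ultimately show ?thesis using cC by blast
  next
    case False
    let ?\<tau> = "{t. (t, n) \<in> ?P}"
    have \<tau>: "?\<tau> \<in> faces" using v cC by (intro top_faces) simp
    have "\<sigma> \<noteq> {}" using \<sigma> unfolding Th_iff by blast
    then have "depth_le ?P (Suc n)" using params by blast
    then have "depth_le (toggle X ?\<tau> ?P) n" by (rule depth_le_toggle_top[OF finite_heap_of])
    then have dep: "depth_le (\<Phi> (inv\<^bsub>W\<^esub> v \<otimes>\<^bsub>W\<^esub> (C \<otimes>\<^bsub>W\<^esub> w ?\<tau>))) n" using P[OF \<tau>] by simp
    have "{C \<otimes>\<^bsub>W\<^esub> w ?\<tau>, s} \<in> Th" if s: "s \<in> \<sigma>" for s
    proof -
      obtain \<delta> where \<delta>: "\<delta> \<in> faces" "s = C \<otimes>\<^bsub>W\<^esub> w \<delta>" "\<And>t. t \<in> \<delta> \<Longrightarrow> height X ?P t \<le> n" using params[OF s] by blast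
      \<comment> \<open>A letter \<open>t\<close> not commuting with the top piece \<open>r\<close>
        would come to rest above layer \<open>n\<close>, too high for the depth of
        \<open>s\<close>.\<close>
      have "{r, t} \<in> X" if rt: "r \<in> ?\<tau>" "t \<in> \<delta>" for r t
      proof (rule ccontr)
        assume "{r, t} \<notin> X"
        then have "\<not> adjacent X r t" unfolding adjacent_def by blast
        then have "n < height X ?P t" using height_bound[OF finite_heap_of] rt(1) by blast
        then show False using \<delta>(3)[OF rt(2)] by simp
      qed
      then have "?\<tau> \<union> \<delta> \<in> faces" using faces_Un_iff[OF \<tau> \<delta>(1)] by blast
      then show ?thesis unfolding \<delta>(2) Th_neighbours_iff[OF cC \<tau> \<delta>(1)] .
    qed
    then show ?thesis using mult_w_closed[OF cC \<tau>] dep by blast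
  qed
qed

end

context five_large_nerve
begin

text \<open>Stripping \<open>P\<close> down to depth \<open>n + 1\<close> removes its whole top layer; any further element \<open>t\<close>
  that is toggled is joined to a top element \<open>s\<close> and to an element \<open>r\<close> of the layer below that blocks \<open>s\<close>.\<close>

lemma shallow_toggles_compatible:
  assumes P: "heap X P" "depth_le P (Suc (Suc n))" "(s, Suc n) \<in> P"
    and a: "\<alpha> \<in> faces" "depth_le (toggle X \<alpha> P) (Suc n)" and b: "\<beta> \<in> faces" "depth_le (toggle X \<beta> P) (Suc n)"
  shows "\<alpha> \<union> \<beta> \<in> faces"
proof -
  have fP: "finite P" using P(1) unfolding heap_def by blast
  \<comment> \<open>The index \<open>Suc n\<close> matters: there is a layer below the top one, and
    it contains an obstacle for \<open>s\<close>. This is where radius at least 1 enters.\<close>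
  obtain r where r: "(r, n) \<in> P" "\<not> adjacent X r s" "(s, n) \<notin> P" using P(1,3) unfolding heap_def by blast
  have rs: "r \<noteq> s" using r by blast
  have rsX: "{s, r} \<notin> X" using r(2) rs unfolding adjacent_def by (simp add: insert_commute)
  have top: "t \<in> \<delta>" if "depth_le (toggle X \<delta> P) (Suc n)" "(t, Suc n) \<in> P" for \<delta> t
    using depth_leD[OF that(1), of t "Suc n"] that(2) unfolding toggle_iff by blast
  have below: "{t, s} \<in> X \<and> {t, r} \<in> X" if \<delta>: "\<delta> \<in> faces" "depth_le (toggle X \<delta> P) (Suc n)" and t: "t \<in> \<delta>" "(t, Suc n) \<notin> P" for \<delta> t
  proof
    have s\<delta>: "s \<in> \<delta>" using top[OF \<delta>(2) P(3)] .
    then show "{t, s} \<in> X" using t \<delta>(1) unfolding faces_iff by blast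
    show "{t, r} \<in> X"
    proof (rule ccontr)
      assume n: "{t, r} \<notin> X"
      have "r \<noteq> t" using \<delta>(1) t s\<delta> rsX unfolding faces_iff by blast
      have na: "\<not> adjacent X r t" using n unfolding adjacent_def by (simp add: insert_commute)
      then have h: "n < height X P t" using height_bound[OF fP r(1)] by blast
      show False
      proof (cases "(t, slot X P t) \<in> P")
        case False
        then have "(t, slot X P t) \<in> toggle X \<delta> P" using t unfolding toggle_iff by blast
        then have "slot X P t < Suc n" by (rule depth_leD[OF \<delta>(2)])
        then show False using h slot_add[OF fP False] by simp
      next
        \<comment> \<open>Here the slot of \<open>t\<close> can only be layer \<open>n\<close>, so
          \<open>t\<close> would share a layer with \<open>r\<close> without commuting with
          it.\<close>
        case True
        have "slot X P t < Suc (Suc n)" using depth_leD[OF P(2) True] .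
        moreover have "slot X P t \<noteq> Suc n" using True t(2) by metis
        moreover have "n \<le> slot X P t" using h slot_remove[OF fP True] by simp
        ultimately have "slot X P t = n" by simp
        then have "(t, n) \<in> P" using True by simp
        then show False using P(1) r(1) \<open>r \<noteq> t\<close> na unfolding heap_def by blast
      qed
    qed
  qed
  show ?thesis unfolding faces_Un_iff[OF a(1) b(1)]
  proof (intro ballI)
    fix t t' assume t: "t \<in> \<alpha>" "t' \<in> \<beta>"
    consider "(t, Suc n) \<in> P" | "(t', Suc n) \<in> P" | "(t, Suc n) \<notin> P" "(t', Suc n) \<notin> P" by blast
    then show "{t, t'} \<in> X"
    proof cases
      case 1 then show ?thesis using top[OF b(2)] t(2) b(1) unfolding faces_iff by blast
    next
      case 2 then show ?thesis using top[OF a(2)] t(1) a(1) unfolding faces_iff by blast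
    next
      \<comment> \<open>Both letters are joined to the non-adjacent vertices \<open>s\<close> and
        \<open>r\<close>, so 5-largeness makes them equal or adjacent.\<close>
      case 3
      then show ?thesis using common_neighbours[OF rsX] below[OF a t(1)] below[OF b t(2)] by blast
    qed
  qed
qed

theorem weakly_systolic_Th: "weakly_systolic Th"
  unfolding weakly_systolic_def
proof (intro conjI ballI allI impI)
  fix v i \<sigma> assume v': "v \<in> \<Union>Th" and i: "1 \<le> i" and \<sigma>S: "\<sigma> \<in> comb_sphere (i + 1) v Th"
  have v: "v \<in> carrier W" using v' vertices_Th by simp
  obtain n where n: "i = Suc n" using i by (cases i) simp_all
  let ?D = "\<lambda>u. \<Phi> (inv\<^bsub>W\<^esub> v \<otimes>\<^bsub>W\<^esub> u)"
  have \<sigma>: "\<sigma> \<in> Th" and \<sigma>v: "\<And>s. s \<in> \<sigma> \<Longrightarrow> skeleton_dist Th v s = enat (Suc i)"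
    using \<sigma>S unfolding comb_sphere_def spanned_subcomplex_def by auto
  have \<sigma>c: "s \<in> carrier W" if "s \<in> \<sigma>" for s using that \<sigma> vertices_Th by blast
  have \<sigma>d: "depth_le (?D s) (Suc i)" "\<not> depth_le (?D s) i" if "s \<in> \<sigma>" for s
    using \<sigma>v[OF that] Th_dist_eq_Suc_iff[OF v \<sigma>c[OF that]] by blast+
  \<comment> \<open>All candidates at once. That they form a simplex is checked from a single vertex
    \<open>s\<close> of \<sigma>; that some candidate exists uses all of \<sigma>.\<close>
  define \<tau> where "\<tau> = {u \<in> carrier W. depth_le (?D u) i \<and> (\<forall>s\<in>\<sigma>. {u, s} \<in> Th)}"
  obtain s where s: "s \<in> \<sigma>" using flag_simplexD(2)[OF flag_Th \<sigma>] by blast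
  note sc = \<sigma>c[OF s]
  have \<tau>s: "\<exists>\<alpha>\<in>faces. u = s \<otimes>\<^bsub>W\<^esub> w \<alpha> \<and> depth_le (toggle X \<alpha> (?D s)) i" if u: "u \<in> \<tau>" for u
  proof -
    have "{s, u} \<in> Th" "depth_le (?D u) i" using u s unfolding \<tau>_def by (auto simp: insert_commute)
    then obtain \<alpha> where \<alpha>: "\<alpha> \<in> faces" "u = s \<otimes>\<^bsub>W\<^esub> w \<alpha>" unfolding Th_edge_iff by blast
    have "inv\<^bsub>W\<^esub> v \<otimes>\<^bsub>W\<^esub> u = inv\<^bsub>W\<^esub> v \<otimes>\<^bsub>W\<^esub> s \<otimes>\<^bsub>W\<^esub> w \<alpha>"
      using v sc w_closed[OF \<alpha>(1)] \<alpha>(2) by (simp add: W.m_assoc)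
    then have "?D u = toggle X \<alpha> (?D s)" using heap_of_mult_w[OF _ \<alpha>(1)] v sc by simp
    then show ?thesis using \<alpha> \<open>depth_le (?D u) i\<close> by auto
  qed
  have fin\<tau>: "finite \<tau>"
  proof (rule finite_subset)
    show "\<tau> \<subseteq> (\<lambda>\<alpha>. s \<otimes>\<^bsub>W\<^esub> w \<alpha>) ` faces" using \<tau>s by blast
  qed (simp add: finite_faces)
  \<comment> \<open>Distance exactly \<open>i + 1\<close> means that layer \<open>i\<close>, counted
    from 0, is the top layer of the heap of \<open>s\<close> and is occupied.\<close>
  obtain s0 k where k: "(s0, k) \<in> ?D s" "\<not> k < i" using \<sigma>d(2)[OF s] unfolding depth_le_def by blast
  then have "k = Suc n" using depth_leD[OF \<sigma>d(1)[OF s] k(1)] n by simp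
  then have s0: "(s0, Suc n) \<in> ?D s" using k(1) by simp
  have clique: "{u, u'} \<in> Th" if u: "u \<in> \<tau>" "u' \<in> \<tau>" for u u'
  proof -
    obtain \<alpha> where \<alpha>: "\<alpha> \<in> faces" "u = s \<otimes>\<^bsub>W\<^esub> w \<alpha>" "depth_le (toggle X \<alpha> (?D s)) (Suc n)" using \<tau>s[OF u(1)] n by blast
    obtain \<beta> where \<beta>: "\<beta> \<in> faces" "u' = s \<otimes>\<^bsub>W\<^esub> w \<beta>" "depth_le (toggle X \<beta> (?D s)) (Suc n)" using \<tau>s[OF u(2)] n by blast
    have "\<alpha> \<union> \<beta> \<in> faces"
      using shallow_toggles_compatible[OF heap_heap_of _ s0 \<alpha>(1,3) \<beta>(1,3)] \<sigma>d(1)[OF s] unfolding n by blast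
    then show ?thesis unfolding \<alpha>(2) \<beta>(2) Th_neighbours_iff[OF sc \<alpha>(1) \<beta>(1)] .
  qed
  obtain u where "u \<in> carrier W" "depth_le (?D u) i" "\<forall>s\<in>\<sigma>. {u, s} \<in> Th"
    using Th_common_neighbour[OF v \<sigma> \<sigma>d(1)] by blast
  then have "u \<in> \<tau>" unfolding \<tau>_def by blast
  then have "\<tau> \<noteq> {}" by blast
  moreover have "link Th \<sigma> \<inter> comb_ball i v Th = Pow \<tau> - {{}}"
  proof (rule equalityI; rule subsetI)
    fix \<rho> assume "\<rho> \<in> link Th \<sigma> \<inter> comb_ball i v Th"
    then have \<rho>: "\<rho> \<in> Th" "\<rho> \<union> \<sigma> \<in> Th" "\<And>u. u \<in> \<rho> \<Longrightarrow> skeleton_dist Th v u \<le> enat i"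
      unfolding link_def comb_ball_def spanned_subcomplex_def by auto
    have "u \<in> \<tau>" if u: "u \<in> \<rho>" for u
    proof -
      have "u \<in> carrier W" using u \<rho>(1) vertices_Th by blast
      then show ?thesis unfolding \<tau>_def
        using Th_dist_le_iff[OF v] \<rho>(3)[OF u] flag_simplexD(4)[OF flag_Th \<rho>(2)] u by blast
    qed
    then show "\<rho> \<in> Pow \<tau> - {{}}" using flag_simplexD(2)[OF flag_Th \<rho>(1)] by blast
  next
    fix \<rho> assume \<rho>: "\<rho> \<in> Pow \<tau> - {{}}"
    have f: "finite \<rho>" "finite \<sigma>" using \<rho> fin\<tau> finite_subset flag_simplexD(1)[OF flag_Th \<sigma>] by blast+
    have \<rho>T: "\<rho> \<in> Th" using flag_simplex_iff[OF flag_Th, of \<rho>] f(1) clique \<rho> by blast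
    have "{x, y} \<in> Th" if xy: "x \<in> \<rho> \<union> \<sigma>" "y \<in> \<rho> \<union> \<sigma>" for x y
    proof -
      have \<rho>\<sigma>: "{x, y} \<in> Th" if "x \<in> \<rho>" "y \<in> \<sigma>" for x y using that \<rho> unfolding \<tau>_def by blast
      consider "x \<in> \<rho>" "y \<in> \<rho>" | "x \<in> \<rho>" "y \<in> \<sigma>" | "x \<in> \<sigma>" "y \<in> \<rho>" | "x \<in> \<sigma>" "y \<in> \<sigma>" using xy by blast
      then show ?thesis
      proof cases
        case 1 then show ?thesis using clique \<rho> by blast
      next
        case 3 then show ?thesis using \<rho>\<sigma>[of y x] by (simp add: insert_commute)
      next
        case 4 then show ?thesis using flag_simplexD(4)[OF flag_Th \<sigma>] by blast
      qed (rule \<rho>\<sigma>)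
    qed
    then have "\<rho> \<union> \<sigma> \<in> Th" using flag_simplex_iff[OF flag_Th, of "\<rho> \<union> \<sigma>"] f \<rho> by blast
    moreover have "\<rho> \<inter> \<sigma> = {}" using \<rho> \<sigma>d(2) unfolding \<tau>_def by blast
    moreover have "u \<in> {u \<in> \<Union>Th. skeleton_dist Th v u \<le> enat i}" if u: "u \<in> \<rho>" for u
      using u \<rho> Th_dist_le_iff[OF v] unfolding \<tau>_def vertices_Th by blast
    ultimately show "\<rho> \<in> link Th \<sigma> \<inter> comb_ball i v Th"
      unfolding link_def comb_ball_def spanned_subcomplex_def using \<rho>T by blast
  qed
  ultimately show "\<exists>\<tau>. \<tau> \<noteq> {} \<and> link Th \<sigma> \<inter> comb_ball i v Th = Pow \<tau> - {{}}" by blast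
qed (rule flag_Th connected_Th)+

end

section \<open>The geometric action\<close>

text \<open>The constructor \<open>topology\<close> is meaningful only for predicates satisfying
  \<open>istopology\<close>, which is checked here.\<close>

lemma openin_realization_topology:
  "openin (realization_topology X) U \<longleftrightarrow> U \<subseteq> realization X \<and>
     (\<forall>\<sigma>\<in>X. openin (top_of_set (closed_simplex X \<sigma>)) (U \<inter> closed_simplex X \<sigma>))"
proof -
  have "istopology (\<lambda>U. U \<subseteq> realization X \<and>
     (\<forall>\<sigma>\<in>X. openin (top_of_set (closed_simplex X \<sigma>)) (U \<inter> closed_simplex X \<sigma>)))"
    unfolding istopology_def
  proof (intro conjI allI impI ballI)
    fix S T \<sigma>
    assume "S \<subseteq> realization X \<and> (\<forall>\<sigma>\<in>X. openin (top_of_set (closed_simplex X \<sigma>)) (S \<inter> closed_simplex X \<sigma>))"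
      and "T \<subseteq> realization X \<and> (\<forall>\<sigma>\<in>X. openin (top_of_set (closed_simplex X \<sigma>)) (T \<inter> closed_simplex X \<sigma>))"
      and "\<sigma> \<in> X"
    then have "openin (top_of_set (closed_simplex X \<sigma>)) (S \<inter> closed_simplex X \<sigma>)"
      "openin (top_of_set (closed_simplex X \<sigma>)) (T \<inter> closed_simplex X \<sigma>)" by blast+
    then have "openin (top_of_set (closed_simplex X \<sigma>)) ((S \<inter> closed_simplex X \<sigma>) \<inter> (T \<inter> closed_simplex X \<sigma>))"
      by (rule openin_Int)
    then show "openin (top_of_set (closed_simplex X \<sigma>)) (S \<inter> T \<inter> closed_simplex X \<sigma>)"
      by (simp add: Int_ac)
  next
    fix K \<sigma>
    assume K: "\<forall>S\<in>K. S \<subseteq> realization X \<and> (\<forall>\<sigma>\<in>X. openin (top_of_set (closed_simplex X \<sigma>)) (S \<inter> closed_simplex X \<sigma>))"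
      and \<sigma>: "\<sigma> \<in> X"
    have "openin (top_of_set (closed_simplex X \<sigma>)) (S \<inter> closed_simplex X \<sigma>)" if "S \<in> K" for S
      using bspec[OF K that] \<sigma> by (elim conjE) (erule bspec)
    then have "openin (top_of_set (closed_simplex X \<sigma>)) (\<Union>S\<in>K. S \<inter> closed_simplex X \<sigma>)"
      by (intro openin_Union) (elim imageE, simp)
    then show "openin (top_of_set (closed_simplex X \<sigma>)) (\<Union>K \<inter> closed_simplex X \<sigma>)"
      unfolding Int_Union2 .
  qed blast+
  then show ?thesis unfolding realization_topology_def by (simp add: topology_inverse')
qed

lemma closed_simplex_subset: "closed_simplex X \<sigma> \<subseteq> realization X"
  unfolding closed_simplex_def by blast

lemma topspace_realization_topology: "topspace (realization_topology X) = realization X"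
proof
  show "topspace (realization_topology X) \<subseteq> realization X"
    unfolding topspace_def openin_realization_topology by blast
  have "openin (realization_topology X) (realization X)"
    unfolding openin_realization_topology using closed_simplex_subset by (metis Int_absorb1 openin_subtopology_self order_refl)
  then show "realization X \<subseteq> topspace (realization_topology X)" by (rule openin_subset)
qed

lemma closed_singleton_fun: "closed {x :: 'a \<Rightarrow> real}"
proof -
  have "{x} = (\<Inter>v. {y. y v = x v})" by auto
  moreover have "closed {y :: 'a \<Rightarrow> real. y v = x v}" for v by (intro closed_Collect_eq) auto
  ultimately show ?thesis by auto
qed

lemma realization_support:
  assumes "x \<in> realization X"
  shows "support x \<in> X" "\<And>v. 0 \<le> x v" "(\<Sum>v\<in>support x. x v) = 1"
  using assms unfolding realization_def by auto

text \<open>One point from each open simplex met by \<open>K\<close>: these points form a closed discrete set.\<close>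

lemma compactin_finite_support:
  assumes X: "simplicial_complex X" and K: "compactin (realization_topology X) K"
  shows "finite (\<Union>(support ` K))"
proof -
  let ?T = "realization_topology X"
  have sub: "K \<subseteq> realization X" using K unfolding compactin_def topspace_realization_topology by blast
  have finX: "finite \<sigma>" if "\<sigma> \<in> X" for \<sigma> using X that unfolding simplicial_complex_def by blast
  let ?S = "support ` K"
  define x where "x \<sigma> = (SOME y. y \<in> K \<and> support y = \<sigma>)" for \<sigma> :: "'a set"
  have x: "x \<sigma> \<in> K \<and> support (x \<sigma>) = \<sigma>" if "\<sigma> \<in> ?S" for \<sigma>
  proof -
    have "\<exists>y. y \<in> K \<and> support y = \<sigma>" using that by blast
    then show ?thesis unfolding x_def by (rule someI_ex)
  qed
  \<comment> \<open>Each \<open>U \<sigma>\<close> omits all chosen points but one. It is open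
    because a closed simplex contains only finitely many chosen points; a finite subcover of
    \<open>K\<close> therefore leaves only finitely many supports.\<close>
  define U where "U \<sigma> = realization X - (x ` ?S - {x \<sigma>})" for \<sigma>
  have "openin ?T (U \<sigma>)" for \<sigma>
    unfolding openin_realization_topology
  proof (intro conjI ballI)
    show "U \<sigma> \<subseteq> realization X" unfolding U_def by blast
    fix \<tau> assume \<tau>: "\<tau> \<in> X"
    let ?C = "closed_simplex X \<tau>"
    let ?E = "(x ` ?S - {x \<sigma>}) \<inter> ?C"
    have "?E \<subseteq> x ` Pow \<tau>"
    proof
      fix y assume "y \<in> ?E"
      then obtain \<rho> where \<rho>: "\<rho> \<in> ?S" "y = x \<rho>" "support y \<subseteq> \<tau>" unfolding closed_simplex_def by blast
      then show "y \<in> x ` Pow \<tau>" using x[OF \<rho>(1)] by blast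
    qed
    then have "finite ?E" using finX[OF \<tau>] finite_subset by blast
    then have "closed (\<Union>y\<in>?E. {y})" by (intro closed_UN) (simp_all add: closed_singleton_fun)
    then have "closed ?E" by simp
    then have "openin (top_of_set ?C) (?C \<inter> - ?E)" by (intro openin_open_Int open_Compl)
    moreover have "?C \<inter> - ?E = U \<sigma> \<inter> ?C" unfolding U_def using closed_simplex_subset by blast
    ultimately show "openin (top_of_set ?C) (U \<sigma> \<inter> ?C)" by simp
  qed
  moreover have "K \<subseteq> \<Union>(U ` ?S)"
  proof
    fix y assume y: "y \<in> K"
    have "y \<notin> x ` ?S - {x (support y)}"
    proof
      assume h: "y \<in> x ` ?S - {x (support y)}"
      then obtain \<rho> where "\<rho> \<in> ?S" "y = x \<rho>" by blast
      then show False using x[of \<rho>] h by auto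
    qed
    then have "y \<in> U (support y)" unfolding U_def using y sub by blast
    then show "y \<in> \<Union>(U ` ?S)" using y by blast
  qed
  ultimately obtain F where F: "finite F" "F \<subseteq> U ` ?S" "K \<subseteq> \<Union>F"
    using K unfolding compactin_def by (metis (no_types, lifting) imageE)
  then obtain S' where S': "finite S'" "S' \<subseteq> ?S" "F = U ` S'" using finite_subset_image by metis
  have "?S \<subseteq> S'"
  proof
    fix \<sigma> assume \<sigma>: "\<sigma> \<in> ?S"
    then obtain \<rho> where \<rho>: "\<rho> \<in> S'" "x \<sigma> \<in> U \<rho>" using x[OF \<sigma>] F(3) S'(3) by blast
    then have "x \<sigma> = x \<rho>" using \<sigma> unfolding U_def by blast
    then have "\<sigma> = \<rho>" using x[OF \<sigma>] x[of \<rho>] \<rho>(1) S'(2) by auto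
    then show "\<sigma> \<in> S'" using \<rho>(1) by simp
  qed
  then have "finite ?S" using S'(1) finite_subset by blast
  moreover have "finite \<sigma>" if "\<sigma> \<in> ?S" for \<sigma> using that sub realization_support(1) finX by blast
  ultimately show ?thesis by (intro finite_Union)
qed

text \<open>Functions into the reals carry the product topology, so Tychonoff applies to the box
  with factors the unit interval on \<sigma> and a point elsewhere. The simplex is its closed slice
  of coordinate sum 1.\<close>

lemma compact_closed_simplex:
  assumes X: "simplicial_complex X" and \<sigma>: "\<sigma> \<in> X"
  shows "compact (closed_simplex X \<sigma>)"
proof -
  have f: "finite \<sigma>" using assms unfolding simplicial_complex_def by blast
  let ?B = "PiE UNIV (\<lambda>v. if v \<in> \<sigma> then {0..1} else {0}) :: ('a \<Rightarrow> real) set"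
  have "compactin (product_topology (\<lambda>v::'a. euclidean) UNIV) ?B"
    unfolding compactin_PiE by auto
  then have cB: "compact ?B" unfolding euclidean_product_topology compactin_euclidean_iff .
  have "closed {x :: 'a \<Rightarrow> real. (\<Sum>v\<in>\<sigma>. x v) = 1}"
    by (intro closed_Collect_eq continuous_on_sum) auto
  then have "compact (?B \<inter> {x. (\<Sum>v\<in>\<sigma>. x v) = 1})" using cB by (rule compact_Int_closed[rotated])
  moreover have "closed_simplex X \<sigma> = ?B \<inter> {x. (\<Sum>v\<in>\<sigma>. x v) = 1}"
  proof (rule equalityI; rule subsetI)
    fix x assume "x \<in> closed_simplex X \<sigma>"
    then have x: "\<And>v. 0 \<le> x v" "(\<Sum>v\<in>support x. x v) = 1" "support x \<subseteq> \<sigma>"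
      unfolding closed_simplex_def realization_def by auto
    have s: "(\<Sum>v\<in>\<sigma>. x v) = 1"
      using x(2) sum.mono_neutral_left[OF f x(3), of x] by (simp add: support_def)
    have "x v \<le> 1" if "v \<in> \<sigma>" for v using member_le_sum[OF that, of x] x(1) f s by simp
    moreover have "x v = 0" if "v \<notin> \<sigma>" for v using that x(3) unfolding support_def by blast
    ultimately show "x \<in> ?B \<inter> {x. (\<Sum>v\<in>\<sigma>. x v) = 1}" using x(1) s by auto
  next
    fix x assume "x \<in> ?B \<inter> {x. (\<Sum>v\<in>\<sigma>. x v) = 1}"
    then have xB: "x \<in> ?B" and s: "(\<Sum>v\<in>\<sigma>. x v) = 1" by simp_all
    note B = PiE_mem[OF xB UNIV_I]
    have x0: "0 \<le> x v" for v using B[of v] by (auto split: if_splits)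
    have sub: "support x \<subseteq> \<sigma>" using B unfolding support_def by (metis (mono_tags, lifting) mem_Collect_eq singletonD subsetI)
    have s': "(\<Sum>v\<in>support x. x v) = 1"
      using s sum.mono_neutral_left[OF f sub, of x] by (simp add: support_def)
    then have "support x \<noteq> {}" by auto
    then have "support x \<in> X" using X \<sigma> sub unfolding simplicial_complex_def by blast
    then show "x \<in> closed_simplex X \<sigma>" unfolding closed_simplex_def realization_def using x0 s' sub by blast
  qed
  ultimately show ?thesis by simp
qed

lemma compactin_closed_simplex:
  assumes X: "simplicial_complex X" and \<sigma>: "\<sigma> \<in> X"
  shows "compactin (realization_topology X) (closed_simplex X \<sigma>)"
proof -
  let ?C = "closed_simplex X \<sigma>"
  have "continuous_map (top_of_set ?C) (realization_topology X) id"
    unfolding continuous_map_def topspace_realization_topology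
  proof (intro conjI allI impI)
    show "id \<in> topspace (top_of_set ?C) \<rightarrow> realization X" using closed_simplex_subset[of X \<sigma>] by auto
    fix U assume "openin (realization_topology X) U"
    then have "openin (top_of_set ?C) (U \<inter> ?C)" using \<sigma> unfolding openin_realization_topology by blast
    moreover have "{x \<in> topspace (top_of_set ?C). id x \<in> U} = U \<inter> ?C" by auto
    ultimately show "openin (top_of_set ?C) {x \<in> topspace (top_of_set ?C). id x \<in> U}" by simp
  qed
  moreover have "compactin (top_of_set ?C) ?C"
    using compact_closed_simplex[OF X \<sigma>] by (simp add: compactin_subtopology)
  ultimately have "compactin (realization_topology X) (id ` ?C)" by (rule image_compactin[rotated])
  then show ?thesis by simp
qed

lemma realization_map_inj:
  assumes "inj_on f (support x)" "finite (support x)"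
  shows "v \<in> support x \<Longrightarrow> realization_map f x (f v) = x v"
    and "u \<notin> f ` support x \<Longrightarrow> realization_map f x u = 0"
proof -
  assume v: "v \<in> support x"
  then have "{v' \<in> support x. f v' = f v} = {v}" using assms(1) by (auto dest: inj_onD)
  then show "realization_map f x (f v) = x v" unfolding realization_map_def by simp
next
  assume "u \<notin> f ` support x"
  then have e: "{v \<in> support x. f v = u} = {}" by blast
  show "realization_map f x u = 0" unfolding realization_map_def e by simp
qed

lemma support_realization_map:
  assumes "inj_on f (support x)" "finite (support x)"
  shows "support (realization_map f x) = f ` support x"
proof -
  have "u \<in> support (realization_map f x) \<longleftrightarrow> u \<in> f ` support x" for u
    using realization_map_inj[OF assms] unfolding support_def by force
  then show ?thesis by blast
qed

lemma realization_map_closed: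
  assumes x: "x \<in> realization X" and f: "inj_on f (support x)" "finite (support x)" "f ` support x \<in> Y"
  shows "realization_map f x \<in> realization Y"
  unfolding realization_def
proof (intro CollectI conjI allI)
  note s = support_realization_map[OF f(1,2)]
  show "support (realization_map f x) \<in> Y" using s f(3) by simp
  show "0 \<le> realization_map f x u" for u
    unfolding realization_map_def using realization_support(2)[OF x] by (intro sum_nonneg) blast
  have "(\<Sum>u\<in>f ` support x. realization_map f x u) = (\<Sum>v\<in>support x. x v)"
    unfolding sum.reindex[OF f(1)] o_def using realization_map_inj(1)[OF f(1,2)] by (intro sum.cong) simp_all
  then show "(\<Sum>u\<in>support (realization_map f x). realization_map f x u) = 1"
    using s realization_support(3)[OF x] by simp
qed

text \<open>\<open>Bij\<close> consists of extensional maps, hence the restriction of left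
  multiplication to the carrier.\<close>

lemma (in group) group_action_mult:
  "group_action G (carrier G) (\<lambda>g. \<lambda>h\<in>carrier G. g \<otimes> h)"
proof -
  let ?\<phi> = "\<lambda>g. \<lambda>h\<in>carrier G. g \<otimes> h"
  have bij: "?\<phi> g \<in> Bij (carrier G)" if g: "g \<in> carrier G" for g
  proof -
    have "bij_betw (?\<phi> g) (carrier G) (carrier G)"
    proof (rule bij_betw_byWitness[where f' = "?\<phi> (inv g)"])
      show "\<forall>a\<in>carrier G. ?\<phi> (inv g) (?\<phi> g a) = a" "\<forall>a\<in>carrier G. ?\<phi> g (?\<phi> (inv g) a) = a"
        using g by (simp_all flip: m_assoc)
    qed (use g in auto)
    then show ?thesis unfolding Bij_def by simp
  qed
  have "?\<phi> (g \<otimes> h) = compose (carrier G) (?\<phi> g) (?\<phi> h)" if "g \<in> carrier G" "h \<in> carrier G" for g h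
    using that by (auto simp: compose_def m_assoc)
  then have "?\<phi> \<in> hom G (BijGroup (carrier G))"
    using bij unfolding hom_def BijGroup_def by auto
  then show ?thesis
    unfolding group_action_def group_hom_def group_hom_axioms_def using group_BijGroup is_group by blast
qed

context finite_flag_nerve
begin

lemma Th_translate:
  assumes g: "g \<in> carrier W" and \<sigma>: "\<sigma> \<in> Th"
  shows "(\<lambda>A. g \<otimes>\<^bsub>W\<^esub> A) ` \<sigma> \<in> Th"
proof -
  obtain A T where A: "A \<in> carrier W" "T \<in> faces" "\<sigma> \<subseteq> cube A T" "\<sigma> \<noteq> {}" using \<sigma> unfolding Th_iff by blast
  have "g \<otimes>\<^bsub>W\<^esub> (A \<otimes>\<^bsub>W\<^esub> w \<rho>) = g \<otimes>\<^bsub>W\<^esub> A \<otimes>\<^bsub>W\<^esub> w \<rho>" if "\<rho> \<subseteq> T" for \<rho>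
    using g A(1) w_closed[OF faces_subset[OF A(2) that]] by (simp add: W.m_assoc)
  then have "(\<lambda>A. g \<otimes>\<^bsub>W\<^esub> A) ` cube A T \<subseteq> cube (g \<otimes>\<^bsub>W\<^esub> A) T" unfolding cube_def by auto
  then have "(\<lambda>A. g \<otimes>\<^bsub>W\<^esub> A) ` \<sigma> \<subseteq> cube (g \<otimes>\<^bsub>W\<^esub> A) T" using A(3) by blast
  moreover have "g \<otimes>\<^bsub>W\<^esub> A \<in> carrier W" using g A(1) by simp
  ultimately show ?thesis unfolding Th_iff using A(2,4) by blast
qed

definition act :: "'a list set \<Rightarrow> 'a list set \<Rightarrow> 'a list set" where
  "act g = (\<lambda>A\<in>carrier W. g \<otimes>\<^bsub>W\<^esub> A)"

lemma act_image: "\<sigma> \<subseteq> carrier W \<Longrightarrow> act g ` \<sigma> = (\<lambda>A. g \<otimes>\<^bsub>W\<^esub> A) ` \<sigma>"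
  unfolding act_def by (rule image_cong) auto

lemma Th_carrier: "\<sigma> \<in> Th \<Longrightarrow> \<sigma> \<subseteq> carrier W"
  using vertices_Th by blast

lemma act_simplex: "g \<in> carrier W \<Longrightarrow> \<sigma> \<in> Th \<Longrightarrow> act g ` \<sigma> \<in> Th"
  using Th_translate act_image[OF Th_carrier] by metis

lemma act_inv: "g \<in> carrier W \<Longrightarrow> A \<in> carrier W \<Longrightarrow> act g (act (inv\<^bsub>W\<^esub> g) A) = A"
  unfolding act_def by (simp flip: W.m_assoc)

lemma inj_on_act: "g \<in> carrier W \<Longrightarrow> S \<subseteq> carrier W \<Longrightarrow> inj_on (act g) S"
  unfolding act_def by (rule inj_onI) (simp add: subset_iff)

text \<open>Vertices are group elements, so the action on them is free. A compact set involves
  finitely many vertices, and \<open>g\<close> is determined by one vertex and its image: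
  properness. Every simplex lies in a translate of one of the finitely many cubes at the identity:
  cocompactness.\<close>

lemma geometric_action_Th: "geometric_action W Th act"
  unfolding geometric_action_def
proof (intro conjI ballI allI impI)
  show sc: "simplicial_complex Th" using flag_Th unfolding flag_complex_def by blast
  show "group_action W (\<Union>Th) act" unfolding vertices_Th act_def by (rule W.group_action_mult)
  have supp: "support x \<in> Th" "finite (support x)" "support x \<noteq> {}" "support x \<subseteq> carrier W" if "x \<in> realization Th" for x
    using realization_support(1)[OF that] flag_simplexD(1,2)[OF flag_Th] Th_carrier by blast+
  have map_supp: "support (realization_map (act g) x) = act g ` support x"
    if "g \<in> carrier W" "x \<in> realization Th" for g x
    using support_realization_map[OF inj_on_act] supp[OF that(2)] that(1) by blast
  have map_closed: "realization_map (act g) x \<in> realization Th" if "g \<in> carrier W" "x \<in> realization Th" for g x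
    using realization_map_closed[OF that(2) inj_on_act] act_simplex supp[OF that(2)] that(1) by blast
  {
    fix g assume g: "g \<in> carrier W"
    show "(\<lambda>\<sigma>. act g ` \<sigma>) ` Th = Th"
    proof (rule equalityI; rule subsetI)
      fix \<sigma> assume "\<sigma> \<in> (\<lambda>\<sigma>. act g ` \<sigma>) ` Th"
      then show "\<sigma> \<in> Th" using act_simplex[OF g] by blast
    next
      fix \<sigma> assume \<sigma>: "\<sigma> \<in> Th"
      have "act g ` act (inv\<^bsub>W\<^esub> g) ` \<sigma> = \<sigma>"
        unfolding image_image using act_inv[OF g] Th_carrier[OF \<sigma>] by (simp add: subset_iff)
      moreover have "act (inv\<^bsub>W\<^esub> g) ` \<sigma> \<in> Th" using act_simplex \<sigma> g by simp
      ultimately show "\<sigma> \<in> (\<lambda>\<sigma>. act g ` \<sigma>) ` Th" by (metis image_eqI)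
    qed
  }
  {
    fix K assume K: "compactin (realization_topology Th) K"
    let ?F = "\<Union>(support ` K)"
    have KR: "K \<subseteq> realization Th" using compactin_subset_topspace[OF K] unfolding topspace_realization_topology .
    have "finite ?F" by (rule compactin_finite_support[OF sc K])
    then have "finite ((\<lambda>(a, b). b \<otimes>\<^bsub>W\<^esub> inv\<^bsub>W\<^esub> a) ` (?F \<times> ?F))" by simp
    moreover have "{g \<in> carrier W. realization_map (act g) ` K \<inter> K \<noteq> {}} \<subseteq> (\<lambda>(a, b). b \<otimes>\<^bsub>W\<^esub> inv\<^bsub>W\<^esub> a) ` (?F \<times> ?F)"
    proof
      fix g assume "g \<in> {g \<in> carrier W. realization_map (act g) ` K \<inter> K \<noteq> {}}"
      then obtain x where g: "g \<in> carrier W" and x: "x \<in> K" "realization_map (act g) x \<in> K" by blast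
      have xR: "x \<in> realization Th" using x(1) KR by blast
      obtain a where a: "a \<in> support x" using supp(3)[OF xR] by blast
      have ac: "a \<in> carrier W" using a supp(4)[OF xR] by blast
      have "act g a \<in> support (realization_map (act g) x)" using map_supp[OF g xR] a by blast
      then have "act g a \<in> ?F" "a \<in> ?F" using x a by blast+
      moreover have "g = act g a \<otimes>\<^bsub>W\<^esub> inv\<^bsub>W\<^esub> a" unfolding act_def using g ac by (simp add: W.m_assoc)
      ultimately show "g \<in> (\<lambda>(a, b). b \<otimes>\<^bsub>W\<^esub> inv\<^bsub>W\<^esub> a) ` (?F \<times> ?F)"
        by (intro image_eqI[of _ _ "(a, act g a)"]) auto
    qed
    ultimately show "finite {g \<in> carrier W. realization_map (act g) ` K \<inter> K \<noteq> {}}" by (rule finite_subset[rotated])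
  }
  let ?K = "\<Union>T\<in>faces. closed_simplex Th (cube \<one>\<^bsub>W\<^esub> T)"
  have "compactin (realization_topology Th) ?K"
  proof (rule compactin_Union)
    show "finite ((\<lambda>T. closed_simplex Th (cube \<one>\<^bsub>W\<^esub> T)) ` faces)" using finite_faces by simp
    fix S assume "S \<in> (\<lambda>T. closed_simplex Th (cube \<one>\<^bsub>W\<^esub> T)) ` faces"
    then obtain T where T: "T \<in> faces" "S = closed_simplex Th (cube \<one>\<^bsub>W\<^esub> T)" by blast
    have "cube \<one>\<^bsub>W\<^esub> T \<noteq> {}" unfolding cube_def by blast
    then have "cube \<one>\<^bsub>W\<^esub> T \<in> Th" unfolding Th_iff using T(1) W.one_closed by blast
    then show "compactin (realization_topology Th) S" unfolding T(2) by (rule compactin_closed_simplex[OF sc])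
  qed
  moreover have "(\<Union>g\<in>carrier W. realization_map (act g) ` ?K) = realization Th"
  proof (rule equalityI; rule subsetI)
    fix y assume "y \<in> (\<Union>g\<in>carrier W. realization_map (act g) ` ?K)"
    then obtain g x T where "g \<in> carrier W" "x \<in> closed_simplex Th (cube \<one>\<^bsub>W\<^esub> T)" "y = realization_map (act g) x" by blast
    then show "y \<in> realization Th" using map_closed closed_simplex_subset by blast
  next
    fix y assume y: "y \<in> realization Th"
    obtain A T where A: "A \<in> carrier W" "T \<in> faces" "support y \<subseteq> cube A T" using supp(1)[OF y] unfolding Th_iff by blast
    define x where "x = realization_map (act (inv\<^bsub>W\<^esub> A)) y"
    have A': "inv\<^bsub>W\<^esub> A \<in> carrier W" using A(1) by simp
    have xR: "x \<in> realization Th" unfolding x_def by (rule map_closed[OF A' y])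
    have sx: "support x = act (inv\<^bsub>W\<^esub> A) ` support y" unfolding x_def by (rule map_supp[OF A' y])
    have "act (inv\<^bsub>W\<^esub> A) B \<in> cube \<one>\<^bsub>W\<^esub> T" if B: "B \<in> cube A T" for B
    proof -
      obtain \<rho> where \<rho>: "\<rho> \<subseteq> T" "B = A \<otimes>\<^bsub>W\<^esub> w \<rho>" using B unfolding cube_def by blast
      have c: "w \<rho> \<in> carrier W" using w_closed[OF faces_subset[OF A(2) \<rho>(1)]] .
      have "act (inv\<^bsub>W\<^esub> A) B = \<one>\<^bsub>W\<^esub> \<otimes>\<^bsub>W\<^esub> w \<rho>"
        unfolding act_def \<rho>(2) using A(1) c by (simp flip: W.m_assoc)
      then show ?thesis unfolding cube_def using \<rho>(1) by blast
    qed
    then have "support x \<subseteq> cube \<one>\<^bsub>W\<^esub> T" unfolding sx using A(3) by blast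
    then have xK: "x \<in> ?K" unfolding closed_simplex_def using xR A(2) by blast
    have "realization_map (act A) x u = y u" for u
    proof (cases "u \<in> support y")
      case True
      let ?v = "act (inv\<^bsub>W\<^esub> A) u"
      have u: "act A ?v = u" using act_inv[OF A(1)] True supp(4)[OF y] by blast
      have "realization_map (act A) x (act A ?v) = x ?v"
        by (rule realization_map_inj(1)[OF inj_on_act[OF A(1) supp(4)[OF xR]] supp(2)[OF xR]]) (use sx True in blast)
      also have "x ?v = y u" unfolding x_def
        by (rule realization_map_inj(1)[OF inj_on_act[OF A' supp(4)[OF y]] supp(2)[OF y] True])
      finally show ?thesis unfolding u .
    next
      case False
      have "act A ` support x = support y"
        unfolding sx image_image using act_inv[OF A(1)] supp(4)[OF y] by (simp add: subset_iff)
      then have "realization_map (act A) x u = 0"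
        using realization_map_inj(2)[OF inj_on_act[OF A(1) supp(4)[OF xR]] supp(2)[OF xR]] False by simp
      then show ?thesis using False unfolding support_def by simp
    qed
    then have "y = realization_map (act A) x" by auto
    then show "y \<in> (\<Union>g\<in>carrier W. realization_map (act g) ` ?K)" using A(1) xK by blast
  qed
  ultimately show "\<exists>K. compactin (realization_topology Th) K \<and>
      (\<Union>g\<in>carrier W. realization_map (act g) ` K) = realization Th" by blast
qed

end

section \<open>The basic construction\<close>

context five_large_nerve
begin

text \<open>Two vertices with the same image differ by an element of \<open>H\<close>; a nontrivial
  one moves vertices by at least 5, so paths of length 3 cannot join them. Edges are lifted by
  translating by \<open>H\<close>.\<close>

lemma SD2_star_links_quotient:
  assumes H: "admissible_subgroup X H" and SD: "SD2_star_links X"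
    and Y: "flag_complex (thickening (davis_quotient X H))"
  shows "SD2_star_links (thickening (davis_quotient X H))"
proof -
  let ?Y = "thickening (davis_quotient X H)"
  let ?p = "\<lambda>A. H #>\<^bsub>W\<^esub> A"
  have sub: "subgroup H W" and far: "\<And>v h. v \<in> carrier W \<Longrightarrow> h \<in> H \<Longrightarrow> h \<noteq> \<one>\<^bsub>W\<^esub> \<Longrightarrow>
      5 \<le> skeleton_dist Th v (h \<otimes>\<^bsub>W\<^esub> v)"
    using H unfolding admissible_subgroup_def vertices_Th by blast+
  have HW: "h \<in> carrier W" if "h \<in> H" for h using sub that by (rule subgroup.mem_carrier)
  have Y_iff: "U \<in> ?Y \<longleftrightarrow> U \<noteq> {} \<and> (\<exists>A\<in>carrier W. \<exists>T\<in>faces. U \<subseteq> ?p ` cube A T)" for U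
    unfolding thickening_def davis_quotient_def davis_complex_cubes by blast
  have p_eq: "\<exists>h\<in>H. u = h \<otimes>\<^bsub>W\<^esub> v" if "u \<in> carrier W" "?p u = ?p v" for u v
  proof -
    have "u \<in> ?p v" using W.rcos_self[OF that(1) sub] that(2) by simp
    then show ?thesis unfolding r_coset_def by blast
  qed
  have p_translate: "?p (h \<otimes>\<^bsub>W\<^esub> v) = ?p v" if "h \<in> H" "v \<in> carrier W" for h v
  proof -
    have "h \<otimes>\<^bsub>W\<^esub> v \<in> ?p v" unfolding r_coset_def using that(1) by blast
    then show ?thesis using W.repr_independence[OF _ that(2) sub] by simp
  qed
  show ?thesis
  proof (rule SD2_star_links_covering[OF flag_Th Y SD2_star_links_Th[OF SD], of ?p])
    fix y assume "{y} \<in> ?Y"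
    then obtain A T where A: "A \<in> carrier W" "T \<in> faces" "y \<in> ?p ` cube A T" unfolding Y_iff by blast
    then obtain B where B: "B \<in> cube A T" "y = ?p B" by blast
    then have "{B} \<in> Th" unfolding Th_iff using A by blast
    then show "\<exists>x. {x} \<in> Th \<and> ?p x = y" using B(2) by blast
  next
    fix u y assume u: "{u} \<in> Th" and y: "{?p u, y} \<in> ?Y"
    have uc: "u \<in> carrier W" using u vertices_Th by blast
    obtain A T where A: "A \<in> carrier W" "T \<in> faces" "{?p u, y} \<subseteq> ?p ` cube A T" using y unfolding Y_iff by blast
    then have "?p u \<in> ?p ` cube A T" "y \<in> ?p ` cube A T" by simp_all
    then obtain u' x' where x: "u' \<in> cube A T" "?p u = ?p u'" "x' \<in> cube A T" "y = ?p x'"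
      by (elim imageE) simp
    have "{u', x'} \<in> Th" unfolding Th_iff using A x by blast
    \<comment> \<open>The cube over the given edge contains just some preimage \<open>u'\<close> of
      the orbit of \<open>u\<close>; translation by \<open>h\<close> moves the lifted edge so that
      it starts at \<open>u\<close>.\<close>
    obtain h where h: "h \<in> H" "u = h \<otimes>\<^bsub>W\<^esub> u'" using p_eq[OF uc x(2)] by blast
    have "(\<lambda>A. h \<otimes>\<^bsub>W\<^esub> A) ` {u', x'} \<in> Th" by (rule Th_translate[OF HW[OF h(1)] \<open>{u', x'} \<in> Th\<close>])
    then have "{u, h \<otimes>\<^bsub>W\<^esub> x'} \<in> Th" unfolding h(2) by simp
    moreover have "?p (h \<otimes>\<^bsub>W\<^esub> x') = y"
      using p_translate[OF h(1)] x cube_closed[OF A(1,2)] by (simp add: subset_iff)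
    ultimately show "\<exists>x. {u, x} \<in> Th \<and> ?p x = y" by blast
  next
    fix u v assume "{u, v} \<in> Th"
    then obtain A T where A: "A \<in> carrier W" "T \<in> faces" "{u, v} \<subseteq> cube A T" unfolding Th_iff by blast
    then have "{?p u, ?p v} \<subseteq> ?p ` cube A T" by blast
    then show "{?p u, ?p v} \<in> ?Y" unfolding Y_iff using A by blast
  next
    fix u a b v assume e: "{u, a} \<in> Th" "{a, b} \<in> Th" "{b, v} \<in> Th" and p: "?p u = ?p v"
    have c: "u \<in> carrier W" "v \<in> carrier W" using e vertices_Th by blast+
    obtain h where h: "h \<in> H" "v = h \<otimes>\<^bsub>W\<^esub> u" using p_eq[OF c(2)] p by metis
    show "u = v"
    proof (cases "h = \<one>\<^bsub>W\<^esub>")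
      case True then show ?thesis using h(2) c by simp
    next
      case False
      have "5 \<le> skeleton_dist Th u v" using far[OF c(1) h(1) False] h(2) by simp
      moreover have "skeleton_dist Th u v \<le> enat 3" by (rule skeleton_dist_path3[OF e])
      ultimately have "(5::enat) \<le> enat 3" by (rule order_trans)
      then have "enat 5 \<le> enat 3" by (simp add: numeral_eq_enat)
      then show ?thesis by simp
    qed
  qed
qed

end

lemma SD2_star_links_basic_step:
  assumes step: "basic_step X X'" and X': "flag_complex X'" and SD: "SD2_star_links X"
  shows "SD2_star_links X'"
proof -
  have "finite X" "five_large X" using step unfolding basic_step_def by blast+
  then interpret five_large_nerve X
    by unfold_locales (simp_all add: five_large_def)
  obtain H where H: "admissible_subgroup X H" "simplicial_iso (thickening (davis_quotient X H)) X'"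
    using step unfolding basic_step_def by blast
  have "flag_complex (thickening (davis_quotient X H))"
    by (rule flag_complex_iso[OF X' simplicial_iso_sym[OF H(2)]])
  then show ?thesis
    using SD2_star_links_iso[OF _ H(2)] SD2_star_links_quotient[OF H(1) SD] by blast
qed

text \<open>Flagness is passed backwards along the steps: the input of a step is 5-large by definition,
  and the last complex is 5-large by assumption.\<close>

lemma SD2_star_links_basic_steps:
  assumes "basic_step\<^sup>*\<^sup>* A B" and B: "flag_complex B"
  shows "flag_complex A \<and> (SD2_star_links A \<longrightarrow> SD2_star_links B)"
  using assms(1)
proof (induction rule: converse_rtranclp_induct)
  case base
  then show ?case using B by blast
next
  case (step A C)
  have "flag_complex A" using step(1) unfolding basic_step_def five_large_def by blast
  moreover have "SD2_star_links C" if "SD2_star_links A"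
    by (rule SD2_star_links_basic_step[OF step(1) _ that]) (use step.IH in blast)
  ultimately show ?case using step.IH by blast
qed

theorem proposition6p2:
  fixes X0 :: "'a set set" and X :: "'b set set"
  assumes "finite X0" and "five_large X0" and "SD2_star_links X0"
    and "finite X" and "five_large X"
    and "obtained_by_basic_steps X0 X"
  shows "SD2_star_links X \<and>
    (\<exists>(Z :: 'b list set set set) \<phi>.
       weakly_systolic Z \<and> SD2_star_links Z \<and> geometric_action (racg X) Z \<phi>)"
proof -
  obtain A B :: "nat set set" where AB: "simplicial_iso X0 A" "basic_step\<^sup>*\<^sup>* A B" "simplicial_iso B X"
    using assms(6) unfolding obtained_by_basic_steps_def by blast
  have flag: "flag_complex X0" "flag_complex X" using assms(2,5) unfolding five_large_def by blast+
  have B: "flag_complex B" by (rule flag_complex_iso[OF flag(2) simplicial_iso_sym[OF AB(3)]])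
  have "SD2_star_links A" by (rule SD2_star_links_iso[OF flag(1) AB(1) assms(3)])
  then have "SD2_star_links B" using SD2_star_links_basic_steps[OF AB(2) B] by blast
  then have SD: "SD2_star_links X" by (rule SD2_star_links_iso[OF B AB(3)])
  interpret five_large_nerve X
    by unfold_locales (use assms(4,5) flag in simp_all)
  \<comment> \<open>The complex acted on is the thickened Davis complex of the group with nerve
    \<open>X\<close>.\<close>
  show ?thesis using SD SD2_star_links_Th[OF SD] weakly_systolic_Th geometric_action_Th by blast
qed

end
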